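(* Let $(X,\ll,\leq,\mathfrak T)$ be a topological causal space and let $(H,G,\mathfrak m)$ be a synthetic null hypersurface in $X$ such that $H$ is null non-branching and $(H,G,\mathfrak m)$ satisfies the $\mathsf{NC}^e(N)$ condition ($N>1$). Assume that $H$ is future complete for $G$ and that $\operatorname{supp}\mathfrak m=H$. Let $S_1,S_2\subset H^\circ$ be two acausal sets with $S_1\subset J^-(S_2)$. Then $$\mathfrak m_G^+(S_1)\le\mathfrak m_G^+(S_2),$$ where the value $+\infty$ is admitted.
   Context: A causal space $(X,\ll,\le)$ is a set $X$ with a preorder $\le$ and a transitive relation $\ll$ contained in $\le$. A topological causal space $(X,\ll,\leq,\mathfrak T)$ is a causal space with a Polish topology $\mathfrak T$ induced by a separable proper metric (closed balls are compact), such that $J:=\{(x,y):x\le y\}$ is closed and $\{(x,y):x\ll y\}$ is open in $X\times X$. $J^{\pm}(S)$ are the causal future/past of $S$. A set is achronal if it contains no $x,y$ with $x\ll y$, and acausal if it contains no two distinct points $x,y$ with $x\le y$. A causal curve is a continuous $\gamma:I\to X$ ($I$ an interval) with $\gamma_s\le\gamma_t$ for all $s\le t$ (constant curves allowed). For a closed achronal set $H$: $\mathfrak a=\{m\in H:\nexists x\in H,\ x\le m,\ x\ne m\}$; $\mathfrak b=\{m\in H:\nexists x\in H,\ m\le x,\ x\neq m\}$; $H^\circ=H\setminus(\mathfrak a\cup\mathfrak b)$. A gauge for $H$ is a Borel map $G:H^\circ\to\mathbb R$ such that (1) for any injective causal curve $\gamma$ in $H^\circ$, $G\circ\gamma$ is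 strictly increasing and continuous; (2) for any causal $\gamma:[0,1]\to H$ with $\gamma((0,1))\subset H^\circ$, $\sup_{(0,1)}G\circ\gamma$ and $\inf_{(0,1)}G\circ\gamma$ are finite. A curve $\gamma:[0,1]\to H$ is $G$-causal if it is constant, or it is causal with $\gamma((0,1))\subset H^\circ$ and $G\circ\gamma|_{(0,1)}$ affine; $\mathrm{Caus}_G\subset C([0,1];H)$ is the set of $G$-causal curves. A synthetic null hypersurface is a triple $(H,G,\mathfrak m)$ with $H$ closed achronal, $G$ a gauge, and $\mathfrak m$ a non-negative Radon measure on $H$ with $\mathfrak m(\mathfrak a\cap\mathfrak b)=0$. $H$ is forward null non-branching if for every pair of injective causal curves $\gamma^1,\gamma^2:[0,1]\to H$ with $\gamma^1_0=\gamma^2_0$ and $\gamma^1_{1/2}=\gamma^2_{1/2}$, either $\gamma^1([0,1])\subset\gamma^2([0,1])$ or $\gamma^2([0,1])\subset\gamma^1([0,1])$; backward null non-branching if it is forward null non-branching for the reversed causal relations; null non-branching if both. $\Pi_\le(\mu_0,\mu_1)$: couplings $\pi$ of $\mu_0,\mu_1$ with $\pi(J)=1$. $\mathrm{OptGeo}^G(\mu_0,\mu_1)$: Borel probability measures $\nu$ on $C([0,1];H)$ with $(e_i)_\sharp\nu=\mu_i$, $i=0,1$ ($e_t$ evaluation at $t$), and $\nu(\mathrm{Caus}_G)=1$. $\mathrm{Ent}(\mu|\mathfrak m)=\int\rho\log\rho\,d\mathfrak m$ if $\mu=\rho\mathfrak m$ and $(\rho\log\rho)_+\in L^1(\mathfrak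 m)$, $+\infty$ otherwise; $\mathrm U_{N-1}(\mu|\mathfrak m)=\exp(-\mathrm{Ent}(\mu|\mathfrak m)/(N-1))$ ($=0$ if $\mathrm{Ent}=+\infty$). $\mathsf{NC}^e(N)$: for all Borel probability measures $\mu_0,\mu_1$ on $H$ with $\Pi_\le(\mu_0,\mu_1)\neq\emptyset$ there is $\nu\in\mathrm{OptGeo}^G(\mu_0,\mu_1)$ such that, with $\mu_t=(e_t)_\sharp\nu$, for all $t\in[0,1]$: $\mathrm U_{N-1}(\mu_t|\mathfrak m)\ge(1-t)\mathrm U_{N-1}(\mu_0|\mathfrak m)+t\,\mathrm U_{N-1}(\mu_1|\mathfrak m)$. ($\mathsf{NC}^e(N)$ implies that any $x\le y$ in $H$ are joined by a causal curve in $H$.) Flow: for $x\in H^\circ$, let $H^\circ_x=\{y\in H^\circ: x\le y\text{ or }y\le x\}$; $\Psi_G(x,t)$ is the unique $y\in H^\circ_x$ with $G(y)-G(x)=t$, when it exists (extended by continuity to the possible end-points of the ray). $H$ is future complete for $G$ if $\sup_{y\in J^+(z)\cap H^\circ}G(y)=\infty$ for all $z\in H^\circ$. Minkowski content: for $S\subset H$ and $\epsilon>0$, $S^+_\epsilon=\{x\in H^\circ:\Psi_G(x,-r)\in S\text{ for some }r\in(0,\epsilon)\}$ and $\mathfrak m^+_G(S)=\limsup_{\epsilon\to0^+}\mathfrak m(S^+_\epsilon)/\epsilon$. (It is tacitly assumed that the sets $S^+_\epsilon$ considered are $\mathfrak m$-measurable.) *)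

theory Defs
  imports "HOL-Probability.Probability"
begin

section \<open>Topological causal spaces\<close>

text \<open>
  \<open>ll\<close> and \<open>le\<close> are the chronological and the causal relation. The relation \<open>le\<close> is only a preorder.
  A topological causal space lives on a type of classes \<^class>\<open>polish_space\<close> and \<^class>\<open>heine_borel\<close>:
  a complete separable metric in which bounded closed sets, hence closed balls, are compact.
\<close>

locale causal_space =
  fixes ll le :: "'a \<Rightarrow> 'a \<Rightarrow> bool"
  assumes le_reflp: "reflp le"
    and le_transp: "transp le"
    and ll_transp: "transp ll"
    and ll_imp_le: "ll x y \<Longrightarrow> le x y"

locale topological_causal_space = causal_space ll le
  for ll le :: "'a::{polish_space, heine_borel} \<Rightarrow> 'a \<Rightarrow> bool" +
  assumes closed_le: "closed {(x, y). le x y}"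
    and open_ll: "open {(x, y). ll x y}"

definition causal_future :: "('a \<Rightarrow> 'a \<Rightarrow> bool) \<Rightarrow> 'a set \<Rightarrow> 'a set" where
  "causal_future le S = {y. \<exists>x\<in>S. le x y}"

definition causal_past :: "('a \<Rightarrow> 'a \<Rightarrow> bool) \<Rightarrow> 'a set \<Rightarrow> 'a set" where
  "causal_past le S = {x. \<exists>y\<in>S. le x y}"

definition achronal :: "('a \<Rightarrow> 'a \<Rightarrow> bool) \<Rightarrow> 'a set \<Rightarrow> bool" where
  "achronal ll S \<longleftrightarrow> \<not> (\<exists>x\<in>S. \<exists>y\<in>S. ll x y)"

definition acausal :: "('a \<Rightarrow> 'a \<Rightarrow> bool) \<Rightarrow> 'a set \<Rightarrow> bool" where
  "acausal le S \<longleftrightarrow> \<not> (\<exists>x\<in>S. \<exists>y\<in>S. x \<noteq> y \<and> le x y)"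

definition causal_curve ::
    "('a::topological_space \<Rightarrow> 'a \<Rightarrow> bool) \<Rightarrow> real set \<Rightarrow> (real \<Rightarrow> 'a) \<Rightarrow> bool" where
  "causal_curve le I \<gamma> \<longleftrightarrow>
     is_interval I \<and> continuous_on I \<gamma> \<and> (\<forall>s\<in>I. \<forall>t\<in>I. s \<le> t \<longrightarrow> le (\<gamma> s) (\<gamma> t))"


section \<open>Synthetic null hypersurfaces\<close>

definition initial_points :: "('a \<Rightarrow> 'a \<Rightarrow> bool) \<Rightarrow> 'a set \<Rightarrow> 'a set" where
  "initial_points le H = {m \<in> H. \<not> (\<exists>x\<in>H. le x m \<and> x \<noteq> m)}"

definition final_points :: "('a \<Rightarrow> 'a \<Rightarrow> bool) \<Rightarrow> 'a set \<Rightarrow> 'a set" where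
  "final_points le H = {m \<in> H. \<not> (\<exists>x\<in>H. le m x \<and> x \<noteq> m)}"

definition causal_interior :: "('a \<Rightarrow> 'a \<Rightarrow> bool) \<Rightarrow> 'a set \<Rightarrow> 'a set" where
  "causal_interior le H = H - (initial_points le H \<union> final_points le H)"

text \<open>The values of a gauge outside \<^term>\<open>causal_interior le H\<close> are irrelevant.\<close>

definition gauge_for ::
    "('a::topological_space \<Rightarrow> 'a \<Rightarrow> bool) \<Rightarrow> 'a set \<Rightarrow> ('a \<Rightarrow> real) \<Rightarrow> bool" where
  "gauge_for le H G \<longleftrightarrow>
     G \<in> borel_measurable (restrict_space borel (causal_interior le H)) \<and>
     (\<forall>I \<gamma>. causal_curve le I \<gamma> \<and> inj_on \<gamma> I \<and> \<gamma> ` I \<subseteq> causal_interior le H \<longrightarrow>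
        strict_mono_on I (G \<circ> \<gamma>) \<and> continuous_on I (G \<circ> \<gamma>)) \<and>
     (\<forall>\<gamma>. causal_curve le {0..1} \<gamma> \<and> \<gamma> ` {0..1} \<subseteq> H \<and>
        \<gamma> ` {0<..<1} \<subseteq> causal_interior le H \<longrightarrow>
        bdd_above ((G \<circ> \<gamma>) ` {0<..<1}) \<and> bdd_below ((G \<circ> \<gamma>) ` {0<..<1}))"

text \<open>Measures on \<open>H\<close> are measures with space \<open>H\<close> on its (relative) Borel sets.\<close>

abbreviation borel_on :: "'a::topological_space set \<Rightarrow> 'a measure" where
  "borel_on H \<equiv> restrict_space borel H"

definition radon_on :: "'a::topological_space set \<Rightarrow> 'a measure \<Rightarrow> bool" where
  "radon_on H m \<longleftrightarrow>
     sets m = sets (borel_on H) \<and>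
     (\<forall>x\<in>H. \<exists>U. open U \<and> x \<in> U \<and> emeasure m (U \<inter> H) < \<infinity>) \<and>
     (\<forall>A\<in>sets m. emeasure m A = (SUP K\<in>{K. compact K \<and> K \<subseteq> A}. emeasure m K))"

definition measure_support :: "'a::topological_space measure \<Rightarrow> 'a set" where
  "measure_support m =
     {x \<in> space m. \<forall>U. open U \<and> x \<in> U \<longrightarrow> emeasure m (U \<inter> space m) > 0}"

locale synthetic_null_hypersurface = topological_causal_space ll le
  for ll le :: "'a::{polish_space, heine_borel} \<Rightarrow> 'a \<Rightarrow> bool" +
  fixes H :: "'a set" and G :: "'a \<Rightarrow> real" and m :: "'a measure"
  assumes closed_H: "closed H"
    and achronal_H: "achronal ll H"
    and gauge_G: "gauge_for le H G"
    and radon_m: "radon_on H m"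
    and null_initial_final: "initial_points le H \<inter> final_points le H \<in> null_sets m"

definition forward_null_nonbranching ::
    "('a::topological_space \<Rightarrow> 'a \<Rightarrow> bool) \<Rightarrow> 'a set \<Rightarrow> bool" where
  "forward_null_nonbranching le H \<longleftrightarrow>
     (\<forall>\<gamma>1 \<gamma>2.
        causal_curve le {0..1} \<gamma>1 \<and> inj_on \<gamma>1 {0..1} \<and> \<gamma>1 ` {0..1} \<subseteq> H \<and>
        causal_curve le {0..1} \<gamma>2 \<and> inj_on \<gamma>2 {0..1} \<and> \<gamma>2 ` {0..1} \<subseteq> H \<and>
        \<gamma>1 0 = \<gamma>2 0 \<and> \<gamma>1 (1/2) = \<gamma>2 (1/2) \<longrightarrow>
        \<gamma>1 ` {0..1} \<subseteq> \<gamma>2 ` {0..1} \<or> \<gamma>2 ` {0..1} \<subseteq> \<gamma>1 ` {0..1})"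

definition null_nonbranching ::
    "('a::topological_space \<Rightarrow> 'a \<Rightarrow> bool) \<Rightarrow> 'a set \<Rightarrow> bool" where
  "null_nonbranching le H \<longleftrightarrow>
     forward_null_nonbranching le H \<and> forward_null_nonbranching (\<lambda>x y. le y x) H"


section \<open>Optimal transport along the hypersurface\<close>

text \<open>
  \<open>C([0,1];H)\<close> with the supremum metric. Its elements are functions on \<^typ>\<open>real\<close> that are
  \<^const>\<open>undefined\<close> outside the unit interval.
\<close>

definition curve_space :: "'a::metric_space set \<Rightarrow> (real \<Rightarrow> 'a) metric" where
  "curve_space H = cfunspace (top_of_set {0..1}) (submetric euclidean_metric H)"

definition curve_borel :: "'a::metric_space set \<Rightarrow> (real \<Rightarrow> 'a) measure" where
  "curve_borel H = sigma (mspace (curve_space H)) {U. openin (mtopology_of (curve_space H)) U}"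

definition G_causal_curves ::
    "('a::metric_space \<Rightarrow> 'a \<Rightarrow> bool) \<Rightarrow> 'a set \<Rightarrow> ('a \<Rightarrow> real) \<Rightarrow> (real \<Rightarrow> 'a) set" where
  "G_causal_curves le H G =
     {\<gamma> \<in> mspace (curve_space H).
        (\<exists>x. \<forall>t\<in>{0..1}. \<gamma> t = x) \<or>
        (causal_curve le {0..1} \<gamma> \<and> \<gamma> ` {0<..<1} \<subseteq> causal_interior le H \<and>
         (\<exists>a b. \<forall>t\<in>{0<..<1}. G (\<gamma> t) = a + b * t))}"

text \<open>
  Concentration of a probability measure on a set (\<open>\<pi>(J) = 1\<close>, \<open>\<nu>(Caus\<^sub>G) = 1\<close>) is expressed by
  the almost-everywhere quantifier.
\<close>

definition causal_couplings ::
    "('a::topological_space \<Rightarrow> 'a \<Rightarrow> bool) \<Rightarrow> 'a set \<Rightarrow> 'a measure \<Rightarrow> 'a measure \<Rightarrow>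
     ('a \<times> 'a) measure set" where
  "causal_couplings le H \<mu>0 \<mu>1 =
     {\<pi>. prob_space \<pi> \<and> sets \<pi> = sets (borel_on H \<Otimes>\<^sub>M borel_on H) \<and>
         distr \<pi> (borel_on H) fst = \<mu>0 \<and> distr \<pi> (borel_on H) snd = \<mu>1 \<and>
         (AE p in \<pi>. le (fst p) (snd p))}"

definition OptGeo ::
    "('a::metric_space \<Rightarrow> 'a \<Rightarrow> bool) \<Rightarrow> 'a set \<Rightarrow> ('a \<Rightarrow> real) \<Rightarrow> 'a measure \<Rightarrow> 'a measure \<Rightarrow>
     (real \<Rightarrow> 'a) measure set" where
  "OptGeo le H G \<mu>0 \<mu>1 =
     {\<nu>. prob_space \<nu> \<and> sets \<nu> = sets (curve_borel H) \<and>
         distr \<nu> (borel_on H) (\<lambda>\<gamma>. \<gamma> 0) = \<mu>0 \<and> distr \<nu> (borel_on H) (\<lambda>\<gamma>. \<gamma> 1) = \<mu>1 \<and>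
         (AE \<gamma> in \<nu>. \<gamma> \<in> G_causal_curves le H G)}"

text \<open>
  The density \<open>\<rho>\<close> is \<^term>\<open>RN_deriv m \<mu>\<close>; the first condition says that a density exists. The
  function \<^const>\<open>ennreal\<close> truncates negative reals to zero, so the two integrals are those of the
  positive and negative part of \<open>\<rho> log \<rho>\<close>. The entropy may be \<open>-\<infinity>\<close>.
\<close>

definition Ent :: "'a measure \<Rightarrow> 'a measure \<Rightarrow> ereal" where
  "Ent \<mu> m =
     (let h = (\<lambda>x. enn2real (RN_deriv m \<mu> x) * ln (enn2real (RN_deriv m \<mu> x)))
      in if density m (RN_deriv m \<mu>) = \<mu> \<and> (\<integral>\<^sup>+x. ennreal (h x) \<partial>m) < \<infinity>
         then enn2ereal (\<integral>\<^sup>+x. ennreal (h x) \<partial>m) - enn2ereal (\<integral>\<^sup>+x. ennreal (- h x) \<partial>m)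
         else \<infinity>)"

text \<open>\<open>exp (- Ent \<mu> m / K)\<close>, with \<open>exp (-\<infinity>) = 0\<close> and \<open>exp \<infinity> = \<infinity>\<close>.\<close>

definition U_ent :: "real \<Rightarrow> 'a measure \<Rightarrow> 'a measure \<Rightarrow> ennreal" where
  "U_ent K \<mu> m =
     (case Ent \<mu> m of ereal r \<Rightarrow> ennreal (exp (- r / K)) | PInfty \<Rightarrow> 0 | MInfty \<Rightarrow> \<infinity>)"

definition NCe ::
    "('a::metric_space \<Rightarrow> 'a \<Rightarrow> bool) \<Rightarrow> 'a set \<Rightarrow> ('a \<Rightarrow> real) \<Rightarrow> 'a measure \<Rightarrow> real \<Rightarrow> bool" where
  "NCe le H G m N \<longleftrightarrow>
     (\<forall>\<mu>0 \<mu>1.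
        prob_space \<mu>0 \<and> sets \<mu>0 = sets (borel_on H) \<and>
        prob_space \<mu>1 \<and> sets \<mu>1 = sets (borel_on H) \<and>
        causal_couplings le H \<mu>0 \<mu>1 \<noteq> {} \<longrightarrow>
        (\<exists>\<nu>\<in>OptGeo le H G \<mu>0 \<mu>1. \<forall>t\<in>{0..1}.
           U_ent (N - 1) (distr \<nu> (borel_on H) (\<lambda>\<gamma>. \<gamma> t)) m
             \<ge> ennreal (1 - t) * U_ent (N - 1) \<mu>0 m + ennreal t * U_ent (N - 1) \<mu>1 m))"


section \<open>The gauge flow and the Minkowski content\<close>

definition ray_of :: "('a \<Rightarrow> 'a \<Rightarrow> bool) \<Rightarrow> 'a set \<Rightarrow> 'a \<Rightarrow> 'a set" where
  "ray_of le H x = {y \<in> causal_interior le H. le x y \<or> le y x}"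

definition flow_times ::
    "('a \<Rightarrow> 'a \<Rightarrow> bool) \<Rightarrow> 'a set \<Rightarrow> ('a \<Rightarrow> real) \<Rightarrow> 'a \<Rightarrow> real set" where
  "flow_times le H G x = {t. \<exists>!y. y \<in> ray_of le H x \<and> G y - G x = t}"

definition flow_point ::
    "('a \<Rightarrow> 'a \<Rightarrow> bool) \<Rightarrow> 'a set \<Rightarrow> ('a \<Rightarrow> real) \<Rightarrow> 'a \<Rightarrow> real \<Rightarrow> 'a" where
  "flow_point le H G x t = (THE y. y \<in> ray_of le H x \<and> G y - G x = t)"

text \<open>
  \<open>flows_to le H G x t y\<close> means that \<open>\<Psi>\<^sub>G(x, t)\<close> is defined and equals \<open>y\<close>. The second disjunct is
  the extension by continuity to the end-points of the ray, which in general lie in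
  \<^term>\<open>H - causal_interior le H\<close>.
\<close>

definition flows_to ::
    "('a::topological_space \<Rightarrow> 'a \<Rightarrow> bool) \<Rightarrow> 'a set \<Rightarrow> ('a \<Rightarrow> real) \<Rightarrow> 'a \<Rightarrow> real \<Rightarrow> 'a \<Rightarrow> bool" where
  "flows_to le H G x t y \<longleftrightarrow>
     (let T = flow_times le H G x
      in (t \<in> T \<and> y = flow_point le H G x t) \<or>
         (((\<forall>s\<in>T. s < t) \<or> (\<forall>s\<in>T. t < s)) \<and> t islimpt T \<and>
          (flow_point le H G x \<longlongrightarrow> y) (at t within T)))"

definition future_complete ::
    "('a \<Rightarrow> 'a \<Rightarrow> bool) \<Rightarrow> 'a set \<Rightarrow> ('a \<Rightarrow> real) \<Rightarrow> bool" where
  "future_complete le H G \<longleftrightarrow>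
     (\<forall>z\<in>causal_interior le H.
        (SUP y\<in>causal_future le {z} \<inter> causal_interior le H. ereal (G y)) = \<infinity>)"

definition forward_thickening ::
    "('a::topological_space \<Rightarrow> 'a \<Rightarrow> bool) \<Rightarrow> 'a set \<Rightarrow> ('a \<Rightarrow> real) \<Rightarrow> 'a set \<Rightarrow> real \<Rightarrow> 'a set" where
  "forward_thickening le H G S \<epsilon> =
     {x \<in> causal_interior le H. \<exists>r\<in>{0<..<\<epsilon>}. \<exists>y\<in>S. flows_to le H G x (- r) y}"

text \<open>
  The thickenings need only be measurable with respect to \<open>m\<close>, that is, up to subsets of
  \<open>m\<close>-null Borel sets; hence the completion of \<open>m\<close>.
\<close>

definition minkowski_measurable ::
    "('a::topological_space \<Rightarrow> 'a \<Rightarrow> bool) \<Rightarrow> 'a set \<Rightarrow> ('a \<Rightarrow> real) \<Rightarrow> 'a measure \<Rightarrow> 'a set \<Rightarrow> bool" where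
  "minkowski_measurable le H G m S \<longleftrightarrow>
     (\<forall>\<epsilon>>0. forward_thickening le H G S \<epsilon> \<in> sets (completion m))"

definition minkowski_content ::
    "('a::topological_space \<Rightarrow> 'a \<Rightarrow> bool) \<Rightarrow> 'a set \<Rightarrow> ('a \<Rightarrow> real) \<Rightarrow> 'a measure \<Rightarrow> 'a set \<Rightarrow> ennreal" where
  "minkowski_content le H G m S =
     Limsup (at_right 0)
       (\<lambda>\<epsilon>. emeasure (completion m) (forward_thickening le H G S \<epsilon>) / ennreal \<epsilon>)"

end

theory Submission
  imports Defs
begin

text \<open>
  Non-branching together with \<open>NC\<^sup>e(N)\<close> makes the causal relation a partial order on \<open>H\<close> whose
  restriction to the future or the past of an interior point is total, so the interior is a disjoint
  union of rays, unbounded to the future in the gauge. The points of \<open>S1\<close>, \<open>S2\<close> on a common ray are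
  unique; write \<open>\<tau> \<ge> 0\<close> for their gauge distance. The claim holds before passing to the limit: the
  thickening of \<open>S1\<close> of width \<open>\<epsilon>\<close> has at most the measure of the one of \<open>S2\<close>. Indeed, transport the
  normalised measure on \<open>A\<close> inside the first thickening to points whose gauge distance to \<open>S1\<close> lies in
  \<open>(\<tau>/t, \<tau>/t + \<epsilon>)\<close>. At time \<open>t\<close> the mass has arrived in the thickening of \<open>S2\<close>, whatever the
  coupling is. By Jensen's inequality \<open>NC\<^sup>e(N)\<close> bounds the measure of the latter below by
  \<open>(1 - t)\<^bsup>N - 1\<^esup> m(A)\<close>; let \<open>t\<close> tend to \<open>0\<close>.

  The only difficulty is that \<open>\<tau>\<close> is not known to be measurable on \<open>A\<close>. It is measurable on the strict future of
  \<open>S2\<close>, and a first transport, to far away in the future, carries most of \<open>A\<close> there at half time,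
  with an absolutely continuous image. So \<open>\<tau>\<close> is read off at the midpoints of this first transport, and the
  second transport starts from the joint law of initial points and midpoints.
\<close>

section \<open>Arcs, selections and images of Borel sets\<close>

text \<open>\<open>NCe\<close> prescribes only the laws of the two end points of the curves, not
  which start is joined to which end. The target window is therefore tied to the ray: a start x and
  an end w joined by a causal curve share a ray, hence the same points y1 of \<open>S1\<close> and
  y2 of \<open>S2\<close>. If G x lies in (G y1, G y1 + \<epsilon>) and G w - G y1 in (\<tau>/t,
  \<tau>/t + \<epsilon>), then (1 - t) G x + t G w lies in (G y2, G y2 + \<epsilon>), since (1 - t)
  G y1 + t (G y1 + \<tau>/t) = G y2. Both windows have width \<epsilon>, so the combined one has
  too; this is why the same \<epsilon> serves on both sides. The law at time 1 may be singular, so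
  \<tau> is read off strictly before it: at half time the law is absolutely continuous and ignores
  the null sets off which the distances have Borel versions. Starts known to have passed
  \<open>S2\<close> by half time need not form a measurable set. Outer measure handles this, because
  it is continuous along increasing sequences of arbitrary sets. The power N - 1 undoes the root in
  \<open>U_ent (N - 1)\<close>, which behaves like the measure of the support to the power 1/(N -
  1).\<close>

text \<open>Kuratowski embedding: \<open>e\<close> maps the metric space injectively and 1-Lipschitz
  into the Banach space of bounded continuous functions, where \<open>path_contains_arc\<close>
  applies. On the compact image of \<open>p\<close> the inverse is continuous and brings the arc
  back. Subtracting \<open>dist (p 0)\<close> makes the functions bounded.\<close>

lemma path_contains_arc_metric:
  fixes p :: "real \<Rightarrow> 'a::metric_space"
  assumes p: "continuous_on {0..1} p" and "p 0 \<noteq> p 1"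
  obtains q :: "real \<Rightarrow> 'a" where "continuous_on {0..1} q" "inj_on q {0..1}" "q ` {0..1} \<subseteq> p ` {0..1}"
    "q 0 = p 0" "q 1 = p 1"
proof -
  define e :: "'a \<Rightarrow> 'a \<Rightarrow>\<^sub>C real" where "e x = Bcontfun (\<lambda>y. dist x y - dist (p 0) y)" for x
  have "(\<lambda>y. dist x y - dist (p 0) y) \<in> bcontfun" for x
  proof (rule bcontfun_normI)
    show "continuous_on UNIV (\<lambda>y. dist x y - dist (p 0) y)"
      by (intro continuous_intros)
    show "norm (dist x y - dist (p 0) y) \<le> dist x (p 0)" for y
      using dist_triangle[of x y "p 0"] dist_triangle[of "p 0" y x] by (simp add: dist_commute abs_le_iff)
  qed
  then have e: "apply_bcontfun (e x) y = dist x y - dist (p 0) y" for x y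
    unfolding e_def by (simp add: Bcontfun_inverse)
  have "dist (e x) (e y) \<le> dist x y" for x y
  proof (rule dist_bound)
    show "dist (apply_bcontfun (e x) z) (apply_bcontfun (e y) z) \<le> dist x y" for z
      using dist_triangle[of x z y] dist_triangle[of y z x] by (simp add: e dist_real_def dist_commute abs_le_iff)
  qed
  then have "1-lipschitz_on UNIV e"
    by (intro lipschitz_onI) auto
  then have cont: "continuous_on X e" for X
    by (rule continuous_on_subset[OF lipschitz_on_continuous_on]) simp
  have inj: "inj_on e X" for X
  proof (rule inj_onI)
    fix x y assume "e x = e y"
    then have "apply_bcontfun (e x) x = apply_bcontfun (e y) x" by simp
    then show "x = y" by (simp add: e)
  qed
  have "path (e \<circ> p)"
    unfolding path_def by (intro continuous_on_compose p cont)
  moreover have "e (p 0) \<noteq> e (p 1)"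
    using inj[of UNIV] assms(2) by (auto dest: injD)
  ultimately obtain q where q: "arc q" "path_image q \<subseteq> path_image (e \<circ> p)"
      "pathstart q = e (p 0)" "pathfinish q = e (p 1)"
    using path_contains_arc[of "e \<circ> p" "e (p 0)" "e (p 1)"] by (auto simp: pathstart_def pathfinish_def)
  let ?K = "p ` {0..1}"
  define i where "i = the_inv_into ?K e"
  have K: "compact ?K" by (intro compact_continuous_image p) simp
  have i: "i (e x) = x" if "x \<in> ?K" for x
    unfolding i_def using that by (intro the_inv_into_f_f inj)
  have ci: "continuous_on (e ` ?K) i"
    by (rule continuous_on_inv[OF cont K]) (use i in auto)
  have qi: "q ` {0..1} \<subseteq> e ` ?K"
    using q(2) by (auto simp: path_image_def image_image)
  show thesis
  proof
    show "continuous_on {0..1} (i \<circ> q)"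
      using q(1) qi by (intro continuous_on_compose continuous_on_subset[OF ci]) (auto simp: arc_def path_def)
    have "inj_on i (e ` ?K)" using i by (auto intro!: inj_onI)
    then show "inj_on (i \<circ> q) {0..1}"
      using q(1) qi by (intro comp_inj_on) (auto simp: arc_def intro: inj_on_subset)
    show "(i \<circ> q) ` {0..1} \<subseteq> ?K"
      using qi i by force
    show "(i \<circ> q) 0 = p 0" "(i \<circ> q) 1 = p 1"
      using q(3,4) i by (auto simp: pathstart_def pathfinish_def)
  qed
qed

text \<open>Selection in the manner of Kuratowski and Ryll-Nardzewski. At stage j the set
  \<open>F x\<close> is cut down by the first ball of radius 1/(j + 1), in a fixed enumeration, that
  still meets what is left. Compactness makes the intersection over all stages nonempty, and the
  shrinking radii make it a single point.\<close>

lemma measurable_selection_compact: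
  fixes F :: "'b \<Rightarrow> 'a::{heine_borel, second_countable_topology} set"
  assumes compact: "\<And>x. compact (F x)"
    and meas: "\<And>C. closed C \<Longrightarrow> {x \<in> space M. F x \<inter> C \<noteq> {}} \<in> sets M"
    and d: "d \<in> borel_measurable M"
  obtains s where "s \<in> borel_measurable M"
    "\<And>x. F x \<noteq> {} \<Longrightarrow> s x \<in> F x" "\<And>x. F x = {} \<Longrightarrow> s x = d x"
proof -
  obtain D :: "'a set" where D: "countable D" "\<And>X. open X \<Longrightarrow> X \<noteq> {} \<Longrightarrow> \<exists>d\<in>D. d \<in> X"
    using countable_dense_setE by blast
  have "D \<noteq> {}" using D(2)[of UNIV] by auto
  define B where "B j i = cball (from_nat_into D i) (1 / Suc j)" for j i
  have clB: "closed (B j i)" for j i by (simp add: B_def)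
  have coverB: "\<exists>i. y \<in> B j i" for j y
  proof -
    obtain c where c: "c \<in> D" "c \<in> ball y (1 / Suc j)"
      using D(2)[of "ball y (1 / Suc j)"] by auto
    then obtain i where "from_nat_into D i = c"
      using D(1) from_nat_into_surj by metis
    with c show ?thesis by (auto simp: B_def dist_commute intro!: exI[of _ i])
  qed
  define T where "T = rec_nat (\<lambda>x. UNIV) (\<lambda>j S x. S x \<inter> B j (LEAST i. F x \<inter> S x \<inter> B j i \<noteq> {}))"
  have T0: "T 0 x = UNIV" for x by (simp add: T_def)
  have TS: "T (Suc j) x = T j x \<inter> B j (LEAST i. F x \<inter> T j x \<inter> B j i \<noteq> {})" for j x
    by (simp add: T_def)
  have clT: "closed (T j x)" for j x
    by (induction j) (simp_all add: T0 TS clB closed_Int)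
  have neT: "F x \<inter> T j x \<noteq> {}" if "F x \<noteq> {}" for j x
  proof (induction j)
    case 0 then show ?case using that by (simp add: T0)
  next
    case (Suc j)
    then obtain i where "F x \<inter> T j x \<inter> B j i \<noteq> {}"
      using coverB[of _ j] by blast
    then have "F x \<inter> T j x \<inter> B j (LEAST i. F x \<inter> T j x \<inter> B j i \<noteq> {}) \<noteq> {}"
      by (rule LeastI)
    then show ?case by (simp add: TS Int_assoc)
  qed
  have measT: "{x \<in> space M. F x \<inter> T j x \<inter> C \<noteq> {}} \<in> sets M" if "closed C" for j C
    using that
  proof (induction j arbitrary: C)
    case 0 then show ?case using meas by (simp add: T0)
  next
    case (Suc j)
    define E where "E C = {x \<in> space M. F x \<inter> T j x \<inter> C \<noteq> {}}" for C
    have E: "E C \<in> sets M" if "closed C" for C using Suc.IH that by (simp add: E_def)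
    \<comment> \<open>Split by the index chosen at stage j: it is i exactly where ball i meets the
      remaining set and no earlier ball does.\<close>
    have "{x \<in> space M. F x \<inter> T (Suc j) x \<inter> C \<noteq> {}} =
      (\<Union>i. E (B j i \<inter> C) \<inter> (E (B j i) - (\<Union>k<i. E (B j k))))" (is "?l = ?r")
    proof (rule set_eqI)
      fix x
      show "x \<in> ?l \<longleftrightarrow> x \<in> ?r"
      proof
        assume x: "x \<in> ?l"
        let ?i = "LEAST i. F x \<inter> T j x \<inter> B j i \<noteq> {}"
        from x have "x \<in> E (B j ?i \<inter> C)" "x \<in> E (B j ?i)" by (auto simp: E_def TS)
        moreover have "x \<notin> E (B j k)" if "k < ?i" for k
          using not_less_Least[OF that] by (auto simp: E_def)
        ultimately show "x \<in> ?r" by blast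
      next
        assume "x \<in> ?r"
        then obtain i where i: "x \<in> E (B j i \<inter> C)" "x \<in> E (B j i)" "\<And>k. k < i \<Longrightarrow> x \<notin> E (B j k)"
          by blast
        then have "(LEAST i. F x \<inter> T j x \<inter> B j i \<noteq> {}) = i"
          by (intro Least_equality) (auto simp: E_def not_less[symmetric])
        with i(1) show "x \<in> ?l" by (auto simp: E_def TS)
      qed
    qed
    also have "\<dots> \<in> sets M"
      by (intro sets.countable_UN sets.Int sets.Diff E closed_Int clB Suc.prems sets.finite_UN image_subsetI) auto
    finally show ?case .
  qed
  have decT: "T k x \<subseteq> T j x" if "j \<le> k" for j k x
    using that by (induction rule: dec_induct) (auto simp: TS)
  have inter: "\<exists>y. \<forall>j. y \<in> F x \<inter> T j x \<inter> C"
    if C: "closed C" and ne: "\<And>j. F x \<inter> T j x \<inter> C \<noteq> {}" for x C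
  proof -
    have "\<Inter> (range (\<lambda>j. F x \<inter> T j x \<inter> C)) \<noteq> {}"
    proof (rule compact_nest)
      show "compact (F x \<inter> T n x \<inter> C)" for n
        by (intro compact_Int_closed compact clT C)
      show "F x \<inter> T n x \<inter> C \<noteq> {}" for n by (rule ne)
      show "F x \<inter> T n x \<inter> C \<subseteq> F x \<inter> T j x \<inter> C" if "j \<le> n" for j n
        using decT[OF that] by blast
    qed
    then show ?thesis by blast
  qed
  have uniq: "y = z" if "\<And>j. y \<in> T j x" "\<And>j. z \<in> T j x" for x y z
  proof (rule ccontr)
    assume "y \<noteq> z"
    then have "0 < dist y z / 2" by simp
    then obtain j where j: "1 / Suc j < dist y z / 2"
      using nat_approx_posE by metis
    have "y \<in> T (Suc j) x" "z \<in> T (Suc j) x" using that by blast+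
    then obtain i where "y \<in> B j i" "z \<in> B j i"
      unfolding TS by blast
    then have "dist y z \<le> 1 / Suc j + 1 / Suc j"
      unfolding B_def mem_cball using dist_triangle3[of y z "from_nat_into D i"] by simp
    with j show False by simp
  qed
  define s where "s x = (if F x = {} then d x else SOME y. \<forall>j. y \<in> F x \<inter> T j x)" for x
  have s: "\<forall>j. s x \<in> F x \<inter> T j x" if "F x \<noteq> {}" for x
  proof -
    have "\<exists>y. \<forall>j. y \<in> F x \<inter> T j x"
      using inter[of UNIV x] neT[OF that] by simp
    then have "\<forall>j. (SOME y. \<forall>j. y \<in> F x \<inter> T j x) \<in> F x \<inter> T j x"
      by (rule someI_ex)
    with that show ?thesis by (simp add: s_def)
  qed
  show thesis
  proof
    show "s x \<in> F x" if "F x \<noteq> {}" for x using s[OF that] by blast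
    show "s x = d x" if "F x = {}" for x using that by (simp add: s_def)
    \<comment> \<open>By compactness, membership of the limit point in a closed set can be tested
      stage by stage, a countable condition.\<close>
    have *: "s x \<in> C \<longleftrightarrow> (\<forall>j. F x \<inter> T j x \<inter> C \<noteq> {})" if C: "closed C" and "F x \<noteq> {}" for x C
    proof
      assume "s x \<in> C"
      then show "\<forall>j. F x \<inter> T j x \<inter> C \<noteq> {}" using s[OF \<open>F x \<noteq> {}\<close>] by blast
    next
      assume "\<forall>j. F x \<inter> T j x \<inter> C \<noteq> {}"
      then obtain y where "\<forall>j. y \<in> F x \<inter> T j x \<inter> C" using inter[OF C] by blast
      moreover from this have "s x = y" using s[OF \<open>F x \<noteq> {}\<close>] by (intro uniq[of _ x]) auto
      ultimately show "s x \<in> C" by blast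
    qed
    show "s \<in> borel_measurable M"
    proof (rule borel_measurableI)
      fix U :: "'a set" assume "open U"
      then have C: "closed (- U)" by (simp add: closed_def)
      have ne: "{x \<in> space M. F x \<noteq> {}} \<in> sets M" using meas[of UNIV] by simp
      have "s -` U \<inter> space M = (({x \<in> space M. F x \<noteq> {}} - (\<Inter>j. {x \<in> space M. F x \<inter> T j x \<inter> - U \<noteq> {}}))
         \<union> ((d -` U \<inter> space M) - {x \<in> space M. F x \<noteq> {}}))" (is "?l = ?r")
      proof (rule set_eqI)
        fix x
        show "x \<in> ?l \<longleftrightarrow> x \<in> ?r"
        proof (cases "F x = {}")
          case True
          then have "s x = d x" by (simp add: s_def)
          with True show ?thesis by simp
        next
          case False
          then show ?thesis using *[OF C False] by auto
        qed
      qed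
      also have "\<dots> \<in> sets M"
        using measT[OF C] ne d \<open>open U\<close>
        by (intro sets.Un sets.Diff sets.countable_INT) (auto intro: measurable_sets)
      finally show "s -` U \<inter> space M \<in> sets M" .
    qed
  qed
qed

text \<open>Sigma-compact substitute for the image of a Borel set, which need not be Borel.\<close>

lemma borel_image_core:
  fixes f :: "'b::{second_countable_topology, complete_space} \<Rightarrow> 'c::t2_space"
  assumes M: "finite_measure M" "sets M = sets borel"
    and Q: "Q \<in> sets borel" and f: "continuous_on UNIV f"
  obtains C where "C \<in> sets borel" "C \<subseteq> f ` Q" "emeasure M (Q - f -` C) = 0"
proof -
  interpret finite_measure M by fact
  have [simp]: "space M = UNIV" using sets_eq_imp_space_eq[OF M(2)] by simp
  have inner: "emeasure M Q = (SUP K\<in>{K. K \<subseteq> Q \<and> compact K}. emeasure M K)"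
    using M(2) Q by (intro inner_regular) auto
  have "\<exists>K. K \<subseteq> Q \<and> compact K \<and> emeasure M Q \<le> emeasure M K + ennreal (1 / Suc n)" for n
  proof (cases "emeasure M Q = 0")
    case True then show ?thesis by (intro exI[of _ "{}"]) auto
  next
    case False
    then have "emeasure M Q - ennreal (1 / Suc n) < emeasure M Q"
      by (intro ennreal_between) (auto simp: zero_less_iff_neq_zero less_top[symmetric])
    then obtain K where "K \<subseteq> Q" "compact K" "emeasure M Q - ennreal (1 / Suc n) < emeasure M K"
      unfolding inner less_SUP_iff by auto
    then show ?thesis
      by (metis add.commute ennreal_minus_le_iff less_imp_le)
  qed
  then obtain K where K: "\<And>n. K n \<subseteq> Q" "\<And>n. compact (K n)"
    "\<And>n. emeasure M Q \<le> emeasure M (K n) + ennreal (1 / Suc n)"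
    by metis
  define C where "C = (\<Union>n. f ` K n)"
  have compact: "compact (f ` K n)" for n
    using K(2) f by (intro compact_continuous_image) (auto intro: continuous_on_subset)
  have C: "C \<in> sets borel"
    unfolding C_def by (intro sets.countable_UN image_subsetI) (auto simp: compact compact_imp_closed)
  have fC: "f -` C \<in> sets borel"
    using measurable_sets[OF borel_measurable_continuous_onI[OF f] C] by simp
  have "emeasure M (Q - f -` C) \<le> ennreal (1 / Suc n)" for n
  proof -
    have Kn: "K n \<in> sets M" using K(2) M(2) by (simp add: compact_imp_closed)
    have "emeasure M (Q - f -` C) \<le> emeasure M (Q - K n)"
      using Q M(2) Kn by (intro emeasure_mono) (auto simp: C_def)
    also have "\<dots> = emeasure M Q - emeasure M (K n)"
      using Q M(2) Kn K(1) by (intro emeasure_Diff) auto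
    also have "\<dots> \<le> ennreal (1 / Suc n)"
      using K(3)[of n] by (simp add: ennreal_minus_le_iff)
    finally show ?thesis .
  qed
  moreover have "(\<lambda>n. ennreal (1 / Suc n)) \<longlonglongrightarrow> ennreal 0"
    using LIMSEQ_inverse_real_of_nat by (intro tendsto_ennrealI) (simp add: inverse_eq_divide)
  ultimately have "emeasure M (Q - f -` C) \<le> ennreal 0"
    by (intro LIMSEQ_le_const) auto
  then show thesis
    using C K(1) by (intro that[of C]) (auto simp: C_def)
qed

lemma closed_fst_projection_compact:
  fixes R :: "('a::metric_space \<times> 'b::metric_space) set"
  assumes R: "closed R" and K: "compact K"
  shows "closed {x. \<exists>y\<in>K. (x, y) \<in> R}"
  unfolding closed_sequential_limits
proof (intro allI impI, elim conjE)
  fix f l assume f: "\<forall>n. f n \<in> {x. \<exists>y\<in>K. (x, y) \<in> R}" and lim: "f \<longlonglongrightarrow> l"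
  then have "\<forall>n. \<exists>y. y \<in> K \<and> (f n, y) \<in> R" by blast
  then obtain g where g: "\<And>n. g n \<in> K" "\<And>n. (f n, g n) \<in> R" by metis
  obtain y r where y: "y \<in> K" "strict_mono (r :: nat \<Rightarrow> nat)" "(g \<circ> r) \<longlonglongrightarrow> y"
    using K g(1) unfolding compact_def by metis
  have "(\<lambda>n. ((f \<circ> r) n, (g \<circ> r) n)) \<longlonglongrightarrow> (l, y)"
    by (intro tendsto_Pair y(3) LIMSEQ_subseq_LIMSEQ[OF lim y(2)])
  from closed_sequentially[OF R _ this] have "(l, y) \<in> R"
    using g(2) by simp
  with y(1) show "l \<in> {x. \<exists>y\<in>K. (x, y) \<in> R}" by blast
qed

text \<open>Compact rather than open sets, because the points causally related to a member of a
  compact set form a closed, hence Borel, set.\<close>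

lemma countable_compact_neighbourhoods:
  obtains K :: "nat \<Rightarrow> 'a::{heine_borel, second_countable_topology} set"
  where "\<And>n. compact (K n)" "\<And>U y. open U \<Longrightarrow> y \<in> U \<Longrightarrow> \<exists>n. y \<in> K n \<and> K n \<subseteq> U"
proof -
  obtain D :: "'a set" where D: "countable D" "\<And>X. open X \<Longrightarrow> X \<noteq> {} \<Longrightarrow> \<exists>d\<in>D. d \<in> X"
    using countable_dense_setE by blast
  define K where "K n = cball (from_nat_into D (fst (prod_decode n))) (1 / Suc (snd (prod_decode n)))" for n
  show thesis
  proof
    show "compact (K n)" for n by (simp add: K_def)
    fix U :: "'a set" and y assume "open U" "y \<in> U"
    then obtain r where r: "0 < r" "ball y r \<subseteq> U" using open_contains_ball by blast
    obtain k where k: "1 / Suc k < r / 2" using nat_approx_posE[of "r / 2"] r(1) by auto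
    obtain d where d: "d \<in> D" "d \<in> ball y (1 / Suc k)"
      using D(2)[of "ball y (1 / Suc k)"] by auto
    obtain i where i: "from_nat_into D i = d" using D(1) d(1) from_nat_into_surj by metis
    have K: "K (prod_encode (i, k)) = cball d (1 / Suc k)" by (simp add: K_def i)
    have "cball d (1 / Suc k) \<subseteq> ball y r"
    proof
      fix z assume "z \<in> cball d (1 / Suc k)"
      then have "dist y z < 1 / Suc k + 1 / Suc k"
        using d(2) dist_triangle[of y z d] unfolding mem_ball mem_cball by linarith
      also have "\<dots> < r" using k by linarith
      finally show "z \<in> ball y r" by simp
    qed
    moreover have "y \<in> cball d (1 / Suc k)" using d(2) by (simp add: dist_commute)
    ultimately have "y \<in> K (prod_encode (i, k)) \<and> K (prod_encode (i, k)) \<subseteq> U" using r(2) K by blast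
    then show "\<exists>n. y \<in> K n \<and> K n \<subseteq> U" ..
  qed
qed

text \<open>Only the end-point laws of the curves are known, so facts about \<open>X\<close> or
  \<open>Y\<close> pass to the curves only in the form of membership in a Borel set.\<close>

lemma AE_law_transfer:
  assumes law: "distr \<nu> borel e = distr M borel X" and e: "e \<in> borel_measurable \<nu>" and X: "X \<in> borel_measurable M"
    and B: "B \<in> sets borel" and AE: "AE p in M. X p \<in> B"
  shows "AE \<gamma> in \<nu>. e \<gamma> \<in> B"
proof -
  have B': "{x \<in> space borel. x \<in> B} \<in> sets borel" using B by simp
  have "AE x in distr M borel X. x \<in> B" using AE AE_distr_iff[OF X B'] by simp
  then have "AE x in distr \<nu> borel e. x \<in> B" by (simp only: law)
  then show ?thesis using AE_distr_iff[OF e B'] by simp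
qed

section \<open>Entropy bounds\<close>

text \<open>On the set where \<open>f\<close> exceeds \<open>C\<close> the function
  \<open>f - C\<close> is positive, yet its integral there is zero by the assumed bound.\<close>

lemma density_bound_AE:
  assumes f: "f \<in> borel_measurable m" and fin: "emeasure (density m f) (space m) < \<infinity>" and "0 < C"
    and le: "\<And>X. X \<in> sets m \<Longrightarrow> emeasure (density m f) X \<le> ennreal C * emeasure m X"
  shows "AE x in m. f x \<le> ennreal C"
proof -
  note f [measurable]
  let ?E = "{x \<in> space m. ennreal C < f x}"
  have E: "?E \<in> sets m" by measurable
  have fE: "emeasure (density m f) ?E = (\<integral>\<^sup>+x. f x * indicator ?E x \<partial>m)"
    by (rule emeasure_density) (use E in auto)
  have "emeasure (density m f) ?E \<le> emeasure (density m f) (space m)"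
    using E by (intro emeasure_mono) auto
  with fin have finE: "emeasure (density m f) ?E \<noteq> \<infinity>" by auto
  have CE: "(\<integral>\<^sup>+x. ennreal C * indicator ?E x \<partial>m) = ennreal C * emeasure m ?E"
    using E by (rule nn_integral_cmult_indicator)
  have CfE: "ennreal C * emeasure m ?E \<le> emeasure (density m f) ?E"
    unfolding fE CE[symmetric] by (intro nn_integral_mono) (auto simp: indicator_def)
  have "(\<integral>\<^sup>+x. f x * indicator ?E x - ennreal C * indicator ?E x \<partial>m) =
      emeasure (density m f) ?E - ennreal C * emeasure m ?E"
    unfolding fE CE[symmetric]
  proof (rule nn_integral_diff)
    show "(\<integral>\<^sup>+x. ennreal C * indicator ?E x \<partial>m) \<noteq> \<infinity>"
      unfolding CE using CfE finE by (auto simp: top_unique)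
  qed (auto simp: indicator_def)
  also have "\<dots> = 0" using le[OF E] finE by (intro diff_eq_0_ennreal) (auto simp: less_top)
  finally have "AE x in m. f x * indicator ?E x - ennreal C * indicator ?E x = 0"
    by (subst (asm) nn_integral_0_iff_AE) measurable
  then show ?thesis
  proof (rule AE_mp, intro AE_I2 impI)
    fix x assume x: "x \<in> space m" "f x * indicator ?E x - ennreal C * indicator ?E x = 0"
    show "f x \<le> ennreal C"
    proof (rule ccontr)
      assume "\<not> f x \<le> ennreal C"
      with x have "f x - ennreal C = 0" by (simp add: not_le)
      with \<open>\<not> f x \<le> ennreal C\<close> show False using ennreal_minus_eq_0 by blast
    qed
  qed
qed

lemma Ent_eq_integral:
  fixes \<mu> m :: "'a measure"
  defines "h \<equiv> \<lambda>x. enn2real (RN_deriv m \<mu> x) * ln (enn2real (RN_deriv m \<mu> x))"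
  assumes "density m (RN_deriv m \<mu>) = \<mu>"
    and "(\<integral>\<^sup>+x. ennreal (h x) \<partial>m) < \<infinity>" "(\<integral>\<^sup>+x. ennreal (- h x) \<partial>m) < \<infinity>"
  shows "integrable m h" "Ent \<mu> m = ereal (\<integral>x. h x \<partial>m)"
proof -
  have [measurable]: "h \<in> borel_measurable m" unfolding h_def by measurable
  show int: "integrable m h"
    using assms by (intro real_integrable_def[THEN iffD2]) auto
  have e: "enn2ereal a = ereal (enn2real a)" if "a < \<infinity>" for a
    using that by (cases a) auto
  show "Ent \<mu> m = ereal (\<integral>x. h x \<partial>m)"
    using assms(2-4) unfolding Ent_def h_def[symmetric] Let_def real_lebesgue_integral_def[OF int]
    by (simp add: e)
qed

lemma integral_RN_deriv_prob_space:
  assumes "prob_space \<mu>" and dens: "density m (RN_deriv m \<mu>) = \<mu>"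
  shows "integrable m (\<lambda>x. enn2real (RN_deriv m \<mu> x))" "(\<integral>x. enn2real (RN_deriv m \<mu> x) \<partial>m) = 1"
    "AE x in m. RN_deriv m \<mu> x = ennreal (enn2real (RN_deriv m \<mu> x))"
proof -
  interpret prob_space \<mu> by fact
  have "space \<mu> = space m" by (subst dens[symmetric]) simp
  have "(\<integral>\<^sup>+x. RN_deriv m \<mu> x \<partial>m) = (\<integral>\<^sup>+x. RN_deriv m \<mu> x * indicator (space m) x \<partial>m)"
    by (intro nn_integral_cong) simp
  also have "\<dots> = emeasure (density m (RN_deriv m \<mu>)) (space m)"
    by (rule emeasure_density[symmetric]) auto
  also have "\<dots> = 1"
    using emeasure_space_1 \<open>space \<mu> = space m\<close> by (simp only: dens)
  finally have *: "(\<integral>\<^sup>+x. RN_deriv m \<mu> x \<partial>m) = 1" .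
  then have "AE x in m. RN_deriv m \<mu> x \<noteq> \<infinity>"
    by (intro nn_integral_PInf_AE) auto
  then show AE: "AE x in m. RN_deriv m \<mu> x = ennreal (enn2real (RN_deriv m \<mu> x))"
    by (rule AE_mp) (auto simp: less_top)
  have "(\<integral>\<^sup>+x. ennreal (enn2real (RN_deriv m \<mu> x)) \<partial>m) = 1"
    unfolding *[symmetric] by (rule nn_integral_cong_AE) (use AE in auto)
  then have "has_bochner_integral m (\<lambda>x. enn2real (RN_deriv m \<mu> x)) 1"
    by (intro has_bochner_integral_nn_integral) auto
  then show "integrable m (\<lambda>x. enn2real (RN_deriv m \<mu> x))" "(\<integral>x. enn2real (RN_deriv m \<mu> x) \<partial>m) = 1"
    by (auto simp: has_bochner_integral_iff)
qed

text \<open>The bound on \<mu> says that the density is at most \<open>C\<close>, so its logarithm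
  is at most ln C and the entropy as well. If the negative part is not integrable, the entropy is
  -\<infinity> and \<open>U_ent\<close> is infinite.\<close>

lemma U_ent_lower_bound:
  assumes "sigma_finite_measure m" and prob: "prob_space \<mu>" and sets: "sets \<mu> = sets m"
    and "0 < C" "0 < K"
    and le: "\<And>X. X \<in> sets m \<Longrightarrow> emeasure \<mu> X \<le> ennreal C * emeasure m X"
  shows "ennreal (exp (- ln C / K)) \<le> U_ent K \<mu> m"
proof -
  interpret m: sigma_finite_measure m by fact
  interpret prob_space \<mu> by fact
  have "absolutely_continuous m \<mu>"
    unfolding absolutely_continuous_def
  proof
    fix X assume "X \<in> null_sets m"
    then show "X \<in> null_sets \<mu>" using le[of X] sets by (auto simp: null_sets_def)
  qed
  then have dens: "density m (RN_deriv m \<mu>) = \<mu>"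
    using sets by (rule m.density_RN_deriv)
  let ?r = "\<lambda>x. enn2real (RN_deriv m \<mu> x)"
  let ?h = "\<lambda>x. ?r x * ln (?r x)"
  note int = integral_RN_deriv_prob_space[OF prob dens]
  have "emeasure \<mu> (space m) < \<infinity>"
    using emeasure_finite[of "space m"] by (simp add: less_top[symmetric])
  then have "AE x in m. RN_deriv m \<mu> x \<le> ennreal C"
    using le \<open>0 < C\<close> by (intro density_bound_AE) (auto simp: dens)
  then have rC: "AE x in m. ?r x \<le> C"
    by (rule AE_mp) (use \<open>0 < C\<close> in \<open>auto intro!: AE_I2 enn2real_leI\<close>)
  have h_le: "AE x in m. ?h x \<le> ?r x * ln C"
    using rC
  proof (rule AE_mp, intro AE_I2 impI)
    fix x assume "?r x \<le> C"
    then show "?h x \<le> ?r x * ln C"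
      by (cases "?r x = 0") (auto intro!: mult_left_mono ln_mono simp: order.strict_iff_order)
  qed
  have P: "(\<integral>\<^sup>+x. ennreal (?h x) \<partial>m) < \<infinity>"
  proof -
    have "(\<integral>\<^sup>+x. ennreal (?h x) \<partial>m) \<le> (\<integral>\<^sup>+x. ennreal (?r x * ln C) \<partial>m)"
      by (rule nn_integral_mono_AE) (use h_le in \<open>auto intro: ennreal_leI\<close>)
    also have "\<dots> < \<infinity>"
    proof -
      have "integrable m (\<lambda>x. ?r x * ln C)" by (intro integrable_mult_left int(1))
      then show ?thesis unfolding real_integrable_def by (simp add: less_top)
    qed
    finally show ?thesis .
  qed
  show ?thesis
  proof (cases "(\<integral>\<^sup>+x. ennreal (- ?h x) \<partial>m) < \<infinity>")
    case True
    note E = Ent_eq_integral[OF dens P True]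
    have "(\<integral>x. ?h x \<partial>m) \<le> (\<integral>x. ?r x * ln C \<partial>m)"
      by (intro integral_mono_AE E(1) integrable_mult_left int(1) h_le)
    then have "(\<integral>x. ?h x \<partial>m) \<le> ln C" using int(2) by simp
    then show ?thesis
      using \<open>0 < K\<close> by (auto simp: U_ent_def E(2) divide_right_mono intro!: ennreal_leI)
  next
    case False
    then have "(\<integral>\<^sup>+x. ennreal (- ?h x) \<partial>m) = \<infinity>" by (simp add: less_top[symmetric])
    then have "Ent \<mu> m = enn2ereal (\<integral>\<^sup>+x. ennreal (?h x) \<partial>m) - \<infinity>"
      using P by (simp add: Ent_def dens Let_def)
    also have "\<dots> = -\<infinity>"
      using P by (cases "\<integral>\<^sup>+x. ennreal (?h x) \<partial>m") auto
    finally show ?thesis by (simp add: U_ent_def)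
  qed
qed

text \<open>Source of absolute continuity: \<open>Ent\<close> is \<infinity> by definition when no
  density exists.\<close>

lemma U_ent_pos_density:
  assumes "0 < U_ent K \<mu> m"
  shows "density m (RN_deriv m \<mu>) = \<mu>"
proof (rule ccontr)
  assume "density m (RN_deriv m \<mu>) \<noteq> \<mu>"
  then have "Ent \<mu> m = \<infinity>" by (simp add: Ent_def Let_def)
  with assms show False by (simp add: U_ent_def)
qed

text \<open>The left side is the tangent of the convex function r ln r at r = 1/b, the density of
  the uniform distribution on a set of mass b.\<close>

lemma mult_ln_lower_bound:
  fixes r b :: real
  assumes "0 < r" "0 < b"
  shows "r * (- ln b) + r - 1 / b \<le> r * ln r"
proof -
  have "ln (1 / (b * r)) \<le> 1 / (b * r) - 1"
    using assms by (intro ln_le_minus_one) simp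
  then have "- ln b - ln r \<le> 1 / (b * r) - 1"
    using assms by (simp add: ln_div ln_mult)
  then have "r * (- ln b - ln r) \<le> r * (1 / (b * r) - 1)"
    using assms by (intro mult_left_mono) auto
  also have "\<dots> = 1 / b - r" using assms by (simp add: field_simps)
  finally show ?thesis by (simp add: algebra_simps)
qed

text \<open>Jensen's inequality, obtained by integrating the tangent bound of
  \<open>mult_ln_lower_bound\<close> over \<open>B\<close>: the entropy of a probability measure
  concentrated on a set of mass b is at least - ln b.\<close>

lemma U_ent_upper_bound:
  assumes prob: "prob_space \<mu>"
    and B: "B \<in> sets m" "AE x in \<mu>. x \<in> B" "emeasure m B = ennreal b" "0 \<le> b" and "0 < K"
  shows "U_ent K \<mu> m \<le> ennreal (exp (ln b / K))"
proof (cases "Ent \<mu> m = \<infinity>")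
  case True
  then show ?thesis by (simp add: U_ent_def)
next
  case False
  interpret prob_space \<mu> by fact
  let ?r = "\<lambda>x. enn2real (RN_deriv m \<mu> x)"
  let ?h = "\<lambda>x. ?r x * ln (?r x)"
  from False have dens: "density m (RN_deriv m \<mu>) = \<mu>" and P: "(\<integral>\<^sup>+x. ennreal (?h x) \<partial>m) < \<infinity>"
    by (auto simp: Ent_def Let_def split: if_splits)
  note int = integral_RN_deriv_prob_space[OF prob dens]
  have "AE x in density m (RN_deriv m \<mu>). x \<in> B" using B(2) by (simp only: dens)
  then have "AE x in m. 0 < RN_deriv m \<mu> x \<longrightarrow> x \<in> B"
    by (subst (asm) AE_density) auto
  then have rB: "AE x in m. x \<notin> B \<longrightarrow> ?r x = 0"
    by (rule AE_mp) (auto simp: zero_less_iff_neq_zero)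
  have "b \<noteq> 0"
  proof
    assume "b = 0"
    then have "AE x in m. x \<notin> B" using B by (auto intro!: AE_not_in)
    with rB have "AE x in m. ?r x = 0" by auto
    then have "(\<integral>x. ?r x \<partial>m) = 0" by (simp add: integral_eq_zero_AE)
    then show False using int(2) by simp
  qed
  with \<open>0 \<le> b\<close> have "0 < b" by simp
  \<comment> \<open>The tangent with its constant term restricted to \<open>B\<close>. The terms
    integrate to - ln b, 1 and 1.\<close>
  define w where "w x = ?r x * (- ln b) + ?r x - indicator B x / b" for x
  have Bs: "B \<inter> space m = B" using B(1) by (rule sets.Int_space_eq2)
  then have intB: "integrable m (indicator B :: _ \<Rightarrow> real)" "(\<integral>x. indicator B x \<partial>m) = b"
    using B \<open>0 < b\<close> by (auto simp: integrable_indicator_iff measure_def)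
  have w: "integrable m w"
    unfolding w_def by (intro Bochner_Integration.integrable_diff Bochner_Integration.integrable_add integrable_mult_left integrable_divide int(1) intB(1))
  have "(\<integral>x. w x \<partial>m) = 1 * (- ln b) + 1 - b / b"
    unfolding w_def using int(1) intB(1)
    by (subst Bochner_Integration.integral_diff Bochner_Integration.integral_add)+
      (use intB(2) in \<open>simp_all add: int(2) Bs\<close>)
  then have w_int: "(\<integral>x. w x \<partial>m) = - ln b" using \<open>0 < b\<close> by simp
  have w_le: "AE x in m. w x \<le> ?h x"
    using rB
  proof (rule AE_mp, intro AE_I2 impI)
    fix x assume x: "x \<notin> B \<longrightarrow> ?r x = 0"
    show "w x \<le> ?h x"
    proof (cases "?r x = 0")
      case True
      then show ?thesis using \<open>0 < b\<close> by (simp add: w_def)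
    next
      case False
      then have r: "0 < ?r x" by (simp add: order.strict_iff_order)
      have "x \<in> B" using x False by blast
      then show ?thesis
        using mult_ln_lower_bound[OF r \<open>0 < b\<close>] by (simp add: w_def)
    qed
  qed
  \<comment> \<open>The integrable minorant \<open>w\<close> rules out entropy -\<infinity>.\<close>
  have Q: "(\<integral>\<^sup>+x. ennreal (- ?h x) \<partial>m) < \<infinity>"
  proof -
    have "(\<integral>\<^sup>+x. ennreal (- ?h x) \<partial>m) \<le> (\<integral>\<^sup>+x. ennreal (- w x) \<partial>m)"
      by (rule nn_integral_mono_AE, rule AE_mp[OF w_le], intro AE_I2 impI ennreal_leI) simp
    also have "\<dots> < \<infinity>"
      using w by (auto simp: real_integrable_def less_top)
    finally show ?thesis .
  qed
  note E = Ent_eq_integral[OF dens P Q]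
  have "- ln b \<le> (\<integral>x. ?h x \<partial>m)"
    unfolding w_int[symmetric] by (intro integral_mono_AE E(1) w w_le)
  then have "- (\<integral>x. ?h x \<partial>m) / K \<le> ln b / K"
    using \<open>0 < K\<close> by (intro divide_right_mono) auto
  then show ?thesis
    by (auto simp: U_ent_def E(2) intro!: ennreal_leI)
qed

section \<open>Causal curves\<close>

lemma mspace_curve_spaceD:
  assumes "\<gamma> \<in> mspace (curve_space H)"
  shows "continuous_on {0..1} \<gamma>" "t \<in> {0..1} \<Longrightarrow> \<gamma> t \<in> H"
  using assms unfolding curve_space_def
  by (auto simp: mtopology_of_submetric continuous_map_in_subtopology)

lemma space_curve_borel: "space (curve_borel H) = mspace (curve_space H)"
  unfolding curve_borel_def by (rule space_measure_of) (use openin_subset in fastforce)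

lemma measurable_curve_eval:
  fixes H :: "'a::metric_space set"
  assumes t: "t \<in> {0..1}"
  shows "(\<lambda>\<gamma>. \<gamma> t) \<in> measurable (curve_borel H) (borel_on H)"
proof (rule measurable_restrict_space2)
  show "(\<lambda>\<gamma>. \<gamma> t) \<in> space (curve_borel H) \<rightarrow> H"
    using t by (auto simp: space_curve_borel dest: mspace_curve_spaceD(2))
  let ?M = "mspace (curve_space H)" and ?d = "mdist (curve_space H)"
  interpret Metric_space ?M ?d by (rule Metric_space_mspace_mdist)
  show "(\<lambda>\<gamma>. \<gamma> t) \<in> borel_measurable (curve_borel H)"
  proof (rule borel_measurableI)
    fix U :: "'a set" assume U: "open U"
    have "openin mtopology {\<gamma> \<in> ?M. \<gamma> t \<in> U}"
      unfolding openin_mtopology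
    proof (intro conjI allI impI)
      fix \<gamma> assume \<gamma>: "\<gamma> \<in> {\<gamma> \<in> ?M. \<gamma> t \<in> U}"
      then obtain r where r: "0 < r" "ball (\<gamma> t) r \<subseteq> U"
        using U open_contains_ball by blast
      have "mball \<gamma> r \<subseteq> {\<gamma> \<in> ?M. \<gamma> t \<in> U}"
      proof
        fix \<eta> assume \<eta>: "\<eta> \<in> mball \<gamma> r"
        have "mdist (submetric euclidean_metric H) (\<gamma> t) (\<eta> t) < r"
        proof (rule cfunspace_mdist_lt[of "top_of_set {0..1::real}"])
          show "\<gamma> \<in> mspace (cfunspace (top_of_set {0..1}) (submetric euclidean_metric H))"
            "\<eta> \<in> mspace (cfunspace (top_of_set {0..1}) (submetric euclidean_metric H))"
            "mdist (cfunspace (top_of_set {0..1}) (submetric euclidean_metric H)) \<gamma> \<eta> < r"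
            using \<eta>[unfolded in_mball, unfolded curve_space_def] by blast+
        qed (use t in \<open>simp_all add: compactin_subtopology\<close>)
        then have "\<eta> t \<in> ball (\<gamma> t) r" by simp
        then show "\<eta> \<in> {\<gamma> \<in> ?M. \<gamma> t \<in> U}" using \<eta> r by auto
      qed
      with r show "\<exists>r>0. mball \<gamma> r \<subseteq> {\<gamma> \<in> ?M. \<gamma> t \<in> U}" by blast
    qed auto
    then have "{\<gamma> \<in> ?M. \<gamma> t \<in> U} \<in> {U. openin (mtopology_of (curve_space H)) U}"
      by (simp add: mtopology_of_def)
    moreover have "(\<lambda>\<gamma>. \<gamma> t) -` U \<inter> space (curve_borel H) = {\<gamma> \<in> ?M. \<gamma> t \<in> U}"
      by (auto simp: space_curve_borel)
    ultimately show "(\<lambda>\<gamma>. \<gamma> t) -` U \<inter> space (curve_borel H) \<in> sets (curve_borel H)"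
      unfolding curve_borel_def
      by (subst sets_measure_of) (use openin_subset in fastforce)+
  qed
qed

lemma causal_curveD:
  assumes "causal_curve le I \<gamma>"
  shows "continuous_on I \<gamma>" "s \<in> I \<Longrightarrow> t \<in> I \<Longrightarrow> s \<le> t \<Longrightarrow> le (\<gamma> s) (\<gamma> t)"
  using assms by (auto simp: causal_curve_def)

text \<open>On the connected triangle of pairs s < t, the closed conditions q s \<le> q t and q t
  \<le> q s cover everything by totality and exclude each other by antisymmetry and injectivity. So
  one of them holds throughout, and the pair (0, 1) decides which.\<close>

lemma arc_in_chain_monotone:
  fixes q :: "real \<Rightarrow> 'a::topological_space"
  assumes closed: "closed {(x, y). le x y}"
    and q: "continuous_on {0..1} q" "inj_on q {0..1}"
    and total: "\<And>x y. x \<in> q ` {0..1} \<Longrightarrow> y \<in> q ` {0..1} \<Longrightarrow> le x y \<or> le y x"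
    and antisym: "\<And>x y. x \<in> q ` {0..1} \<Longrightarrow> y \<in> q ` {0..1} \<Longrightarrow> le x y \<Longrightarrow> le y x \<Longrightarrow> x = y"
    and "le (q 0) (q 1)"
  shows "causal_curve le {0..1} q"
proof -
  let ?T = "{p :: real \<times> real. 0 \<le> fst p \<and> snd p \<le> 1 \<and> fst p < snd p}"
  have "convex ?T"
  proof -
    have "?T = fst -` {0..} \<inter> snd -` {..1} \<inter> (\<lambda>p. fst p - snd p) -` {..<0}" by auto
    moreover have "linear (fst :: real \<times> real \<Rightarrow> real)" "linear (snd :: real \<times> real \<Rightarrow> real)"
        "linear (\<lambda>p :: real \<times> real. fst p - snd p)"
      by (intro linear_fst linear_snd linear_compose_sub)+
    then have "convex (fst -` {0..} :: (real \<times> real) set)" "convex (snd -` {..1} :: (real \<times> real) set)"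
        "convex ((\<lambda>p. fst p - snd p) -` {..<0} :: (real \<times> real) set)"
      by (auto intro!: convex_linear_vimage)
    ultimately show ?thesis by (simp add: convex_Int)
  qed
  then have conn: "connected ?T" by (rule convex_connected)
  let ?A = "?T \<inter> (\<lambda>p. (q (fst p), q (snd p))) -` {(x, y). le x y}"
  let ?B = "?T \<inter> (\<lambda>p. (q (snd p), q (fst p))) -` {(x, y). le x y}"
  have c: "continuous_on ?T (\<lambda>p. q (fst p))" "continuous_on ?T (\<lambda>p. q (snd p))"
    by (auto intro!: continuous_on_compose2[OF q(1)] continuous_intros)
  have cl: "closedin (top_of_set ?T) ?A" "closedin (top_of_set ?T) ?B"
    by (intro continuous_closedin_preimage closed continuous_on_Pair c)+
  have cover: "?T \<subseteq> ?A \<union> ?B"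
  proof
    fix p assume "p \<in> ?T"
    moreover from this have "q (fst p) \<in> q ` {0..1}" "q (snd p) \<in> q ` {0..1}" by auto
    ultimately show "p \<in> ?A \<union> ?B" using total by auto
  qed
  have disj: "?A \<inter> ?B = {}"
  proof (rule equals0I)
    fix p assume p: "p \<in> ?A \<inter> ?B"
    then have "q (fst p) = q (snd p)" by (intro antisym) auto
    then show False using inj_onD[OF q(2), of "fst p" "snd p"] p by auto
  qed
  have "(0, 1) \<in> ?A" using \<open>le (q 0) (q 1)\<close> by simp
  then have ne: "?A \<noteq> {}" by blast
  have "?B = {}"
  proof (rule ccontr)
    assume "?B \<noteq> {}"
    then have "\<exists>E1 E2. closedin (top_of_set ?T) E1 \<and> closedin (top_of_set ?T) E2 \<and>
        ?T \<subseteq> E1 \<union> E2 \<and> E1 \<inter> E2 = {} \<and> E1 \<noteq> {} \<and> E2 \<noteq> {}"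
      by (intro exI[of _ ?A] exI[of _ ?B] conjI cl cover disj ne)
    with connected_closedin[THEN iffD1, OF conn] show False by (rule notE)
  qed
  have lt: "le (q s) (q t)" if "0 \<le> s" "s < t" "t \<le> 1" for s t
  proof -
    have "(s, t) \<in> ?T" using that by simp
    then have "(s, t) \<in> ?A" using cover \<open>?B = {}\<close> by blast
    then show ?thesis by simp
  qed
  have "le (q s) (q t)" if "s \<in> {0..1}" "t \<in> {0..1}" "s \<le> t" for s t
    using lt[of s t] total[of "q s" "q t"] that by (cases "s = t") auto
  then show ?thesis using q(1) by (auto simp: causal_curve_def)
qed

lemma causal_curve_reverse:
  assumes "causal_curve le {0..1::real} \<gamma>"
  shows "causal_curve (\<lambda>x y. le y x) {0..1} (\<lambda>t. \<gamma> (1 - t))"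
proof -
  have "continuous_on {0..1} (\<lambda>t. \<gamma> (1 - t))"
    using causal_curveD(1)[OF assms]
    by (rule continuous_on_compose2) (auto intro!: continuous_intros)
  then show ?thesis
    using causal_curveD(2)[OF assms] by (simp add: causal_curve_def is_interval_cc)
qed

lemma inj_on_reverse:
  "inj_on \<gamma> {0..1::real} \<Longrightarrow> inj_on (\<lambda>t. \<gamma> (1 - t)) {0..1}"
proof (rule inj_onI)
  fix s t :: real assume "inj_on \<gamma> {0..1}" "s \<in> {0..1}" "t \<in> {0..1}" "\<gamma> (1 - s) = \<gamma> (1 - t)"
  then show "s = t" using inj_onD[of \<gamma> "{0..1}" "1 - s" "1 - t"] by simp
qed

lemma causal_curve_join:
  fixes \<alpha> \<beta> :: "real \<Rightarrow> 'a::topological_space"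
  assumes trans: "transp le"
    and \<alpha>: "causal_curve le {0..1} \<alpha>" and \<beta>: "causal_curve le {0..1} \<beta>" and "\<alpha> 1 = \<beta> 0"
  shows "causal_curve le {0..1} (\<alpha> +++ \<beta>)"
proof -
  have "le ((\<alpha> +++ \<beta>) s) ((\<alpha> +++ \<beta>) t)" if "0 \<le> s" "s \<le> t" "t \<le> 1" for s t
  proof -
    consider "t \<le> 1/2" | "1/2 < s" | "s \<le> 1/2" "1/2 < t" by linarith
    then show ?thesis
    proof cases
      case 1
      then show ?thesis using that causal_curveD(2)[OF \<alpha>, of "2 * s" "2 * t"] by (simp add: joinpaths_def)
    next
      case 2
      then show ?thesis using that causal_curveD(2)[OF \<beta>, of "2 * s-1" "2 * t-1"] by (simp add: joinpaths_def)
    next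
      case 3
      have "le (\<alpha> (2 * s)) (\<alpha> 1)" "le (\<beta> 0) (\<beta> (2 * t-1))"
        using that 3 by (auto intro: causal_curveD(2)[OF \<alpha>] causal_curveD(2)[OF \<beta>])
      then have "le (\<alpha> (2 * s)) (\<beta> (2 * t-1))"
        using transpD[OF trans] unfolding \<open>\<alpha> 1 = \<beta> 0\<close> by metis
      then show ?thesis using 3 by (simp add: joinpaths_def)
    qed
  qed
  moreover have "path (\<alpha> +++ \<beta>)"
    using causal_curveD(1)[OF \<alpha>] causal_curveD(1)[OF \<beta>] \<open>\<alpha> 1 = \<beta> 0\<close>
    by (intro path_join_imp) (auto simp: path_def pathstart_def pathfinish_def)
  ultimately show ?thesis unfolding causal_curve_def path_def by (simp add: is_interval_cc)
qed

text \<open>The definition of non-branching only excludes branching strictly after the starting point of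
  both curves, hence the point \<open>w\<close> before \<open>x\<close>.\<close>

lemma nonbranching_future_chain:
  fixes le :: "'a::topological_space \<Rightarrow> 'a \<Rightarrow> bool"
  assumes nb: "forward_null_nonbranching le H" and trans: "transp le"
    and antisym: "\<And>x y. x \<in> H \<Longrightarrow> y \<in> H \<Longrightarrow> le x y \<Longrightarrow> le y x \<Longrightarrow> x = y"
    and curve: "\<And>x y. x \<in> H \<Longrightarrow> y \<in> H \<Longrightarrow> le x y \<Longrightarrow> x \<noteq> y \<Longrightarrow>
      \<exists>\<gamma>. causal_curve le {0..1} \<gamma> \<and> inj_on \<gamma> {0..1} \<and> \<gamma> ` {0..1} \<subseteq> H \<and> \<gamma> 0 = x \<and> \<gamma> 1 = y"
    and w: "w \<in> H" "le w x" "w \<noteq> x"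
    and xyz: "x \<in> H" "y \<in> H" "z \<in> H" "le x y" "le x z"
  shows "le y z \<or> le z y"
proof (cases "x = y \<or> x = z")
  case True then show ?thesis using xyz by auto
next
  case False
  obtain \<alpha> where \<alpha>: "causal_curve le {0..1} \<alpha>" "inj_on \<alpha> {0..1}" "\<alpha> ` {0..1} \<subseteq> H" "\<alpha> 0 = w" "\<alpha> 1 = x"
    using curve w xyz(1) by metis
  \<comment> \<open>Curves from \<open>w\<close> that pass \<open>x\<close> exactly at time 1/2, the
    shape required by \<open>forward_null_nonbranching\<close>. By antisymmetry the two halves meet
    only in \<open>x\<close>, which gives injectivity.\<close>
  have join: "\<exists>\<gamma>. causal_curve le {0..1} \<gamma> \<and> inj_on \<gamma> {0..1} \<and> \<gamma> ` {0..1} \<subseteq> H \<and>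
      \<gamma> 0 = w \<and> \<gamma> (1/2) = x \<and> \<gamma> 1 = v" if v: "v \<in> H" "le x v" "x \<noteq> v" for v
  proof -
    obtain \<beta> where \<beta>: "causal_curve le {0..1} \<beta>" "inj_on \<beta> {0..1}" "\<beta> ` {0..1} \<subseteq> H" "\<beta> 0 = x" "\<beta> 1 = v"
      using curve v xyz(1) by metis
    have ne: "\<alpha> s \<noteq> \<beta> t" if "s \<in> {0..1}" "t \<in> {0<..1}" for s t
    proof
      assume eq: "\<alpha> s = \<beta> t"
      have "le (\<alpha> s) (\<alpha> 1)" "le (\<beta> 0) (\<beta> t)"
        using that by (auto intro: causal_curveD(2)[OF \<alpha>(1)] causal_curveD(2)[OF \<beta>(1)])
      then have "\<beta> t = x"
        using antisym[of "\<beta> t" x] \<beta>(3,4) \<alpha>(5) eq that xyz(1) by (auto simp: image_subset_iff)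
      then show False using inj_onD[OF \<beta>(2), of t 0] \<beta>(4) that by auto
    qed
    have "inj_on (\<alpha> +++ \<beta>) {0..1}"
    proof (rule inj_onI)
      fix s t :: real assume st: "s \<in> {0..1}" "t \<in> {0..1}" and eq: "(\<alpha> +++ \<beta>) s = (\<alpha> +++ \<beta>) t"
      consider "s \<le> 1/2" "t \<le> 1/2" | "1/2 < s" "1/2 < t" | "s \<le> 1/2" "1/2 < t" | "t \<le> 1/2" "1/2 < s" by linarith
      then show "s = t"
      proof cases
        case 1 then show ?thesis using eq st inj_onD[OF \<alpha>(2), of "2 * s" "2 * t"] by (simp add: joinpaths_def)
      next
        case 2 then show ?thesis using eq st inj_onD[OF \<beta>(2), of "2 * s-1" "2 * t-1"] by (simp add: joinpaths_def)
      next
        case 3 then show ?thesis using eq st ne[of "2 * s" "2 * t-1"] by (simp add: joinpaths_def)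
      next
        case 4 then show ?thesis using eq st ne[of "2 * t" "2 * s-1"] by (simp add: joinpaths_def)
      qed
    qed
    moreover have "(\<alpha> +++ \<beta>) ` {0..1} \<subseteq> H"
      using path_image_join_subset[of \<alpha> \<beta>] \<alpha>(3) \<beta>(3) by (auto simp: path_image_def)
    moreover have "(\<alpha> +++ \<beta>) 0 = w" "(\<alpha> +++ \<beta>) (1/2) = x" "(\<alpha> +++ \<beta>) 1 = v"
      using \<alpha>(4,5) \<beta>(4,5) by (simp_all add: joinpaths_def)
    moreover have "causal_curve le {0..1} (\<alpha> +++ \<beta>)"
      using causal_curve_join[OF trans \<alpha>(1) \<beta>(1)] \<alpha>(5) \<beta>(4) by simp
    ultimately show ?thesis by blast
  qed
  obtain \<gamma>1 where 1: "causal_curve le {0..1} \<gamma>1" "inj_on \<gamma>1 {0..1}" "\<gamma>1 ` {0..1} \<subseteq> H"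
      "\<gamma>1 0 = w" "\<gamma>1 (1/2) = x" "\<gamma>1 1 = y"
    using join[of y] False xyz by blast
  obtain \<gamma>2 where 2: "causal_curve le {0..1} \<gamma>2" "inj_on \<gamma>2 {0..1}" "\<gamma>2 ` {0..1} \<subseteq> H"
      "\<gamma>2 0 = w" "\<gamma>2 (1/2) = x" "\<gamma>2 1 = z"
    using join[of z] False xyz by blast
  \<comment> \<open>Either inclusion puts the end point of one curve on the other, which ends at
    \<open>z\<close> or \<open>y\<close>.\<close>
  have "\<gamma>1 ` {0..1} \<subseteq> \<gamma>2 ` {0..1} \<or> \<gamma>2 ` {0..1} \<subseteq> \<gamma>1 ` {0..1}"
    using nb 1 2 unfolding forward_null_nonbranching_def by metis
  then show ?thesis
  proof
    assume "\<gamma>1 ` {0..1} \<subseteq> \<gamma>2 ` {0..1}"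
    then have "y \<in> \<gamma>2 ` {0..1}" using 1(6) by force
    then show ?thesis using causal_curveD(2)[OF 2(1), of _ 1] 2(6) by auto
  next
    assume "\<gamma>2 ` {0..1} \<subseteq> \<gamma>1 ` {0..1}"
    then have "z \<in> \<gamma>1 ` {0..1}" using 2(6) by force
    then show ?thesis using causal_curveD(2)[OF 1(1), of _ 1] 1(6) by auto
  qed
qed

section \<open>Rays of a complete null hypersurface\<close>

locale complete_null_hypersurface = synthetic_null_hypersurface ll le H G m
  for ll le :: "'a::{polish_space, heine_borel} \<Rightarrow> 'a \<Rightarrow> bool" and H G m +
  fixes N :: real
  assumes nonbranching: "null_nonbranching le H"
    and N: "1 < N"
    and NC: "NCe le H G m N"
    and future_complete: "future_complete le H G"
begin

abbreviation "Hi \<equiv> causal_interior le H"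

lemma le_refl [simp]: "le x x"
  using le_reflp by (rule reflpD)

lemma le_trans [trans]: "le x y \<Longrightarrow> le y z \<Longrightarrow> le x z"
  using le_transp by (rule transpD)

lemma Hi_subset: "Hi \<subseteq> H"
  by (auto simp: causal_interior_def)

lemma Hi_H: "x \<in> Hi \<Longrightarrow> x \<in> H"
  using Hi_subset by blast

lemma HiI: "y \<in> H \<Longrightarrow> x \<in> H \<Longrightarrow> z \<in> H \<Longrightarrow> le x y \<Longrightarrow> x \<noteq> y \<Longrightarrow> le y z \<Longrightarrow> z \<noteq> y \<Longrightarrow> y \<in> Hi"
  unfolding causal_interior_def initial_points_def final_points_def by blast

lemma Hi_past: "x \<in> Hi \<Longrightarrow> \<exists>w\<in>H. le w x \<and> w \<noteq> x"
  unfolding causal_interior_def initial_points_def by blast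

lemma Hi_future: "x \<in> Hi \<Longrightarrow> \<exists>w\<in>H. le x w \<and> w \<noteq> x"
  unfolding causal_interior_def final_points_def by blast

lemma sets_le:
  assumes "f \<in> borel_measurable M" "g \<in> borel_measurable M"
  shows "{x \<in> space M. le (f x) (g x)} \<in> sets M"
proof -
  have "(\<lambda>x. (f x, g x)) -` {(x, y). le x y} \<inter> space M \<in> sets M"
    by (intro measurable_sets[OF borel_measurable_Pair[OF assms]] borel_closed closed_le)
  also have "(\<lambda>x. (f x, g x)) -` {(x, y). le x y} \<inter> space M = {x \<in> space M. le (f x) (g x)}"
    by auto
  finally show ?thesis .
qed

lemma sets_m: "sets m = sets (borel_on H)"
  using radon_m by (simp add: radon_on_def)

lemma space_m: "space m = H"
  using sets_eq_imp_space_eq[OF sets_m] by (simp add: space_restrict_space)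

lemma sets_m_iff: "A \<in> sets m \<longleftrightarrow> A \<subseteq> H \<and> A \<in> sets borel"
  using closed_H by (auto simp: sets_m sets_restrict_space_iff)

lemma G_curve:
  assumes "causal_curve le I \<gamma>" "inj_on \<gamma> I" "\<gamma> ` I \<subseteq> Hi"
  shows "s \<in> I \<Longrightarrow> t \<in> I \<Longrightarrow> s < t \<Longrightarrow> G (\<gamma> s) < G (\<gamma> t)" "continuous_on I (\<lambda>t. G (\<gamma> t))"
proof -
  have "strict_mono_on I (G \<circ> \<gamma>) \<and> continuous_on I (G \<circ> \<gamma>)"
    using gauge_G assms unfolding gauge_for_def by blast
  then show "s \<in> I \<Longrightarrow> t \<in> I \<Longrightarrow> s < t \<Longrightarrow> G (\<gamma> s) < G (\<gamma> t)" "continuous_on I (\<lambda>t. G (\<gamma> t))"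
    by (simp_all add: strict_mono_on_def o_def)
qed

section \<open>Injective causal curves between related points\<close>

text \<open>\<open>NCe\<close> is applied to the Dirac measures at \<open>x\<close> and
  \<open>y\<close>. Almost every curve of the resulting probability measure has the required
  properties, so one exists.\<close>

lemma ex_G_causal_curve:
  assumes "x \<in> H" "y \<in> H" "le x y"
  shows "\<exists>\<gamma>\<in>G_causal_curves le H G. \<gamma> 0 = x \<and> \<gamma> 1 = y"
proof -
  let ?B = "borel_on H" and ?P = "borel_on H \<Otimes>\<^sub>M borel_on H"
  have [simp]: "space ?B = H" by (simp add: space_restrict_space)
  have id: "(\<lambda>z. z) \<in> borel_measurable ?B"
    by (rule measurable_restrict_space1) simp
  have fg: "fst \<in> borel_measurable ?P" "snd \<in> borel_measurable ?P"
    using measurable_compose[OF measurable_fst id] measurable_compose[OF measurable_snd id] by auto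
  let ?\<mu> = "\<lambda>z. return ?B z"
  have "return ?P (x, y) \<in> causal_couplings le H (?\<mu> x) (?\<mu> y)"
    unfolding causal_couplings_def
  proof (intro CollectI conjI)
    show "prob_space (return ?P (x, y))"
      using assms by (intro prob_space_return) (simp add: space_pair_measure space_restrict_space)
    show "distr (return ?P (x, y)) ?B fst = ?\<mu> x" "distr (return ?P (x, y)) ?B snd = ?\<mu> y"
      using assms by (simp_all add: distr_return space_pair_measure space_restrict_space)
    show "AE p in return ?P (x, y). le (fst p) (snd p)"
      using assms sets_le[OF fg] by (subst AE_return) (auto simp: space_pair_measure space_restrict_space pred_def)
  qed simp
  moreover have "prob_space (?\<mu> x)" "prob_space (?\<mu> y)"
    using assms by (auto intro!: prob_space_return)
  ultimately obtain \<nu> where \<nu>: "\<nu> \<in> OptGeo le H G (?\<mu> x) (?\<mu> y)"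
    using NC unfolding NCe_def by (metis empty_iff sets_return)
  then interpret prob_space \<nu> by (simp add: OptGeo_def)
  have sets: "sets \<nu> = sets (curve_borel H)" using \<nu> by (simp add: OptGeo_def)
  have eval: "(\<lambda>\<gamma>. \<gamma> t) \<in> measurable \<nu> ?B" if "t \<in> {0..1}" for t
    using measurable_curve_eval[OF that] by (subst measurable_cong_sets[OF sets refl])
  have end_AE: "AE \<gamma> in \<nu>. \<gamma> t = z" if t: "t \<in> {0..1}" and z: "z \<in> H" and d: "distr \<nu> ?B (\<lambda>\<gamma>. \<gamma> t) = ?\<mu> z" for t z
  proof -
    have zB: "{w \<in> space ?B. w = z} \<in> sets ?B"
      using z by (simp add: sets_restrict_space_iff space_restrict_space closed_H conj_commute Collect_conv_if)
    have "AE w in ?\<mu> z. w = z"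
      using z zB by (subst AE_return) (auto simp: pred_def space_restrict_space)
    then have "AE w in distr \<nu> ?B (\<lambda>\<gamma>. \<gamma> t). w = z" by (simp only: d)
    then show ?thesis using AE_distr_iff[OF eval[OF t] zB] by blast
  qed
  have "AE \<gamma> in \<nu>. \<gamma> \<in> G_causal_curves le H G" and
      "distr \<nu> ?B (\<lambda>\<gamma>. \<gamma> 0) = ?\<mu> x" "distr \<nu> ?B (\<lambda>\<gamma>. \<gamma> 1) = ?\<mu> y"
    using \<nu> by (simp_all add: OptGeo_def)
  moreover from this have "AE \<gamma> in \<nu>. \<gamma> 0 = x" "AE \<gamma> in \<nu>. \<gamma> 1 = y"
    using assms by (intro end_AE; simp)+
  ultimately have "AE \<gamma> in \<nu>. \<gamma> \<in> G_causal_curves le H G \<and> \<gamma> 0 = x \<and> \<gamma> 1 = y"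
    by auto
  then have "\<exists>\<gamma>. \<gamma> \<in> G_causal_curves le H G \<and> \<gamma> 0 = x \<and> \<gamma> 1 = y"
    by (rule eventually_happens'[OF ae_filter_bot])
  then show ?thesis by blast
qed

lemma G_causal_curvesD:
  assumes "\<gamma> \<in> G_causal_curves le H G" "\<gamma> s \<noteq> \<gamma> t" "s \<in> {0..1}" "t \<in> {0..1}"
  shows "causal_curve le {0..1} \<gamma>" "\<gamma> ` {0<..<1} \<subseteq> Hi" "\<gamma> ` {0..1} \<subseteq> H"
    "\<exists>a b. \<forall>t\<in>{0<..<1}. G (\<gamma> t) = a + b * t"
proof -
  have "\<not> (\<exists>x. \<forall>t\<in>{0..1}. \<gamma> t = x)" using assms(2-4) by metis
  then show "causal_curve le {0..1} \<gamma>" "\<gamma> ` {0<..<1} \<subseteq> Hi" "\<exists>a b. \<forall>t\<in>{0<..<1}. G (\<gamma> t) = a + b * t"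
    using assms(1) unfolding G_causal_curves_def by blast+
  show "\<gamma> ` {0..1} \<subseteq> H"
    using assms(1) mspace_curve_spaceD(2)[of \<gamma> H] unfolding G_causal_curves_def by blast
qed

text \<open>An arc inside a causal loop would be causal in both directions, contradicting the strict
  monotonicity of the gauge.\<close>

lemma le_antisym_H:
  assumes x: "x \<in> H" and y: "y \<in> H" and xy: "le x y" "le y x"
  shows "x = y"
proof (rule ccontr)
  assume "x \<noteq> y"
  obtain \<gamma> where \<gamma>: "\<gamma> \<in> G_causal_curves le H G" "\<gamma> 0 = x" "\<gamma> 1 = y"
    using ex_G_causal_curve[OF x y xy(1)] by blast
  have c: "causal_curve le {0..1} \<gamma>" and int: "\<gamma> ` {0<..<1} \<subseteq> Hi"
    using G_causal_curvesD[OF \<gamma>(1), of 0 1] \<gamma>(2,3) \<open>x \<noteq> y\<close> by auto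
  \<comment> \<open>In a loop, each of the two points is both an earlier and a later neighbour of
    the other.\<close>
  have "x \<in> Hi" "y \<in> Hi" using HiI x y xy \<open>x \<noteq> y\<close> by metis+
  have img: "\<gamma> ` {0..1} \<subseteq> Hi"
  proof
    fix z assume "z \<in> \<gamma> ` {0..1}"
    then obtain t where "t \<in> {0..1}" "z = \<gamma> t" by blast
    then show "z \<in> Hi"
      using int \<gamma>(2,3) \<open>x \<in> Hi\<close> \<open>y \<in> Hi\<close> by (cases "t = 0 \<or> t = 1") (auto simp: image_subset_iff)
  qed
  have "le x z \<and> le z y" if "z \<in> \<gamma> ` {0..1}" for z
    using that causal_curveD(2)[OF c, of 0] causal_curveD(2)[OF c, of _ 1] \<gamma>(2,3) by auto
  then have all: "le u v" if "u \<in> \<gamma> ` {0..1}" "v \<in> \<gamma> ` {0..1}" for u v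
    using that xy(2) le_trans by metis
  have "\<gamma> 0 \<noteq> \<gamma> 1" using \<gamma>(2,3) \<open>x \<noteq> y\<close> by simp
  then obtain q :: "real \<Rightarrow> 'a" where q: "continuous_on {0..1} q" "inj_on q {0..1}" "q ` {0..1} \<subseteq> \<gamma> ` {0..1}"
      "q 0 = \<gamma> 0" "q 1 = \<gamma> 1"
    by (rule path_contains_arc_metric[OF causal_curveD(1)[OF c]])
  have qall: "le (q s) (q t)" if "s \<in> {0..1}" "t \<in> {0..1}" for s t
    using that q(3) by (intro all) auto
  have "causal_curve le {0..1} q" "causal_curve (\<lambda>x y. le y x) {0..1} q"
    using q(1) qall by (auto simp: causal_curve_def is_interval_cc)
  note c1 = this(1) and c2 = causal_curve_reverse[OF this(2)]
  have qHi: "q ` {0..1} \<subseteq> Hi" using q(3) img by blast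
  have "(\<lambda>t. q (1 - t)) ` {0..1} \<subseteq> Hi" using qHi by (auto simp: image_subset_iff)
  note qHi' = this
  have "G (q 0) < G (q 1)" by (rule G_curve(1)[OF c1 q(2) qHi]) auto
  moreover have "G (q (1 - 0)) < G (q (1 - 1))"
    by (rule G_curve(1)[OF c2 inj_on_reverse[OF q(2)] qHi', where s = 0 and t = 1]) auto
  ultimately show False by simp
qed

text \<open>A causal curve may pause, but here the gauge is affine in the inner times. An arc
  between two distinct inner points is causal by \<open>arc_in_chain_monotone\<close>, so the gauge
  increases strictly along it and the slope is not zero. Hence inner times give distinct points. A
  coincidence of any two times would, by antisymmetry, make the curve constant between them.\<close>

lemma G_causal_curve_inj:
  assumes \<gamma>: "\<gamma> \<in> G_causal_curves le H G" and ne: "\<gamma> 0 \<noteq> \<gamma> 1"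
  shows "inj_on \<gamma> {0..1}"
proof -
  have "(0::real) \<in> {0..1}" "(1::real) \<in> {0..1}" by auto
  note \<gamma>D = G_causal_curvesD[OF \<gamma> ne this]
  have c: "causal_curve le {0..1} \<gamma>" and int: "\<gamma> ` {0<..<1} \<subseteq> Hi" and H: "\<gamma> ` {0..1} \<subseteq> H"
    by (fact \<gamma>D(1), fact \<gamma>D(2), fact \<gamma>D(3))
  note cD = causal_curveD[OF c]
  have anti: "u = v" if "u \<in> \<gamma> ` {0..1}" "v \<in> \<gamma> ` {0..1}" "le u v" "le v u" for u v
    using that H by (intro le_antisym_H) auto
  have total: "le u v \<or> le v u" if uv: "u \<in> \<gamma> ` {0..1}" "v \<in> \<gamma> ` {0..1}" for u v
  proof -
    obtain s t where "s \<in> {0..1}" "t \<in> {0..1}" "u = \<gamma> s" "v = \<gamma> t" using uv by blast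
    then show ?thesis using cD(2)[of s t] cD(2)[of t s] by (cases "s \<le> t") auto
  qed
  obtain a b where ab: "\<And>t. t \<in> {0<..<1} \<Longrightarrow> G (\<gamma> t) = a + b * t" using \<gamma>D(4) by auto
  \<comment> \<open>Constancy on the open interval would extend by continuity to both end points,
    which differ.\<close>
  have "\<exists>s\<in>{0<..<1}. \<exists>t\<in>{0<..<1}. s < t \<and> \<gamma> s \<noteq> \<gamma> t"
  proof (rule ccontr)
    assume nex: "\<not> ?thesis"
    have lt: "\<gamma> s = \<gamma> t" if "s \<in> {0<..<1}" "t \<in> {0<..<1}" "s < t" for s t
    proof (rule ccontr)
      assume "\<gamma> s \<noteq> \<gamma> t"
      with that nex show False by metis
    qed
    have eq: "\<gamma> s = \<gamma> t" if "s \<in> {0<..<1}" "t \<in> {0<..<1}" for s t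
    proof (cases s t rule: linorder_cases)
      case less then show ?thesis by (rule lt[OF that])
    next
      case greater then show ?thesis by (rule lt[OF that(2,1), symmetric])
    qed simp
    have mid: "\<gamma> t = \<gamma> (1/2)" if "t \<in> {0<..<1}" for t
      using that by (intro eq) auto
    have cl: "closure {0<..<1::real} = {0..1}" by simp
    have "\<gamma> t = \<gamma> (1/2)" if "t \<in> {0..1}" for t
      by (rule continuous_constant_on_closure[of "{0<..<1::real}" \<gamma>])
        (use cD(1) that mid in \<open>simp_all only: cl\<close>)
    then have "\<gamma> 0 = \<gamma> (1/2)" "\<gamma> 1 = \<gamma> (1/2)" by (simp_all only: atLeastAtMost_iff zero_le_one order_refl simp_thms)
    with ne show False by metis
  qed
  then obtain s t where st: "s \<in> {0<..<1}" "t \<in> {0<..<1}" "s < t" "\<gamma> s \<noteq> \<gamma> t" by blast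
  let ?r = "\<lambda>u. \<gamma> (s + u * (t - s))"
  have r: "s + u * (t - s) \<in> {s..t}" if "u \<in> {0..1}" for u
  proof -
    have "0 \<le> (1 - u) * (t - s)" using that st(3) by auto
    moreover have "s + u * (t - s) = t - (1 - u) * (t - s)" by (simp add: algebra_simps)
    moreover have "0 \<le> u * (t - s)" using that st(3) by auto
    ultimately have "s \<le> s + u * (t - s)" "s + u * (t - s) \<le> t" by linarith+
    then show ?thesis by (simp only: atLeastAtMost_iff)
  qed
  have "continuous_on {0..1} ?r"
    by (rule continuous_on_compose2[OF cD(1)]) (use r st in \<open>fastforce intro!: continuous_intros\<close>)+
  moreover have "?r 0 \<noteq> ?r 1" using st(4) by simp
  ultimately obtain q :: "real \<Rightarrow> 'a" where q: "continuous_on {0..1} q" "inj_on q {0..1}" "q ` {0..1} \<subseteq> ?r ` {0..1}"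
      "q 0 = ?r 0" "q 1 = ?r 1"
    by (rule path_contains_arc_metric)
  have "?r ` {0..1} \<subseteq> \<gamma> ` {0<..<1}"
  proof (rule image_subsetI)
    fix u :: real assume "u \<in> {0..1}"
    from r[OF this] st have "s + u * (t - s) \<in> {0<..<1}"
      unfolding atLeastAtMost_iff greaterThanLessThan_iff by linarith
    then show "?r u \<in> \<gamma> ` {0<..<1}" by (rule imageI)
  qed
  then have qi: "q ` {0..1} \<subseteq> \<gamma> ` {0<..<1}" using q(3) by blast
  then have qi': "q ` {0..1} \<subseteq> \<gamma> ` {0..1}" by fastforce
  have "causal_curve le {0..1} q"
  proof (rule arc_in_chain_monotone[OF closed_le q(1,2)])
    show "le (q 0) (q 1)" using cD(2)[of s t] st q(4,5) by simp
    fix u v assume "u \<in> q ` {0..1}" "v \<in> q ` {0..1}"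
    then have uv: "u \<in> \<gamma> ` {0..1}" "v \<in> \<gamma> ` {0..1}" using qi' by (auto dest: subsetD)
    show "le u v \<or> le v u" by (rule total[OF uv])
    show "le u v \<Longrightarrow> le v u \<Longrightarrow> u = v" by (rule anti[OF uv])
  qed
  from G_curve(1)[OF this q(2), of 0 1] have "G (\<gamma> s) < G (\<gamma> t)"
    using qi int q(4,5) by auto
  then have "b * s < b * t" using ab st by simp
  then have b: "b \<noteq> 0" by auto
  have inj: "u = v" if "u \<in> {0<..<1}" "v \<in> {0<..<1}" "\<gamma> u = \<gamma> v" for u v
  proof -
    have "a + b * u = a + b * v" by (simp only: ab[OF that(1), symmetric] ab[OF that(2), symmetric] that(3))
    with b show ?thesis by simp
  qed
  have const: "\<gamma> w = \<gamma> u" if "\<gamma> u = \<gamma> v" "u \<le> w" "w \<le> v" "0 \<le> u" "v \<le> 1" for u v w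
  proof (rule anti)
    have "u \<in> {0..1}" "w \<in> {0..1}" "v \<in> {0..1}" using that by simp_all
    then show "\<gamma> w \<in> \<gamma> ` {0..1}" "\<gamma> u \<in> \<gamma> ` {0..1}" "le (\<gamma> u) (\<gamma> w)" "le (\<gamma> w) (\<gamma> u)"
      using cD(2)[of u w] cD(2)[of w v] that by simp_all
  qed
  have "u = v" if uv: "0 \<le> u" "u \<le> v" "v \<le> 1" "\<gamma> u = \<gamma> v" for u v
  proof (rule ccontr)
    assume "u \<noteq> v"
    with uv have "u < v" by simp
    \<comment> \<open>Two times strictly between, since \<open>u\<close> and \<open>v\<close> may be
      0 and 1, where affinity is not known.\<close>
    then obtain w1 where w1: "u < w1" "w1 < v" using dense by blast
    then obtain w2 where w2: "w1 < w2" "w2 < v" using dense by blast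
    have "\<gamma> w1 = \<gamma> u" "\<gamma> w2 = \<gamma> u" by (rule const[OF uv(4)]; use uv w1 w2 in linarith)+
    then have "w1 = w2" by (intro inj) (use w1 w2 uv in auto)
    then show False using w2 by simp
  qed
  then show ?thesis
    by (intro inj_onI) (metis atLeastAtMost_iff linear)
qed

lemma ex_injective_curve:
  assumes "x \<in> H" "y \<in> H" "le x y" "x \<noteq> y"
  shows "\<exists>\<gamma>. causal_curve le {0..1} \<gamma> \<and> inj_on \<gamma> {0..1} \<and> \<gamma> ` {0..1} \<subseteq> H \<and> \<gamma> 0 = x \<and> \<gamma> 1 = y
    \<and> \<gamma> ` {0<..<1} \<subseteq> Hi"
proof -
  obtain \<gamma> where \<gamma>: "\<gamma> \<in> G_causal_curves le H G" "\<gamma> 0 = x" "\<gamma> 1 = y"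
    using ex_G_causal_curve assms by blast
  then show ?thesis
    using G_causal_curve_inj[OF \<gamma>(1)] G_causal_curvesD[OF \<gamma>(1), of 0 1] assms(4)
    by (intro exI[of _ \<gamma>]) auto
qed

section \<open>Order and gauge along rays\<close>

text \<open>Membership of \<open>x\<close> in \<open>Hi\<close> supplies the earlier point that
  \<open>nonbranching_future_chain\<close> asks for.\<close>

lemma future_chain:
  assumes "x \<in> Hi" "y \<in> H" "z \<in> H" "le x y" "le x z"
  shows "le y z \<or> le z y"
proof -
  obtain w where "w \<in> H" "le w x" "w \<noteq> x" using Hi_past[OF assms(1)] by blast
  then show ?thesis
    using assms ex_injective_curve nonbranching
    by (intro nonbranching_future_chain[of le H w x]) (auto simp: null_nonbranching_def le_transp Hi_H intro: le_antisym_H)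
qed

text \<open>Time reversal of \<open>future_chain\<close>: backward non-branching, with a later point
  of \<open>H\<close> in the role of \<open>w\<close> and all curves run backwards.\<close>

lemma past_chain:
  assumes "x \<in> Hi" "y \<in> H" "z \<in> H" "le y x" "le z x"
  shows "le y z \<or> le z y"
proof -
  obtain w where w: "w \<in> H" "le x w" "w \<noteq> x" using Hi_future[OF assms(1)] by blast
  let ?ge = "\<lambda>x y. le y x"
  have "?ge y z \<or> ?ge z y"
  proof (rule nonbranching_future_chain[of ?ge H w x])
    show "forward_null_nonbranching ?ge H" using nonbranching by (simp add: null_nonbranching_def)
    show "transp ?ge" using le_transp by (auto simp: transp_def)
    fix x y assume "x \<in> H" "y \<in> H" "?ge x y" "x \<noteq> y"
    then obtain \<gamma> where \<gamma>: "causal_curve le {0..1} \<gamma>" "inj_on \<gamma> {0..1}" "\<gamma> ` {0..1} \<subseteq> H" "\<gamma> 0 = y" "\<gamma> 1 = x"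
      using ex_injective_curve by metis
    then show "\<exists>\<gamma>. causal_curve ?ge {0..1} \<gamma> \<and> inj_on \<gamma> {0..1} \<and> \<gamma> ` {0..1} \<subseteq> H \<and> \<gamma> 0 = x \<and> \<gamma> 1 = y"
      by (intro exI[of _ "\<lambda>t. \<gamma> (1 - t)"])
        (auto intro!: causal_curve_reverse inj_on_reverse simp: image_subset_iff)
  qed (use w assms le_antisym_H Hi_H in auto)
  then show ?thesis by blast
qed

lemma inj_curve_in_Hi:
  assumes "\<gamma> ` {0<..<1::real} \<subseteq> Hi" "\<gamma> 0 \<in> Hi" "\<gamma> 1 \<in> Hi"
  shows "\<gamma> ` {0..1} \<subseteq> Hi"
proof
  fix z assume "z \<in> \<gamma> ` {0..1}"
  then obtain t where t: "t \<in> {0..1}" "z = \<gamma> t" by blast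
  consider "t = 0" | "t = 1" | "t \<in> {0<..<1}" using t(1) by force
  then show "z \<in> Hi" using assms t(2) by cases auto
qed

lemma G_strict_mono:
  assumes "x \<in> Hi" "y \<in> Hi" "le x y" "x \<noteq> y"
  shows "G x < G y"
proof -
  obtain \<gamma> where \<gamma>: "causal_curve le {0..1} \<gamma>" "inj_on \<gamma> {0..1}" "\<gamma> 0 = x" "\<gamma> 1 = y" "\<gamma> ` {0<..<1} \<subseteq> Hi"
    using ex_injective_curve[OF Hi_H Hi_H] assms by metis
  have "\<gamma> ` {0..1} \<subseteq> Hi" by (rule inj_curve_in_Hi) (use \<gamma> assms in auto)
  then have "G (\<gamma> 0) < G (\<gamma> 1)" by (rule G_curve(1)[OF \<gamma>(1,2)]) auto
  then show ?thesis using \<gamma> by simp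
qed

lemma G_mono: "x \<in> Hi \<Longrightarrow> y \<in> Hi \<Longrightarrow> le x y \<Longrightarrow> G x \<le> G y"
  using G_strict_mono by (cases "x = y") (auto intro: less_imp_le)

text \<open>Comparability is thus an equivalence relation on \<open>Hi\<close>, and its classes are
  the rays.\<close>

lemma comparable_trans:
  assumes "x \<in> Hi" "y \<in> Hi" "z \<in> Hi" "le x y \<or> le y x" "le x z \<or> le z x"
  shows "le y z \<or> le z y"
  using assms future_chain[of x y z] past_chain[of x y z] le_trans[of y x z] le_trans[of z x y]
  by (auto dest: Hi_H)

lemma le_iff_G:
  assumes "x \<in> Hi" "y \<in> Hi" "le x y \<or> le y x"
  shows "le x y \<longleftrightarrow> G x \<le> G y"
proof
  assume "G x \<le> G y"
  then show "le x y" using assms G_strict_mono[of y x] by (cases "x = y") auto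
qed (rule G_mono[OF assms(1,2)])

lemma comparable_eq:
  assumes "x \<in> Hi" "y \<in> Hi" "le x y \<or> le y x" "G x = G y"
  shows "x = y"
  using assms G_strict_mono[of x y] G_strict_mono[of y x] by force

text \<open>The earlier point given by \<open>Hi_past\<close> may be initial in \<open>H\<close>;
  the midpoint of a curve from it to \<open>y\<close> is interior.\<close>

lemma ex_earlier:
  assumes "y \<in> Hi"
  obtains p where "p \<in> Hi" "le p y" "p \<noteq> y"
proof -
  obtain w where w: "w \<in> H" "le w y" "w \<noteq> y" using Hi_past[OF assms] by blast
  then obtain \<gamma> where \<gamma>: "causal_curve le {0..1} \<gamma>" "inj_on \<gamma> {0..1}" "\<gamma> 0 = w" "\<gamma> 1 = y" "\<gamma> ` {0<..<1} \<subseteq> Hi"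
    using ex_injective_curve[OF _ Hi_H[OF assms]] by metis
  show thesis
  proof
    show "\<gamma> (1/2) \<in> Hi" by (rule subsetD[OF \<gamma>(5)]) auto
    have "le (\<gamma> (1/2)) (\<gamma> 1)" by (rule causal_curveD(2)[OF \<gamma>(1)]) auto
    then show "le (\<gamma> (1/2)) y" using \<gamma>(4) by simp
    show "\<gamma> (1/2) \<noteq> y"
    proof
      assume "\<gamma> (1/2) = y"
      then have "\<gamma> (1/2) = \<gamma> 1" using \<gamma>(4) by simp
      then have "1/2 = (1::real)" by (rule inj_onD[OF \<gamma>(2)]) auto
      then show False by simp
    qed
  qed
qed

text \<open>A future end-point of the ray would bound the gauge on the ray, by the second gauge axiom.\<close>

lemma future_in_Hi:
  assumes x: "x \<in> Hi" and y: "y \<in> H" and xy: "le x y"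
  shows "y \<in> Hi"
proof (rule ccontr)
  assume "y \<notin> Hi"
  with x have "x \<noteq> y" by blast
  have final: "z = y" if "z \<in> H" "le y z" for z
    using HiI[OF y Hi_H[OF x] that(1) xy \<open>x \<noteq> y\<close> that(2)] \<open>y \<notin> Hi\<close> by blast
  obtain \<gamma> where \<gamma>: "causal_curve le {0..1} \<gamma>" "inj_on \<gamma> {0..1}" "\<gamma> ` {0..1} \<subseteq> H" "\<gamma> 0 = x" "\<gamma> 1 = y" "\<gamma> ` {0<..<1} \<subseteq> Hi"
    using ex_injective_curve[OF Hi_H[OF x] y xy \<open>x \<noteq> y\<close>] by blast
  have "bdd_above ((G \<circ> \<gamma>) ` {0<..<1})"
  proof -
    have "causal_curve le {0..1} \<gamma> \<and> \<gamma> ` {0..1} \<subseteq> H \<and> \<gamma> ` {0<..<1} \<subseteq> Hi \<longrightarrow>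
        bdd_above ((G \<circ> \<gamma>) ` {0<..<1}) \<and> bdd_below ((G \<circ> \<gamma>) ` {0<..<1})"
      using gauge_G unfolding gauge_for_def by (elim conjE) (erule spec)
    with \<gamma>(1,3,6) show ?thesis by (simp only: simp_thms)
  qed
  then obtain B where "\<forall>g\<in>(G \<circ> \<gamma>) ` {0<..<1}. g \<le> B"
    unfolding bdd_above_def by blast
  then have B: "\<And>s. s \<in> {0<..<1} \<Longrightarrow> G (\<gamma> s) \<le> B" by simp
  have "(SUP y\<in>causal_future le {x} \<inter> Hi. ereal (G y)) = \<infinity>"
    using future_complete x unfolding future_complete_def by blast
  then obtain y' where "y' \<in> causal_future le {x} \<inter> Hi" "ereal B < ereal (G y')"
    using less_SUP_iff[of "ereal B" "\<lambda>y. ereal (G y)" "causal_future le {x} \<inter> Hi"] by auto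
  then have y': "le x y'" "y' \<in> Hi" "B < G y'" by (auto simp: causal_future_def)
  have "\<not> le y y'" using final[OF Hi_H[OF y'(2)]] y'(2) \<open>y \<notin> Hi\<close> by metis
  \<comment> \<open>Otherwise every inner point of the curve precedes \<open>y'\<close>, the future
    of \<open>x\<close> being a chain. Closedness of \<open>le\<close> carries this to time 1 and
    gives \<open>le y y'\<close>, which was just excluded.\<close>
  have "\<exists>s\<in>{0<..<1}. le y' (\<gamma> s)"
  proof (rule ccontr)
    assume no: "\<not> ?thesis"
    have sub: "(\<lambda>s. (\<gamma> s, y')) ` {0<..<1} \<subseteq> {(x, y). le x y}"
    proof clarsimp
      fix s :: real assume s: "0 < s" "s < 1"
      then have "\<gamma> s \<in> Hi" using \<gamma>(6) by auto
      have "le (\<gamma> 0) (\<gamma> s)" by (rule causal_curveD(2)[OF \<gamma>(1)]) (use s in auto)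
      then have "le x (\<gamma> s)" using \<gamma>(4) by simp
      then have "le (\<gamma> s) y' \<or> le y' (\<gamma> s)"
        by (intro future_chain[OF x Hi_H Hi_H]) (use \<open>\<gamma> s \<in> Hi\<close> y' in auto)
      then show "le (\<gamma> s) y'" using no s by (metis greaterThanLessThan_iff)
    qed
    have "(\<lambda>s. (\<gamma> s, y')) ` closure {0<..<1} \<subseteq> {(x, y). le x y}"
      by (rule image_closure_subset[OF _ closed_le sub])
        (use causal_curveD(1)[OF \<gamma>(1)] in \<open>auto intro!: continuous_intros\<close>)
    then have "le (\<gamma> 1) y'" by (auto simp: image_subset_iff)
    then show False using \<gamma>(5) \<open>\<not> le y y'\<close> by simp
  qed
  then obtain s where s: "s \<in> {0<..<1}" "le y' (\<gamma> s)" by blast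
  then have "G y' \<le> G (\<gamma> s)" using \<gamma>(6) by (intro G_mono y') auto
  with B[OF s(1)] y'(3) show False by simp
qed

lemma ex_later:
  assumes x: "x \<in> Hi"
  obtains y where "y \<in> Hi" "le x y" "c < G y"
proof -
  have "(SUP y\<in>causal_future le {x} \<inter> Hi. ereal (G y)) = \<infinity>"
    using future_complete x unfolding future_complete_def by blast
  then obtain y where "y \<in> causal_future le {x} \<inter> Hi" "ereal c < ereal (G y)"
    using less_SUP_iff[of "ereal c" "\<lambda>y. ereal (G y)" "causal_future le {x} \<inter> Hi"] by auto
  then show thesis by (intro that[of y]) (auto simp: causal_future_def)
qed

lemma G_IVT:
  assumes "x \<in> Hi" "z \<in> Hi" "le x z" "G x \<le> c" "c \<le> G z"
  obtains y where "y \<in> Hi" "le x y" "le y z" "G y = c"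
proof (cases "x = z")
  case True
  then show ?thesis using assms by (intro that[of x]) auto
next
  case False
  obtain \<gamma> where \<gamma>: "causal_curve le {0..1} \<gamma>" "inj_on \<gamma> {0..1}" "\<gamma> 0 = x" "\<gamma> 1 = z" "\<gamma> ` {0<..<1} \<subseteq> Hi"
    using ex_injective_curve[OF Hi_H Hi_H] assms False by metis
  have Hi: "\<gamma> ` {0..1} \<subseteq> Hi" by (rule inj_curve_in_Hi) (use \<gamma> assms in auto)
  obtain t where t: "0 \<le> t" "t \<le> 1" "G (\<gamma> t) = c"
    using IVT'[of "\<lambda>t. G (\<gamma> t)" 0 c 1] G_curve(2)[OF \<gamma>(1,2) Hi] \<gamma>(3,4) assms(4,5) by auto
  show thesis
  proof (rule that[OF _ _ _ t(3)])
    show "\<gamma> t \<in> Hi" using Hi t by auto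
    have "le (\<gamma> 0) (\<gamma> t)" "le (\<gamma> t) (\<gamma> 1)"
      by (rule causal_curveD(2)[OF \<gamma>(1)]; use t in auto)+
    then show "le x (\<gamma> t)" "le (\<gamma> t) z" using \<gamma>(3,4) by simp_all
  qed
qed

text \<open>The definition gives affinity only on the open interval. With both end points in
  \<open>Hi\<close> the gauge is continuous along the whole curve, so the formula extends to the
  ends and its coefficients can be read off there. Equal end points force a constant curve by
  antisymmetry.\<close>

lemma G_causal_curve_affine:
  assumes \<gamma>: "\<gamma> \<in> G_causal_curves le H G" and ends: "\<gamma> 0 \<in> Hi" "\<gamma> 1 \<in> Hi" and t: "t \<in> {0..1}"
  shows "\<gamma> t \<in> Hi" "le (\<gamma> 0) (\<gamma> t)" "le (\<gamma> t) (\<gamma> 1)" "G (\<gamma> t) = (1 - t) * G (\<gamma> 0) + t * G (\<gamma> 1)"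
proof -
  have "\<gamma> t \<in> Hi \<and> le (\<gamma> 0) (\<gamma> t) \<and> le (\<gamma> t) (\<gamma> 1) \<and> G (\<gamma> t) = (1 - t) * G (\<gamma> 0) + t * G (\<gamma> 1)"
  proof (cases "\<gamma> 0 = \<gamma> 1")
    case True
    have "\<gamma> t = \<gamma> 0"
    proof (rule ccontr)
      assume ne: "\<gamma> t \<noteq> \<gamma> 0"
      have c: "causal_curve le {0..1} \<gamma>" and H: "\<gamma> ` {0..1} \<subseteq> H"
        using G_causal_curvesD[OF \<gamma> ne] t by auto
      have "le (\<gamma> 0) (\<gamma> t)" "le (\<gamma> t) (\<gamma> 1)"
        by (rule causal_curveD(2)[OF c]; use t in auto)+
      moreover have "\<gamma> t \<in> H" "\<gamma> 0 \<in> H" using H t by auto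
      ultimately show False using le_antisym_H ne True by metis
    qed
    moreover from this True have "\<gamma> t = \<gamma> 1" by metis
    ultimately show ?thesis using ends by (metis le_refl left_diff_distrib diff_add_cancel mult_1)
  next
    case False
    have c: "causal_curve le {0..1} \<gamma>" and int: "\<gamma> ` {0<..<1} \<subseteq> Hi"
      and "\<exists>a b. \<forall>t\<in>{0<..<1}. G (\<gamma> t) = a + b * t"
      using G_causal_curvesD[OF \<gamma> False] by auto
    then obtain a b where ab: "\<And>t. t \<in> {0<..<1} \<Longrightarrow> G (\<gamma> t) = a + b * t" by blast
    have Hi: "\<gamma> ` {0..1} \<subseteq> Hi" by (rule inj_curve_in_Hi[OF int ends])
    have "continuous_on {0..1} (\<lambda>t. G (\<gamma> t) - (a + b * t))"
      by (intro continuous_intros G_curve(2)[OF c G_causal_curve_inj[OF \<gamma> False] Hi])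
    then have cont: "continuous_on (closure {0<..<1}) (\<lambda>t. G (\<gamma> t) - (a + b * t))" by simp
    have ab': "G (\<gamma> t) = a + b * t" if "t \<in> {0..1}" for t
      using continuous_constant_on_closure[OF cont, of 0 t] ab that by auto
    have "G (\<gamma> t) = (1 - t) * G (\<gamma> 0) + t * G (\<gamma> 1)"
      using ab'[of 0] ab'[of 1] ab'[OF t] by (simp add: algebra_simps)
    moreover have "le (\<gamma> 0) (\<gamma> t)" "le (\<gamma> t) (\<gamma> 1)"
      by (rule causal_curveD(2)[OF c]; use t in auto)+
    ultimately show ?thesis using Hi t by blast
  qed
  then show "\<gamma> t \<in> Hi" "le (\<gamma> 0) (\<gamma> t)" "le (\<gamma> t) (\<gamma> 1)" "G (\<gamma> t) = (1 - t) * G (\<gamma> 0) + t * G (\<gamma> 1)"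
    by auto
qed

section \<open>The flow and the thickenings in terms of order and gauge\<close>

lemma ray_eq:
  assumes "x \<in> Hi" "y \<in> ray_of le H x" "y' \<in> ray_of le H x" "G y = G y'"
  shows "y = y'"
  using assms comparable_trans[of x y y'] by (intro comparable_eq) (auto simp: ray_of_def)

lemma flow_times_eq: "x \<in> Hi \<Longrightarrow> flow_times le H G x = (\<lambda>y. G y - G x) ` ray_of le H x"
  unfolding flow_times_def using ray_eq by (auto intro!: image_eqI)

lemma flow_point_eq: "x \<in> Hi \<Longrightarrow> y \<in> ray_of le H x \<Longrightarrow> flow_point le H G x (G y - G x) = y"
  unfolding flow_point_def using ray_eq[of x] by (intro the_equality) auto

text \<open>The extension of the flow to the past end-point of a ray plays no role: that end-point is
  not in \<^term>\<open>Hi\<close>.\<close>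

lemma flows_to_iff:
  assumes x: "x \<in> Hi" and y: "y \<in> Hi" and r: "0 < r"
  shows "flows_to le H G x (- r) y \<longleftrightarrow> le y x \<and> G x - G y = r"
proof
  assume "le y x \<and> G x - G y = r"
  then have ray: "y \<in> ray_of le H x" and r: "- r = G y - G x"
    using y by (auto simp: ray_of_def)
  then show "flows_to le H G x (- r) y"
    unfolding flows_to_def Let_def flow_times_eq[OF x] r flow_point_eq[OF x ray] by blast
next
  let ?T = "flow_times le H G x" and ?f = "flow_point le H G x"
  note T = flow_times_eq[OF x]
  have x_ray: "x \<in> ray_of le H x" using x by (simp add: ray_of_def)
  assume "flows_to le H G x (- r) y"
  then consider "- r \<in> ?T" "y = ?f (- r)"
    | "(\<forall>s\<in>?T. s < - r) \<or> (\<forall>s\<in>?T. - r < s)" "- r islimpt ?T" "(?f \<longlongrightarrow> y) (at (- r) within ?T)"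
    unfolding flows_to_def Let_def by blast
  then show "le y x \<and> G x - G y = r"
  proof cases
    case 1
    then obtain y' where y': "y' \<in> ray_of le H x" "- r = G y' - G x" unfolding T by blast
    then have "y = y'" using flow_point_eq[OF x y'(1)] 1(2) by simp
    moreover have "le y' x"
      using y' le_iff_G[of y' x] x r by (auto simp: ray_of_def)
    ultimately show ?thesis using y'(2) by simp
  next
    case 2
    have "0 \<in> ?T" unfolding T using x_ray by force
    then have low: "- r < s" if "s \<in> ?T" for s using 2(1) that r by force
    \<comment> \<open>The limit point \<open>y\<close> precedes the whole ray: for parameters near
      \<open>- r\<close> the flow points have smaller gauge than \<open>p\<close>, hence precede
      \<open>p\<close>, and \<open>le\<close> is closed.\<close>
    have below: "le y p" if p: "p \<in> ray_of le H x" for p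
    proof -
      have "- r < G p - G x" using low p unfolding T by blast
      then have "\<forall>\<^sub>F s in at (- r) within ?T. s < G p - G x"
        by (intro order_tendstoD(2)[OF tendsto_ident_at])
      moreover have "\<forall>\<^sub>F s in at (- r) within ?T. s \<in> ?T"
        by (simp add: eventually_at_filter)
      ultimately have e1: "\<forall>\<^sub>F s in at (- r) within ?T. (?f s, p) \<in> {(x, y). le x y}"
      proof eventually_elim
        case (elim s)
        then obtain q where q: "q \<in> ray_of le H x" "s = G q - G x" unfolding T by blast
        have "le q p"
          using le_iff_G[of q p] comparable_trans[of x q p] p q elim x by (auto simp: ray_of_def)
        then show ?case using flow_point_eq[OF x q(1)] q(2) by simp
      qed
      have e2: "at (- r) within ?T \<noteq> bot" using 2(2) by (simp add: trivial_limit_within)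
      have "((\<lambda>s. (?f s, p)) \<longlongrightarrow> (y, p)) (at (- r) within ?T)"
        by (intro tendsto_intros 2(3))
      from Lim_in_closed_set[OF closed_le e1 e2 this] show ?thesis by simp
    qed
    have "le y x" by (rule below[OF x_ray])
    \<comment> \<open>An interior \<open>y\<close> has a strictly earlier interior point, which lies
      on the same ray and so would have to come after \<open>y\<close>.\<close>
    obtain p where p: "p \<in> Hi" "le p y" "p \<noteq> y" using ex_earlier[OF y] by blast
    then have "le p x" using \<open>le y x\<close> le_trans by blast
    then have "le y p" using p(1) by (intro below) (simp add: ray_of_def)
    then show ?thesis using le_antisym_H[of y p] p y Hi_H by blast
  qed
qed

lemma forward_thickening_iff:
  assumes "S \<subseteq> Hi"
  shows "x \<in> forward_thickening le H G S \<epsilon> \<longleftrightarrow> x \<in> Hi \<and> (\<exists>y\<in>S. le y x \<and> 0 < G x - G y \<and> G x - G y < \<epsilon>)"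
proof
  assume "x \<in> forward_thickening le H G S \<epsilon>"
  then obtain r y where "x \<in> Hi" "r \<in> {0<..<\<epsilon>}" "y \<in> S" "flows_to le H G x (- r) y"
    unfolding forward_thickening_def by blast
  then show "x \<in> Hi \<and> (\<exists>y\<in>S. le y x \<and> 0 < G x - G y \<and> G x - G y < \<epsilon>)"
    using flows_to_iff[of x y r] assms by (auto intro!: bexI[of _ y])
next
  assume "x \<in> Hi \<and> (\<exists>y\<in>S. le y x \<and> 0 < G x - G y \<and> G x - G y < \<epsilon>)"
  then obtain y where y: "x \<in> Hi" "y \<in> S" "le y x" "0 < G x - G y" "G x - G y < \<epsilon>" by blast
  then have "flows_to le H G x (- (G x - G y)) y"
    using flows_to_iff[of x y "G x - G y"] assms by auto
  then show "x \<in> forward_thickening le H G S \<epsilon>"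
    unfolding forward_thickening_def using y by (intro CollectI conjI bexI[of _ "G x - G y"] bexI[of _ y]) auto
qed

subsection \<open>Borel maps along rays\<close>

lemma closed_past: "compact K \<Longrightarrow> closed {x. \<exists>y\<in>K. le x y}"
  using closed_fst_projection_compact[OF closed_le] by simp

lemma closed_future: "compact K \<Longrightarrow> closed {y. \<exists>x\<in>K. le x y}"
proof -
  assume K: "compact K"
  have "closed ((\<lambda>p. (snd p, fst p)) -` {(x, y). le x y})"
    by (intro closed_vimage closed_le continuous_intros)
  from closed_fst_projection_compact[OF this K] show ?thesis by simp
qed

lemma closed_le_sections: "closed {w. le w u}" "closed {w. le u w}"
  using closed_past[of "{u}"] closed_future[of "{u}"] by simp_all

text \<open>The condition that a related point differ from \<open>z\<close> is made countable: a
  point x \<noteq> z lies in some \<open>K n\<close> that misses \<open>z\<close>, and the points of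
  \<open>H\<close> after or before \<open>K n \<inter> H\<close> form a closed set.\<close>

lemma Hi_borel: "Hi \<in> sets borel"
proof -
  obtain K :: "nat \<Rightarrow> 'a set" where K: "\<And>n. compact (K n)" "\<And>U y. open U \<Longrightarrow> y \<in> U \<Longrightarrow> \<exists>n. y \<in> K n \<and> K n \<subseteq> U"
    using countable_compact_neighbourhoods by metis
  have off: "\<exists>n. x \<in> K n \<and> z \<notin> K n" if "x \<noteq> z" for x z
    using K(2)[of "- {z}" x] that by auto
  have KH: "compact (K n \<inter> H)" for n using K(1) closed_H by (rule compact_Int_closed)
  let ?P = "\<Union>n. (H \<inter> {z. \<exists>x\<in>K n \<inter> H. le x z}) - K n"
  let ?F = "\<Union>n. (H \<inter> {z. \<exists>x\<in>K n \<inter> H. le z x}) - K n"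
  have P: "z \<in> ?P \<longleftrightarrow> z \<in> H \<and> (\<exists>x\<in>H. le x z \<and> x \<noteq> z)" for z
    using off[of _ z] by blast
  have F: "z \<in> ?F \<longleftrightarrow> z \<in> H \<and> (\<exists>x\<in>H. le z x \<and> x \<noteq> z)" for z
    using off[of _ z] by blast
  have Hi: "z \<in> Hi \<longleftrightarrow> z \<in> H \<and> (\<exists>x\<in>H. le x z \<and> x \<noteq> z) \<and> (\<exists>x\<in>H. le z x \<and> x \<noteq> z)" for z
    unfolding causal_interior_def initial_points_def final_points_def by blast
  have "Hi = ?P \<inter> ?F"
    by (rule set_eqI) (simp only: Int_iff P F Hi, blast)
  also have "\<dots> \<in> sets borel"
    using closed_H closed_past[OF KH] closed_future[OF KH] compact_imp_closed[OF K(1)]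
    by (intro sets.Int sets.countable_UN sets.Diff image_subsetI) auto
  finally show ?thesis .
qed

text \<open>A gauge is Borel only relative to \<open>Hi\<close>. This version is Borel on the whole
  space and agrees with \<open>G\<close> where \<open>G\<close> matters.\<close>

definition Gb :: "'a \<Rightarrow> real" where
  "Gb x = (if x \<in> Hi then G x else 0)"

lemma Gb_eq: "x \<in> Hi \<Longrightarrow> Gb x = G x"
  by (simp add: Gb_def)

lemma Gb_borel [measurable]: "Gb \<in> borel_measurable borel"
proof -
  have "G \<in> borel_measurable (restrict_space borel Hi)"
    using gauge_G unfolding gauge_for_def by blast
  then show ?thesis
    using Hi_borel unfolding Gb_def
    by (subst (asm) measurable_restrict_space_iff[where c = 0]) auto
qed

text \<open>Borel choice of a point on the future ray with gauge in a prescribed window. For each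
  \<open>n\<close> a Borel map \<open>s n\<close> picks a point of \<open>K n \<inter> H\<close> in
  the future of its argument. If \<open>K n\<close> is a small neighbourhood of a suitable point of
  the ray, the picked point must have gauge in the window, so the first successful \<open>n\<close>
  is used. Where nothing can be picked, \<open>s n x = x\<close>, which keeps the point on the
  ray.\<close>

lemma later_selection:
  assumes X [measurable]: "X \<in> borel_measurable M"
    and lo [measurable]: "lo \<in> borel_measurable M" and hi [measurable]: "hi \<in> borel_measurable M"
  obtains Y where "Y \<in> borel_measurable M"
    "\<And>p. X p \<in> Hi \<Longrightarrow> lo p < hi p \<Longrightarrow> G (X p) < hi p \<Longrightarrow>
      le (X p) (Y p) \<and> Y p \<in> Hi \<and> lo p < G (Y p) \<and> G (Y p) < hi p"
proof -
  obtain K :: "nat \<Rightarrow> 'a set" where K: "\<And>n. compact (K n)" "\<And>U y. open U \<Longrightarrow> y \<in> U \<Longrightarrow> \<exists>n. y \<in> K n \<and> K n \<subseteq> U"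
    using countable_compact_neighbourhoods by metis
  have "\<exists>s. s \<in> borel_measurable borel \<and>
      (\<forall>x. (\<exists>y\<in>K n \<inter> H. le x y) \<longrightarrow> s x \<in> K n \<inter> H \<and> le x (s x)) \<and>
      (\<forall>x. \<not> (\<exists>y\<in>K n \<inter> H. le x y) \<longrightarrow> s x = x)" for n
  proof -
    let ?F = "\<lambda>x. K n \<inter> (H \<inter> {y. le x y})"
    obtain s where "s \<in> borel_measurable borel"
      "\<And>x. ?F x \<noteq> {} \<Longrightarrow> s x \<in> ?F x" "\<And>x. ?F x = {} \<Longrightarrow> s x = x"
    proof (rule measurable_selection_compact[of ?F borel "\<lambda>x. x"])
      show "compact (?F x)" for x
        by (intro compact_Int_closed K closed_Int closed_H closed_le_sections)
      fix C :: "'a set" assume "closed C"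
      then have "closed {x. \<exists>y\<in>K n \<inter> (H \<inter> C). le x y}"
        by (intro closed_past compact_Int_closed K closed_Int closed_H)
      then have "{x. \<exists>y\<in>K n \<inter> (H \<inter> C). le x y} \<in> sets borel" by simp
      also have "{x. \<exists>y\<in>K n \<inter> (H \<inter> C). le x y} = {x \<in> space borel. ?F x \<inter> C \<noteq> {}}" by auto
      finally show "{x \<in> space borel. ?F x \<inter> C \<noteq> {}} \<in> sets borel" .
    qed simp_all
    then show ?thesis by (intro exI[of _ s]) blast
  qed
  then obtain s where s [measurable]: "\<And>n. s n \<in> borel_measurable borel"
    and s1: "\<And>n x. \<exists>y\<in>K n \<inter> H. le x y \<Longrightarrow> s n x \<in> K n \<inter> H \<and> le x (s n x)"
    and s2: "\<And>n x. \<not> (\<exists>y\<in>K n \<inter> H. le x y) \<Longrightarrow> s n x = x"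
    by metis
  define Q where "Q n p \<longleftrightarrow> lo p < Gb (s n (X p)) \<and> Gb (s n (X p)) < hi p" for n p
  have sHi: "s n x \<in> Hi \<and> le x (s n x)" if "x \<in> Hi" for n x
  proof (cases "\<exists>y\<in>K n \<inter> H. le x y")
    case True
    then show ?thesis using s1[OF True] future_in_Hi[OF that] by blast
  next
    case False
    then show ?thesis using s2 that by simp
  qed
  have Q [measurable]: "(\<lambda>p. Q n p) \<in> measurable M (count_space UNIV)" for n
    unfolding Q_def by measurable
  define Y where "Y p = s (LEAST n. Q n p) (X p)" for p
  show thesis
  proof
    show "Y \<in> borel_measurable M"
      unfolding Y_def by (rule measurable_compose_countable[where f = "\<lambda>n p. s n (X p)"]) measurable
    fix p assume x: "X p \<in> Hi" and lh: "lo p < hi p" and xh: "G (X p) < hi p"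
    let ?x = "X p"
    \<comment> \<open>Three gauge values inside the window: \<open>K n\<close> is taken around the
      ray point at level \<open>c2\<close>, and the ray points at \<open>c1\<close> and
      \<open>c3\<close> fence it in.\<close>
    from lh xh have "max (lo p) (G ?x) < hi p" by simp
    then obtain c1 where c1: "max (lo p) (G ?x) < c1" "c1 < hi p" using dense by blast
    then obtain c2 where c2: "c1 < c2" "c2 < hi p" using dense by blast
    then obtain c3 where c3: "c2 < c3" "c3 < hi p" using dense by blast
    obtain e where e: "e \<in> Hi" "le ?x e" "c3 < G e" using ex_later[OF x] by blast
    obtain z where z: "z \<in> Hi" "le ?x z" "le z e" "G z = c3"
      by (rule G_IVT[OF x e(1,2), of c3]) (use c1 c2 c3 e in auto)
    obtain y where y: "y \<in> Hi" "le ?x y" "le y z" "G y = c2"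
      by (rule G_IVT[OF x z(1,2), of c2]) (use c1 c2 c3 z in auto)
    obtain u where u: "u \<in> Hi" "le ?x u" "le u y" "G u = c1"
      by (rule G_IVT[OF x y(1,2), of c1]) (use c1 c2 y in auto)
    have "\<not> le y u" "\<not> le z y"
      using G_mono[of y u] G_mono[of z y] y u z c2 c3 by auto
    moreover have "open (- {w. le w u} \<inter> - {w. le z w})"
      by (intro open_Int open_Compl closed_le_sections)
    ultimately obtain n where n: "y \<in> K n" "K n \<subseteq> - {w. le w u} \<inter> - {w. le z w}"
      using K(2)[of "- {w. le w u} \<inter> - {w. le z w}" y] by blast
    have "\<exists>y\<in>K n \<inter> H. le ?x y" using n(1) y Hi_H by blast
    then have w: "s n ?x \<in> K n" "s n ?x \<in> H" "le ?x (s n ?x)" using s1 by blast+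
    then have wHi: "s n ?x \<in> Hi" using future_in_Hi[OF x] by blast
    \<comment> \<open>The selected point is comparable with \<open>u\<close> and with
      \<open>z\<close>, since the future of \<open>?x\<close> is a chain. Avoiding the past of
      \<open>u\<close> and the future of \<open>z\<close> leaves only the segment between
      them.\<close>
    have "le u (s n ?x)" "le (s n ?x) z"
      using future_chain[OF x w(2) Hi_H[OF u(1)] w(3) u(2)] future_chain[OF x w(2) Hi_H[OF z(1)] w(3) z(2)] n(2) w(1)
      by blast+
    then have "c1 \<le> G (s n ?x)" "G (s n ?x) \<le> c3"
      using G_mono[OF u(1) wHi] G_mono[OF wHi z(1)] u z by simp_all
    then have "Q n p" using c1 c2 c3 by (simp add: Q_def Gb_eq[OF wHi])
    then have "Q (LEAST n. Q n p) p" by (rule LeastI)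
    then show "le ?x (Y p) \<and> Y p \<in> Hi \<and> lo p < G (Y p) \<and> G (Y p) < hi p"
      using sHi[OF x, of "LEAST n. Q n p"] by (simp add: Q_def Y_def Gb_eq)
  qed
qed

lemma sigma_finite_m: "sigma_finite_measure m"
proof -
  have "\<forall>x\<in>H. \<exists>U. open U \<and> x \<in> U \<and> emeasure m (U \<inter> H) < \<infinity>"
    using radon_m by (simp add: radon_on_def)
  then obtain U where U: "\<And>x. x \<in> H \<Longrightarrow> open (U x) \<and> x \<in> U x \<and> emeasure m (U x \<inter> H) < \<infinity>"
    by metis
  obtain F where F: "F \<subseteq> U ` H" "countable F" "\<Union> F = \<Union> (U ` H)"
    using Lindelof[of "U ` H"] U by blast
  show ?thesis
  proof
    show "\<exists>A. countable A \<and> A \<subseteq> sets m \<and> \<Union> A = space m \<and> (\<forall>a\<in>A. emeasure m a \<noteq> \<infinity>)"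
    proof (intro exI[of _ "(\<lambda>V. V \<inter> H) ` F"] conjI)
      show "countable ((\<lambda>V. V \<inter> H) ` F)" using F(2) by simp
      show "(\<lambda>V. V \<inter> H) ` F \<subseteq> sets m" using F(1) U closed_H by (auto simp: sets_m_iff)
      show "\<Union> ((\<lambda>V. V \<inter> H) ` F) = space m"
      proof -
        have "\<Union> ((\<lambda>V. V \<inter> H) ` F) = \<Union> F \<inter> H" by blast
        also have "\<dots> = H" unfolding F(3) using U by blast
        finally show ?thesis by (simp add: space_m)
      qed
      show "\<forall>a\<in>(\<lambda>V. V \<inter> H) ` F. emeasure m a \<noteq> \<infinity>" using F(1) U by fastforce
    qed
  qed
qed

subsection \<open>Transport along rays\<close>

lemma measurable_borel_on_H:
  assumes "f \<in> borel_measurable M" "\<And>x. x \<in> space M \<Longrightarrow> f x \<in> H"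
  shows "f \<in> measurable M (borel_on H)"
  using assms by (intro measurable_restrict_space2) auto

lemma borel_on_H_to_borel:
  "f \<in> measurable M (borel_on H) \<Longrightarrow> f \<in> borel_measurable M"
  using closed_H by (simp add: measurable_restrict_space2_iff)

text \<open>\<open>NCe\<close> for random points \<open>X\<close> and \<open>Y\<close> on any
  probability space: the pair itself is a causal coupling. The curves obtained reproduce the two
  laws, but may pair starts and ends differently from \<open>(X, Y)\<close>. \<open>C\<close> bounds
  the density of the law of \<open>X\<close>.\<close>

lemma NC_transport:
  assumes "prob_space M"
    and X: "X \<in> borel_measurable M" "AE p in M. X p \<in> Hi"
    and Y: "Y \<in> borel_measurable M"
    and XY: "AE p in M. le (X p) (Y p) \<and> Y p \<in> H"
    and C: "0 < C" "\<And>B. B \<in> sets m \<Longrightarrow> emeasure M {p \<in> space M. X p \<in> B} \<le> ennreal C * emeasure m B"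
  obtains \<nu> where "prob_space \<nu>" "sets \<nu> = sets (curve_borel H)"
    "distr \<nu> borel (\<lambda>\<gamma>. \<gamma> 0) = distr M borel X" "distr \<nu> borel (\<lambda>\<gamma>. \<gamma> 1) = distr M borel Y"
    "AE \<gamma> in \<nu>. \<gamma> \<in> G_causal_curves le H G"
    "\<And>t. 0 \<le> t \<Longrightarrow> t < 1 \<Longrightarrow>
      ennreal ((1 - t) * exp (- ln C / (N - 1))) \<le> U_ent (N - 1) (distr \<nu> (borel_on H) (\<lambda>\<gamma>. \<gamma> t)) m"
proof -
  interpret M: prob_space M by fact
  let ?B = "borel_on H"
  have [simp]: "space ?B = H" by (simp add: space_restrict_space)
  have sets_B: "A \<in> sets ?B \<longleftrightarrow> A \<subseteq> H \<and> A \<in> sets borel" for A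
    using sets_m_iff sets_m by simp
  have "\<exists>p. X p \<in> Hi"
    using eventually_happens'[OF M.ae_filter_bot X(2)] by blast
  then obtain h where h: "h \<in> H" using Hi_H by blast
  \<comment> \<open>Measures on \<open>H\<close> need maps with values in \<open>H\<close>
    everywhere; the default \<open>h\<close> changes \<open>X\<close> and \<open>Y\<close> only on a
    null set.\<close>
  define X' where "X' p = (if X p \<in> H then X p else h)" for p
  define Y' where "Y' p = (if Y p \<in> H then Y p else h)" for p
  note [measurable] = X(1) Y
  have HB [measurable]: "H \<in> sets borel" using closed_H by simp
  have X'b [measurable]: "X' \<in> borel_measurable M" and Y'b [measurable]: "Y' \<in> borel_measurable M"
    unfolding X'_def Y'_def by measurable
  have X' [measurable]: "X' \<in> measurable M ?B" and Y' [measurable]: "Y' \<in> measurable M ?B"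
    using X'b Y'b h by (auto intro!: measurable_borel_on_H simp: X'_def Y'_def)
  have eqX: "AE p in M. X' p = X p" and eqY: "AE p in M. Y' p = Y p"
    using X(2) XY by (auto simp: X'_def Y'_def Hi_H)
  let ?\<mu>0 = "distr M ?B X'" and ?\<mu>1 = "distr M ?B Y'"
  have id: "(\<lambda>z. z) \<in> borel_measurable ?B" by (rule measurable_restrict_space1) simp
  have fg: "fst \<in> borel_measurable (?B \<Otimes>\<^sub>M ?B)" "snd \<in> borel_measurable (?B \<Otimes>\<^sub>M ?B)"
    using measurable_compose[OF measurable_fst id] measurable_compose[OF measurable_snd id] by auto
  have "distr M (?B \<Otimes>\<^sub>M ?B) (\<lambda>p. (X' p, Y' p)) \<in> causal_couplings le H ?\<mu>0 ?\<mu>1"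
    unfolding causal_couplings_def
  proof (intro CollectI conjI)
    show "prob_space (distr M (?B \<Otimes>\<^sub>M ?B) (\<lambda>p. (X' p, Y' p)))"
      by (intro M.prob_space_distr) measurable
    show "distr (distr M (?B \<Otimes>\<^sub>M ?B) (\<lambda>p. (X' p, Y' p))) ?B fst = ?\<mu>0"
      "distr (distr M (?B \<Otimes>\<^sub>M ?B) (\<lambda>p. (X' p, Y' p))) ?B snd = ?\<mu>1"
      by (simp_all add: distr_distr comp_def)
    show "AE p in distr M (?B \<Otimes>\<^sub>M ?B) (\<lambda>p. (X' p, Y' p)). le (fst p) (snd p)"
    proof (subst AE_distr_iff)
      show "AE p in M. le (fst (X' p, Y' p)) (snd (X' p, Y' p))"
        using XY eqX eqY by eventually_elim simp
    qed (use sets_le[OF fg] in auto)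
  qed simp
  then have "causal_couplings le H ?\<mu>0 ?\<mu>1 \<noteq> {}" by blast
  moreover have p0: "prob_space ?\<mu>0" and "prob_space ?\<mu>1" by (auto intro!: M.prob_space_distr)
  ultimately have "\<exists>\<nu>\<in>OptGeo le H G ?\<mu>0 ?\<mu>1. \<forall>t\<in>{0..1}.
      ennreal (1 - t) * U_ent (N - 1) ?\<mu>0 m + ennreal t * U_ent (N - 1) ?\<mu>1 m
       \<le> U_ent (N - 1) (distr \<nu> ?B (\<lambda>\<gamma>. \<gamma> t)) m"
    by (intro NC[unfolded NCe_def, rule_format] conjI) simp_all
  then obtain \<nu> where \<nu>: "\<nu> \<in> OptGeo le H G ?\<mu>0 ?\<mu>1"
    and U: "\<And>t. t \<in> {0..1} \<Longrightarrow> ennreal (1 - t) * U_ent (N - 1) ?\<mu>0 m + ennreal t * U_ent (N - 1) ?\<mu>1 m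
       \<le> U_ent (N - 1) (distr \<nu> ?B (\<lambda>\<gamma>. \<gamma> t)) m"
    by blast
  have sets: "sets \<nu> = sets (curve_borel H)" using \<nu> by (simp add: OptGeo_def)
  have eval: "(\<lambda>\<gamma>. \<gamma> t) \<in> measurable \<nu> ?B" if "t \<in> {0..1}" for t
    using measurable_curve_eval[OF that] by (subst measurable_cong_sets[OF sets refl])
  have d: "distr \<nu> borel (\<lambda>\<gamma>. \<gamma> t) = distr (distr \<nu> ?B (\<lambda>\<gamma>. \<gamma> t)) borel (\<lambda>z. z)" if "t \<in> {0..1}" for t
    using eval[OF that] id by (subst distr_distr) (auto simp: comp_def)
  show thesis
  proof
    show "prob_space \<nu>" "AE \<gamma> in \<nu>. \<gamma> \<in> G_causal_curves le H G" using \<nu> by (simp_all add: OptGeo_def)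
    have "distr \<nu> borel (\<lambda>\<gamma>. \<gamma> 0) = distr ?\<mu>0 borel (\<lambda>z. z)"
      using \<nu> by (subst d) (auto simp: OptGeo_def)
    also have "\<dots> = distr M borel X'" using X' id by (subst distr_distr) (auto simp: comp_def)
    also have "\<dots> = distr M borel X" by (rule distr_cong_AE[OF refl refl eqX]) measurable
    finally show "distr \<nu> borel (\<lambda>\<gamma>. \<gamma> 0) = distr M borel X" .
    have "distr \<nu> borel (\<lambda>\<gamma>. \<gamma> 1) = distr ?\<mu>1 borel (\<lambda>z. z)"
      using \<nu> by (subst d) (auto simp: OptGeo_def)
    also have "\<dots> = distr M borel Y'" using Y' id by (subst distr_distr) (auto simp: comp_def)
    also have "\<dots> = distr M borel Y" by (rule distr_cong_AE[OF refl refl eqY]) measurable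
    finally show "distr \<nu> borel (\<lambda>\<gamma>. \<gamma> 1) = distr M borel Y" .
    fix t :: real assume t: "0 \<le> t" "t < 1"
    have "ennreal (exp (- ln C / (N - 1))) \<le> U_ent (N - 1) ?\<mu>0 m"
    proof (rule U_ent_lower_bound[OF sigma_finite_m p0 _ C(1)])
      show "sets ?\<mu>0 = sets m" by (simp add: sets_m)
      show "0 < N - 1" using N by simp
      fix A assume A: "A \<in> sets m"
      then have AB: "A \<in> sets ?B" by (simp add: sets_m)
      then have [measurable]: "A \<in> sets borel" by (simp add: sets_B)
      have "emeasure ?\<mu>0 A = emeasure M (X' -` A \<inter> space M)"
        by (rule emeasure_distr[OF X' AB])
      also have "\<dots> = emeasure M {p \<in> space M. X p \<in> A}"
      proof (rule emeasure_eq_AE)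
        show "AE p in M. p \<in> X' -` A \<inter> space M \<longleftrightarrow> p \<in> {p \<in> space M. X p \<in> A}"
          using eqX by eventually_elim auto
        show "X' -` A \<inter> space M \<in> M.events" by (rule measurable_sets[OF X' AB])
      qed measurable
      also have "\<dots> \<le> ennreal C * emeasure m A" by (rule C(2)[OF A])
      finally show "emeasure ?\<mu>0 A \<le> ennreal C * emeasure m A" .
    qed
    then have "ennreal (1 - t) * ennreal (exp (- ln C / (N - 1))) \<le> ennreal (1 - t) * U_ent (N - 1) ?\<mu>0 m"
      by (intro mult_left_mono) auto
    \<comment> \<open>The law of \<open>Y\<close> may be singular, so its nonnegative term is simply
      discarded.\<close>
    also have "\<dots> \<le> \<dots> + ennreal t * U_ent (N - 1) ?\<mu>1 m" by (rule add_increasing2) auto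
    also have "\<dots> \<le> U_ent (N - 1) (distr \<nu> ?B (\<lambda>\<gamma>. \<gamma> t)) m" using t by (intro U) auto
    finally show "ennreal ((1 - t) * exp (- ln C / (N - 1))) \<le> U_ent (N - 1) (distr \<nu> ?B (\<lambda>\<gamma>. \<gamma> t)) m"
      using t by (simp add: ennreal_mult)
  qed (rule sets)
qed

lemma transport_null_set:
  assumes sets: "sets \<nu> = sets (curve_borel H)" and t: "t \<in> {0..1}"
    and U: "0 < U_ent K (distr \<nu> (borel_on H) (\<lambda>\<gamma>. \<gamma> t)) m" and Z: "Z \<in> null_sets m"
  shows "AE \<gamma> in \<nu>. \<gamma> t \<notin> Z"
proof -
  let ?\<mu> = "distr \<nu> (borel_on H) (\<lambda>\<gamma>. \<gamma> t)"
  have eval: "(\<lambda>\<gamma>. \<gamma> t) \<in> measurable \<nu> (borel_on H)"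
    using measurable_curve_eval[OF t] by (subst measurable_cong_sets[OF sets refl])
  have Zs: "Z \<in> sets (borel_on H)" using Z sets_m by auto
  have "density m (RN_deriv m ?\<mu>) = ?\<mu>" using U by (rule U_ent_pos_density)
  moreover have "emeasure (density m (RN_deriv m ?\<mu>)) Z = 0"
    using Z by (subst emeasure_density) (auto simp: null_sets_def nn_integral_null_set)
  ultimately have "emeasure ?\<mu> Z = 0" by (simp only:)
  then have "emeasure \<nu> ((\<lambda>\<gamma>. \<gamma> t) -` Z \<inter> space \<nu>) = 0"
    using emeasure_distr[OF eval Zs] by simp
  then show ?thesis
    using measurable_sets[OF eval Zs] by (intro AE_I[where N = "(\<lambda>\<gamma>. \<gamma> t) -` Z \<inter> space \<nu>"]) auto
qed

text \<open>With b the measure of \<open>P\<close>, the two entropy bounds read (1 - t) C^(-1/(N -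
  1)) \<le> U \<le> b^(1/(N - 1)); the claim is the (N - 1)-th power. As \<open>P\<close> is
  measurable only for the completion, a set \<open>B\<close> of \<open>sets m\<close> that contains
  it and has the same measure takes its place.\<close>

lemma transport_measure_bound:
  assumes prob: "prob_space \<nu>" and sets: "sets \<nu> = sets (curve_borel H)" and t: "0 \<le> t" "t < 1" and "0 < C"
    and U: "ennreal ((1 - t) * exp (- ln C / (N - 1))) \<le> U_ent (N - 1) (distr \<nu> (borel_on H) (\<lambda>\<gamma>. \<gamma> t)) m"
    and P: "P \<in> sets (completion m)" "AE \<gamma> in \<nu>. \<gamma> t \<in> P"
  shows "ennreal ((1 - t) powr (N - 1) / C) \<le> emeasure (completion m) P"
proof -
  interpret prob_space \<nu> by fact
  have tI: "t \<in> {0..1}" using t by simp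
  let ?K = "N - 1" and ?\<mu> = "distr \<nu> (borel_on H) (\<lambda>\<gamma>. \<gamma> t)"
  have K: "0 < ?K" using N by simp
  have eval: "(\<lambda>\<gamma>. \<gamma> t) \<in> measurable \<nu> (borel_on H)"
    using measurable_curve_eval[OF tI] by (subst measurable_cong_sets[OF sets refl])
  obtain B where "P \<subseteq> B" "B \<in> sets m" "B - P \<in> null_sets (completion m)"
      "emeasure (completion m) P = emeasure m B"
    by (rule completion_upper[OF P(1)])
  note B = this(2,1,4)
  have Bs: "B \<in> sets (borel_on H)" using B(1) sets_m by simp
  have inB: "AE \<gamma> in \<nu>. \<gamma> t \<in> B" using P(2) B(2) by auto
  have pos: "0 < U_ent ?K ?\<mu> m"
  proof (rule less_le_trans[OF _ U])
    show "0 < ennreal ((1 - t) * exp (- ln C / ?K))" using t by simp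
  qed
  have "emeasure m B \<noteq> 0"
  proof
    assume "emeasure m B = 0"
    with B(1) have "B \<in> null_sets m" by auto
    from transport_null_set[OF sets tI pos this] inB have "AE \<gamma> in \<nu>. False"
      by eventually_elim simp
    then show False by simp
  qed
  show ?thesis
  proof (cases "emeasure m B")
    case top
    then show ?thesis by (simp add: B(3))
  next
    case (real b)
    with \<open>emeasure m B \<noteq> 0\<close> have b: "0 < b" by (auto simp: order.strict_iff_order)
    have "prob_space ?\<mu>" by (rule prob_space_distr[OF eval])
    moreover have "{x \<in> space (borel_on H). x \<in> B} = B"
      using sets.sets_into_space[OF Bs] by auto
    then have "AE x in ?\<mu>. x \<in> B"
      using inB Bs by (subst AE_distr_iff[OF eval]) auto
    ultimately have "U_ent ?K ?\<mu> m \<le> ennreal (exp (ln b / ?K))"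
      using U_ent_upper_bound[OF _ B(1) _ real(2) real(1) K] by blast
    with U have "ennreal ((1 - t) * exp (- ln C / ?K)) \<le> ennreal (exp (ln b / ?K))" by (rule order_trans)
    then have "(1 - t) * exp (- ln C / ?K) \<le> exp (ln b / ?K)" by simp
    then have "ln ((1 - t) * exp (- ln C / ?K)) \<le> ln (exp (ln b / ?K))"
      using t by (intro ln_mono) auto
    then have "ln (1 - t) - ln C / ?K \<le> ln b / ?K" using t by (simp add: ln_mult)
    moreover have "k * u - c \<le> v" if "u - c / k \<le> v / k" "0 < k" for k u v c :: real
    proof -
      have "k * (u - c / k) \<le> k * (v / k)" using that by (intro mult_left_mono) auto
      then show ?thesis using that by (simp add: right_diff_distrib)
    qed
    ultimately have "?K * ln (1 - t) - ln C \<le> ln b" using K by blast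
    then have "exp (?K * ln (1 - t) - ln C) \<le> exp (ln b)" by simp
    then have "(1 - t) powr ?K / C \<le> b"
      using t b \<open>0 < C\<close> by (simp add: exp_diff powr_def)
    then show ?thesis unfolding B(3) real(2) by (rule ennreal_leI)
  qed
qed

lemma measurable_eval_borel:
  assumes "sets \<nu> = sets (curve_borel H)" "t \<in> {0..1}"
  shows "(\<lambda>\<gamma>. \<gamma> t) \<in> borel_measurable \<nu>"
  using measurable_curve_eval[OF assms(2)] assms(1)
  by (intro borel_on_H_to_borel) (subst measurable_cong_sets[OF assms(1) refl])

text \<open>\<pi> is the joint law of start and midpoint when the uniform law on \<open>A\<close> is
  moved to gauge values above \<open>c\<close>. The midpoint gauge is the average of the end values,
  hence the bound (G x + c)/2. At time 1/2 \<open>U_ent\<close> is positive, so the null set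
  \<open>Z\<close> is avoided.\<close>

lemma first_transport:
  assumes A: "A \<in> sets m" "A \<subseteq> Hi" "emeasure m A = ennreal a" "0 < a" and Z: "Z \<in> null_sets m"
  obtains \<pi> :: "('a \<times> 'a) measure" where "prob_space \<pi>" "sets \<pi> = sets borel"
    "AE p in \<pi>. fst p \<in> A \<and> snd p \<in> Hi - Z \<and> le (fst p) (snd p) \<and> (G (fst p) + c) / 2 < G (snd p)"
    "\<And>B. B \<in> sets borel \<Longrightarrow> emeasure \<pi> (fst -` B) = emeasure m (A \<inter> B) / ennreal a"
proof -
  let ?M = "uniform_measure m A"
  have A0: "emeasure m A \<noteq> 0" "emeasure m A \<noteq> \<infinity>" "emeasure m A < \<infinity>" using A by auto
  interpret M: prob_space ?M by (rule prob_space_uniform_measure[OF A0(1,2)])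
  have Ab: "A \<in> sets borel" using A(1) by (simp add: sets_m_iff)
  have "(\<lambda>x. x) \<in> borel_measurable (borel_on H)" by (rule measurable_restrict_space1) simp
  then have id [measurable]: "(\<lambda>x. x) \<in> borel_measurable ?M"
    by (subst measurable_cong_sets[OF _ refl, of _ "borel_on H"]) (simp_all add: sets_m)
  have inA: "AE x in ?M. x \<in> A" using A by (intro AE_uniform_measureI) auto
  \<comment> \<open>The upper limit \<open>max c (Gb x) + 1\<close> exceeds both \<open>c\<close>
    and the gauge of the start, so the window is nonempty and can be reached.\<close>
  obtain Y where Y: "Y \<in> borel_measurable ?M"
    "\<And>x. x \<in> Hi \<Longrightarrow> c < max c (Gb x) + 1 \<Longrightarrow> G x < max c (Gb x) + 1 \<Longrightarrow>
      le x (Y x) \<and> Y x \<in> Hi \<and> c < G (Y x) \<and> G (Y x) < max c (Gb x) + 1"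
    by (rule later_selection[OF id, of "\<lambda>_. c" "\<lambda>x. max c (Gb x) + 1"]) (auto simp: measurable_compose[OF id Gb_borel])
  have Y': "le x (Y x)" "Y x \<in> Hi" "c < G (Y x)" if "x \<in> A" for x
    using Y(2)[of x] that A(2) Gb_eq[of x] by (auto simp: max_def split: if_splits)
  obtain \<nu> where \<nu>: "prob_space \<nu>" "sets \<nu> = sets (curve_borel H)"
    "distr \<nu> borel (\<lambda>\<gamma>. \<gamma> 0) = distr ?M borel (\<lambda>x. x)" "distr \<nu> borel (\<lambda>\<gamma>. \<gamma> 1) = distr ?M borel Y"
    "AE \<gamma> in \<nu>. \<gamma> \<in> G_causal_curves le H G"
    "\<And>t. 0 \<le> t \<Longrightarrow> t < 1 \<Longrightarrow>
      ennreal ((1 - t) * exp (- ln (1 / a) / (N - 1))) \<le> U_ent (N - 1) (distr \<nu> (borel_on H) (\<lambda>\<gamma>. \<gamma> t)) m"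
  proof (rule NC_transport[OF M.prob_space_axioms id _ Y(1), where C = "1 / a"])
    show "AE x in ?M. x \<in> Hi" using inA by eventually_elim (use A(2) in auto)
    show "AE x in ?M. le x (Y x) \<and> Y x \<in> H"
      using inA by eventually_elim (use Y' Hi_H in auto)
    show "0 < 1 / a" using A(4) by simp
    fix B assume B: "B \<in> sets m"
    then have "{x \<in> space ?M. x \<in> B} = B" using sets.sets_into_space by auto
    then have "emeasure ?M {x \<in> space ?M. x \<in> B} = emeasure m (A \<inter> B) / ennreal a"
      using A B by simp
    also have "\<dots> \<le> emeasure m B / ennreal a"
      using B by (intro divide_right_mono_ennreal emeasure_mono) auto
    also have "\<dots> = ennreal (1 / a) * emeasure m B"
      using A(4) by (simp add: divide_ennreal_def inverse_ennreal mult.commute inverse_eq_divide)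
    finally show "emeasure ?M {x \<in> space ?M. x \<in> B} \<le> ennreal (1 / a) * emeasure m B" .
  qed (rule that)
  have e: "(\<lambda>\<gamma>. \<gamma> 0) \<in> borel_measurable \<nu>" "(\<lambda>\<gamma>. \<gamma> (1/2)) \<in> borel_measurable \<nu>" "(\<lambda>\<gamma>. \<gamma> 1) \<in> borel_measurable \<nu>"
    by (rule measurable_eval_borel[OF \<nu>(2)]; simp)+
  have pair: "(\<lambda>\<gamma>. (\<gamma> 0, \<gamma> (1/2))) \<in> borel_measurable \<nu>"
    by (intro borel_measurable_Pair e)
  let ?\<pi> = "distr \<nu> borel (\<lambda>\<gamma>. (\<gamma> 0, \<gamma> (1/2)))"
  interpret \<nu>: prob_space \<nu> by (rule \<nu>(1))
  have 0: "AE \<gamma> in \<nu>. \<gamma> 0 \<in> A" by (rule AE_law_transfer[OF \<nu>(3) e(1) id Ab inA])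
  have D: "{x \<in> Hi. c < Gb x} \<in> sets borel"
  proof -
    have "{x \<in> space borel. c < Gb x} \<in> sets borel" by measurable
    then have "Hi \<inter> {x \<in> space borel. c < Gb x} \<in> sets borel" by (intro sets.Int Hi_borel)
    also have "Hi \<inter> {x \<in> space borel. c < Gb x} = {x \<in> Hi. c < Gb x}" by auto
    finally show ?thesis .
  qed
  have 1: "AE \<gamma> in \<nu>. \<gamma> 1 \<in> {x \<in> Hi. c < Gb x}"
    by (rule AE_law_transfer[OF \<nu>(4) e(3) Y(1) D]) (use inA in eventually_elim, use Y' Gb_eq in auto)
  have 2: "AE \<gamma> in \<nu>. \<gamma> (1/2) \<notin> Z"
  proof (rule transport_null_set[OF \<nu>(2) _ _ Z])
    show "0 < U_ent (N - 1) (distr \<nu> (borel_on H) (\<lambda>\<gamma>. \<gamma> (1/2))) m"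
      by (rule less_le_trans[OF _ \<nu>(6)]) auto
  qed simp
  have Zb: "Z \<in> sets borel" using Z by (auto simp: sets_m_iff dest: null_setsD2)
  have AE: "AE \<gamma> in \<nu>. \<gamma> 0 \<in> A \<and> \<gamma> (1/2) \<in> Hi - Z \<and> le (\<gamma> 0) (\<gamma> (1/2)) \<and> (Gb (\<gamma> 0) + c) / 2 < Gb (\<gamma> (1/2))"
    using 0 1 2 \<nu>(5)
  proof eventually_elim
    case (elim \<gamma>)
    then have Hi: "\<gamma> 0 \<in> Hi" "\<gamma> 1 \<in> Hi" using A(2) by auto
    note aff = G_causal_curve_affine[OF elim(4) Hi, of "1/2"]
    have "\<gamma> (1/2) \<in> Hi" "le (\<gamma> 0) (\<gamma> (1/2))" "G (\<gamma> (1/2)) = (1 - 1/2) * G (\<gamma> 0) + 1/2 * G (\<gamma> 1)"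
      by (rule aff; simp)+
    moreover have "c < G (\<gamma> 1)" using elim(2) Gb_eq[OF Hi(2)] by simp
    ultimately show ?case using elim Gb_eq Hi(1) by simp
  qed
  show thesis
  proof
    show "prob_space ?\<pi>" by (rule \<nu>.prob_space_distr[OF pair])
    show "sets ?\<pi> = sets borel" by simp
    define Q where "Q = {p. fst p \<in> A \<and> snd p \<in> Hi - Z \<and> le (fst p) (snd p) \<and> (Gb (fst p) + c) / 2 < Gb (snd p)}"
    have QE: "Q = {p \<in> space borel. fst p \<in> A \<and> snd p \<in> Hi - Z \<and> (Gb (fst p) + c) / 2 < Gb (snd p)} \<inter> {(x, y). le x y}"
      by (auto simp: Q_def)
    have m1: "{(x, y). le x y} \<in> sets borel" using closed_le by simp
    have m2: "{p \<in> space borel. fst p \<in> A \<and> snd p \<in> Hi - Z \<and> (Gb (fst p) + c) / 2 < Gb (snd p)} \<in> sets borel"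
    proof -
      have [measurable]: "A \<in> sets borel" "Hi - Z \<in> sets borel" using Ab Hi_borel Zb by auto
      have [measurable]: "fst \<in> borel_measurable (borel :: ('a \<times> 'a) measure)" "snd \<in> borel_measurable (borel :: ('a \<times> 'a) measure)"
        by (auto intro!: borel_measurable_continuous_onI continuous_intros)
      show ?thesis by measurable
    qed
    have "Q \<in> sets borel" unfolding QE by (intro sets.Int m1 m2)
    then have "{p \<in> space borel. p \<in> Q} \<in> sets borel" by simp
    from AE_distr_iff[OF pair this] have "AE p in ?\<pi>. p \<in> Q"
      using AE by (simp add: Q_def)
    then show "AE p in ?\<pi>. fst p \<in> A \<and> snd p \<in> Hi - Z \<and> le (fst p) (snd p) \<and> (G (fst p) + c) / 2 < G (snd p)"
      by eventually_elim (use A(2) Gb_eq in \<open>auto simp: Q_def\<close>)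
    fix B :: "'a set" assume B: "B \<in> sets borel"
    have fB: "fst -` B \<in> sets (borel :: ('a \<times> 'a) measure)"
      using measurable_sets[OF borel_measurable_continuous_onI[OF continuous_on_fst[OF continuous_on_id]] B] by simp
    have "emeasure ?\<pi> (fst -` B) = emeasure \<nu> ((\<lambda>\<gamma>. \<gamma> 0) -` B \<inter> space \<nu>)"
      by (subst emeasure_distr[OF pair fB]) (simp add: vimage_def)
    also have "\<dots> = emeasure (distr ?M borel (\<lambda>x. x)) B"
      using emeasure_distr[OF e(1) B] \<nu>(3) by simp
    also have "\<dots> = emeasure ?M (B \<inter> H)"
      by (subst emeasure_distr[OF id B]) (simp add: space_m)
    also have "\<dots> = emeasure m (A \<inter> B) / ennreal a"
    proof -
      have "B \<inter> H \<in> sets m" using B closed_H by (simp add: sets_m_iff)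
      moreover have "A \<inter> (B \<inter> H) = A \<inter> B" using A(2) Hi_subset by blast
      ultimately show ?thesis using A(1,3) by simp
    qed
    finally show "emeasure ?\<pi> (fst -` B) = emeasure m (A \<inter> B) / ennreal a" .
  qed
qed

text \<open>\<pi> is conditioned on \<open>V\<close>; each \<open>q\<close> in \<open>V\<close> is
  sent along the ray of \<open>fst q\<close> into the gauge window of width \<epsilon> above
  \<open>lo q\<close>. Conditioning multiplies the density bound \<open>c\<close> by 1/p. Since a
  curve ending in the window of \<open>q\<close> may start elsewhere in \<open>A\<close>, the
  hypothesis \<open>land\<close> lets the start x vary independently of \<open>q\<close>.\<close>

lemma second_transport:
  fixes \<pi> :: "('a \<times> 'a) measure"
  assumes \<pi>: "prob_space \<pi>" "sets \<pi> = sets borel"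
    and V: "V \<in> sets borel" "emeasure \<pi> V = ennreal p" "0 < p" "V \<subseteq> A \<times> UNIV" and A: "A \<in> sets borel" "A \<subseteq> Hi"
    and c: "0 < c" "\<And>B. B \<in> sets m \<Longrightarrow> emeasure \<pi> (fst -` B) \<le> ennreal c * emeasure m B"
    and lo: "lo \<in> borel_measurable borel" and \<epsilon>: "0 < \<epsilon>" and t: "0 \<le> t" "t < 1" and P: "P \<in> sets (completion m)"
    and up: "\<And>q. q \<in> V \<Longrightarrow> G (fst q) < lo q + \<epsilon>"
    and land: "\<And>q x w z. q \<in> V \<Longrightarrow> x \<in> A \<Longrightarrow> w \<in> Hi \<Longrightarrow> z \<in> Hi \<Longrightarrow> le (fst q) w \<Longrightarrow> lo q < G w \<Longrightarrow> G w < lo q + \<epsilon> \<Longrightarrow>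
      le x z \<Longrightarrow> le z w \<Longrightarrow> G z = (1 - t) * G x + t * G w \<Longrightarrow> z \<in> P"
  shows "ennreal ((1 - t) powr (N - 1) * (p / c)) \<le> emeasure (completion m) P"
proof -
  interpret \<pi>: prob_space \<pi> by fact
  have sp [simp]: "space \<pi> = UNIV" using sets_eq_imp_space_eq[OF \<pi>(2)] by simp
  have V\<pi>: "V \<in> sets \<pi>" using V(1) \<pi>(2) by simp
  let ?M = "uniform_measure \<pi> V"
  have V0: "emeasure \<pi> V \<noteq> 0" "emeasure \<pi> V \<noteq> \<infinity>" using V by auto
  interpret M: prob_space ?M by (rule prob_space_uniform_measure[OF V0])
  have meas: "f \<in> borel_measurable borel \<Longrightarrow> f \<in> borel_measurable ?M" for f :: "'a \<times> 'a \<Rightarrow> 'b::topological_space"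
    using \<pi>(2) by (subst measurable_cong_sets[OF _ refl, of _ borel]) simp_all
  have fst: "fst \<in> borel_measurable ?M"
    by (intro meas borel_measurable_continuous_onI continuous_intros)
  have loM [measurable]: "lo \<in> borel_measurable ?M" by (rule meas[OF lo])
  have VA: "fst q \<in> A" if "q \<in> V" for q using V(4) that by (auto simp: mem_Times_iff)
  have inV: "AE q in ?M. q \<in> V" using V\<pi> by (intro AE_uniform_measureI) auto
  obtain Y where Y: "Y \<in> borel_measurable ?M"
    "\<And>q. fst q \<in> Hi \<Longrightarrow> lo q < lo q + \<epsilon> \<Longrightarrow> G (fst q) < lo q + \<epsilon> \<Longrightarrow>
      le (fst q) (Y q) \<and> Y q \<in> Hi \<and> lo q < G (Y q) \<and> G (Y q) < lo q + \<epsilon>"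
    by (rule later_selection[OF fst, of lo "\<lambda>q. lo q + \<epsilon>"]) auto
  have Y': "le (fst q) (Y q)" "Y q \<in> Hi" "lo q < G (Y q)" "G (Y q) < lo q + \<epsilon>" if "q \<in> V" for q
    using Y(2)[of q] up[OF that] \<epsilon> VA[OF that] A(2) by auto
  obtain \<nu> where \<nu>: "prob_space \<nu>" "sets \<nu> = sets (curve_borel H)"
    "distr \<nu> borel (\<lambda>\<gamma>. \<gamma> 0) = distr ?M borel fst" "distr \<nu> borel (\<lambda>\<gamma>. \<gamma> 1) = distr ?M borel Y"
    "AE \<gamma> in \<nu>. \<gamma> \<in> G_causal_curves le H G"
    "\<And>t. 0 \<le> t \<Longrightarrow> t < 1 \<Longrightarrow>
      ennreal ((1 - t) * exp (- ln (c / p) / (N - 1))) \<le> U_ent (N - 1) (distr \<nu> (borel_on H) (\<lambda>\<gamma>. \<gamma> t)) m"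
  proof (rule NC_transport[OF M.prob_space_axioms fst _ Y(1), where C = "c / p"])
    show "AE q in ?M. fst q \<in> Hi" using inV by eventually_elim (use VA A(2) in auto)
    show "AE q in ?M. le (fst q) (Y q) \<and> Y q \<in> H" using inV by eventually_elim (use Y' Hi_H in auto)
    show "0 < c / p" using c(1) V(3) by simp
    fix B assume B: "B \<in> sets m"
    then have fB: "fst -` B \<in> sets \<pi>"
      using measurable_sets[OF fst, of B] by (simp add: sets_m_iff)
    have "emeasure ?M {q \<in> space ?M. fst q \<in> B} = emeasure \<pi> (V \<inter> fst -` B) / ennreal p"
      using V\<pi> fB V(2) by (simp add: vimage_def)
    also have "\<dots> \<le> emeasure \<pi> (fst -` B) / ennreal p"
      using fB by (intro divide_right_mono_ennreal emeasure_mono) auto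
    also have "\<dots> \<le> (ennreal c * emeasure m B) / ennreal p"
      by (intro divide_right_mono_ennreal c(2)[OF B])
    also have "\<dots> = ennreal (c / p) * emeasure m B"
      using V(3) c(1) by (simp add: divide_ennreal_def inverse_ennreal ennreal_mult'' ennreal_mult divide_inverse ac_simps)
    finally show "emeasure ?M {q \<in> space ?M. fst q \<in> B} \<le> ennreal (c / p) * emeasure m B" .
  qed (rule that)
  have e: "(\<lambda>\<gamma>. \<gamma> 0) \<in> borel_measurable \<nu>" "(\<lambda>\<gamma>. \<gamma> 1) \<in> borel_measurable \<nu>"
    by (rule measurable_eval_borel[OF \<nu>(2)]; simp)+
  have 0: "AE \<gamma> in \<nu>. \<gamma> 0 \<in> A"
    by (rule AE_law_transfer[OF \<nu>(3) e(1) fst A(1)]) (use inV in eventually_elim, use VA in auto)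
  obtain C where C: "C \<in> sets borel" "C \<subseteq> Y ` V" "AE q in ?M. Y q \<in> C"
  proof -
    have pair: "(\<lambda>q. (q, Y q)) \<in> borel_measurable ?M"
      by (intro borel_measurable_Pair Y(1) meas) simp
    let ?R = "distr ?M borel (\<lambda>q. (q, Y q))"
    have Yb: "Y \<in> borel_measurable borel"
      using Y(1) \<pi>(2) by (subst (asm) measurable_cong_sets[OF _ refl, of _ borel]) simp_all
    let ?Q = "{r. fst r \<in> V \<and> snd r = Y (fst r)}"
    have [measurable]: "fst \<in> borel_measurable (borel :: (('a \<times> 'a) \<times> 'a) measure)" "snd \<in> borel_measurable (borel :: (('a \<times> 'a) \<times> 'a) measure)"
      by (auto intro!: borel_measurable_continuous_onI continuous_intros)
    note [measurable] = V(1) measurable_compose[OF \<open>fst \<in> borel_measurable (borel :: (('a \<times> 'a) \<times> 'a) measure)\<close> Yb]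
    have "{r \<in> space (borel :: (('a \<times> 'a) \<times> 'a) measure). fst r \<in> V \<and> dist (snd r) (Y (fst r)) = 0} \<in> sets borel"
      by measurable
    then have Q: "?Q \<in> sets borel" by simp
    obtain C where C: "C \<in> sets borel" "C \<subseteq> snd ` ?Q" "emeasure ?R (?Q - snd -` C) = 0"
    proof (rule borel_image_core[of ?R ?Q snd])
      show "finite_measure ?R" using M.prob_space_distr[OF pair] by (simp add: prob_space_def)
      show "continuous_on UNIV snd" by (intro continuous_intros)
    qed (use Q in auto)
    have sC: "snd -` C \<in> sets (borel :: (('a \<times> 'a) \<times> 'a) measure)"
      using measurable_sets[OF borel_measurable_continuous_onI[OF continuous_on_snd[OF continuous_on_id]] C(1)] by simp
    have "?Q - snd -` C \<in> null_sets ?R" using C(3) Q sC by auto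
    then have ae: "AE r in ?R. r \<notin> ?Q - snd -` C" by (rule AE_not_in)
    have S: "{r \<in> space borel. r \<notin> ?Q - snd -` C} \<in> sets borel"
    proof -
      have "space borel - (?Q - snd -` C) \<in> sets borel" by (intro sets.Diff sets.top Q sC)
      also have "space borel - (?Q - snd -` C) = {r \<in> space borel. r \<notin> ?Q - snd -` C}" by blast
      finally show ?thesis .
    qed
    have "AE q in ?M. (q, Y q) \<notin> ?Q - snd -` C"
      by (rule AE_distr_iff[OF pair S, THEN iffD1, OF ae])
    with inV have "AE q in ?M. Y q \<in> C" by eventually_elim auto
    moreover have "C \<subseteq> Y ` V" using C(2) by auto
    ultimately show thesis using C(1) that by blast
  qed
  have 1: "AE \<gamma> in \<nu>. \<gamma> 1 \<in> C" by (rule AE_law_transfer[OF \<nu>(4) e(2) Y(1) C(1,3)])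
  have "AE \<gamma> in \<nu>. \<gamma> t \<in> P"
    using 0 1 \<nu>(5)
  proof eventually_elim
    case (elim \<gamma>)
    then obtain q where q: "q \<in> V" "\<gamma> 1 = Y q" using C(2) by blast
    note Yq = Y'[OF q(1), folded q(2)]
    have Hi: "\<gamma> 0 \<in> Hi" using elim(1) A(2) by blast
    have tI: "t \<in> {0..1}" using t by simp
    note aff = G_causal_curve_affine[OF elim(3) Hi Yq(2) tI]
    show "\<gamma> t \<in> P"
      by (rule land[OF q(1) elim(1) Yq(2) aff(1) Yq(1,3,4) aff(2,3,4)])
  qed
  then have "ennreal ((1 - t) powr (N - 1) / (c / p)) \<le> emeasure (completion m) P"
    using t c(1) V(3) by (intro transport_measure_bound[OF \<nu>(1,2) t _ \<nu>(6)[OF t] P]) auto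
  then show ?thesis by simp
qed

subsection \<open>Comparison of thickenings\<close>

lemma acausal_unique:
  assumes S: "S \<subseteq> Hi" "acausal le S" and y: "y \<in> S" "y' \<in> S"
    and x: "x \<in> Hi" "le x y \<or> le y x" "le x y' \<or> le y' x"
  shows "y = y'"
proof (rule ccontr)
  assume "y \<noteq> y'"
  have "le y y' \<or> le y' y"
    by (rule comparable_trans[OF x(1) _ _ x(2,3)]) (use S(1) y in auto)
  then show False using S(2) y \<open>y \<noteq> y'\<close> unfolding acausal_def by metis
qed

text \<open>The measurability of the thickenings says that the distance to \<open>S\<close> along rays is
  measurable, but only where it is positive.\<close>

lemma measurable_distance:
  assumes S: "S \<subseteq> Hi" "acausal le S" and meas: "minkowski_measurable le H G m S"
  obtains g Z where "g \<in> borel_measurable borel" "Z \<in> null_sets m"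
    "\<And>x y. x \<in> Hi \<Longrightarrow> x \<notin> Z \<Longrightarrow> y \<in> S \<Longrightarrow> le y x \<Longrightarrow> y \<noteq> x \<Longrightarrow> g x = G x - G y"
    "\<And>x. x \<in> Hi \<Longrightarrow> x \<notin> Z \<Longrightarrow> 0 < g x \<Longrightarrow> \<exists>y\<in>S. le y x \<and> y \<noteq> x"
proof -
  let ?D = "{x \<in> Hi. \<exists>y\<in>S. le y x \<and> y \<noteq> x}"
  \<comment> \<open>The exact distance back to \<open>S\<close> along the ray, with default 0 off
    the strict future \<open>?D\<close> of \<open>S\<close>.\<close>
  define f :: "'a \<Rightarrow> real" where
    "f x = (if x \<in> ?D then G x - G (SOME y. y \<in> S \<and> le y x \<and> y \<noteq> x) else 0)" for x
  have f: "f x = G x - G y" if "x \<in> Hi" "y \<in> S" "le y x" "y \<noteq> x" for x y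
  proof -
    have "\<exists>y. y \<in> S \<and> le y x \<and> y \<noteq> x" using that by blast
    from someI_ex[OF this] have "(SOME y. y \<in> S \<and> le y x \<and> y \<noteq> x) = y"
      by (intro acausal_unique[OF S _ that(2) that(1)]) (use that(3) in auto)
    then show ?thesis using that unfolding f_def by auto
  qed
  have f_pos: "0 < f x \<and> (\<exists>y\<in>S. le y x \<and> y \<noteq> x \<and> f x = G x - G y)" if "x \<in> ?D" for x
    using that f G_strict_mono S(1) by fastforce
  have f0: "f x = 0" if "x \<notin> ?D" for x using that by (auto simp: f_def)
  have f_nn: "0 \<le> f x" for x using f_pos[of x] f0[of x] by (cases "x \<in> ?D") auto
  have lt: "{x \<in> space m. ennreal (f x) < a} \<in> sets (completion m)" for a
  proof -
    consider "a = 0" | "a = \<infinity>" | r where "a = ennreal r" "0 < r"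
      by (cases a) (auto simp: order.strict_iff_order)
    then show ?thesis
    proof cases
      case 2 then show ?thesis using sets.top[of "completion m"] by simp
    next
      case 3
      have T: "x \<in> forward_thickening le H G S \<epsilon> \<longleftrightarrow> x \<in> ?D \<and> f x < \<epsilon>" for x \<epsilon>
      proof
        assume "x \<in> forward_thickening le H G S \<epsilon>"
        then obtain y where y: "x \<in> Hi" "y \<in> S" "le y x" "0 < G x - G y" "G x - G y < \<epsilon>"
          unfolding forward_thickening_iff[OF S(1)] by blast
        then have "y \<noteq> x" by auto
        then show "x \<in> ?D \<and> f x < \<epsilon>" using f[OF y(1-3)] y by auto
      next
        assume x: "x \<in> ?D \<and> f x < \<epsilon>"
        then obtain y where "y \<in> S" "le y x" "f x = G x - G y" "0 < f x" using f_pos[of x] by blast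
        then show "x \<in> forward_thickening le H G S \<epsilon>"
          unfolding forward_thickening_iff[OF S(1)] using x by (intro conjI bexI[of _ y]) auto
      qed
      have D: "?D = (\<Union>n. forward_thickening le H G S (real (Suc n)))"
      proof (rule set_eqI)
        fix x
        obtain n where "f x < real n" using reals_Archimedean2 by blast
        then have "f x < real (Suc n)" by simp
        then show "x \<in> ?D \<longleftrightarrow> x \<in> (\<Union>n. forward_thickening le H G S (real (Suc n)))"
          unfolding UN_iff T by blast
      qed
      \<comment> \<open>Because of the default 0, a sublevel set consists of a thickening and the
        complement of \<open>?D\<close>, and \<open>?D\<close> is a countable union of
        thickenings.\<close>
      have r: "{x \<in> space m. ennreal (f x) < a} = (space m - ?D) \<union> forward_thickening le H G S r"
      proof (rule set_eqI)
        fix x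
        have "ennreal (f x) < a \<longleftrightarrow> f x < r" using 3(1) f_nn[of x] by (simp add: ennreal_less_iff)
        then show "x \<in> {x \<in> space m. ennreal (f x) < a} \<longleftrightarrow> x \<in> (space m - ?D) \<union> forward_thickening le H G S r"
          unfolding mem_Collect_eq Un_iff Diff_iff T space_m using f0[of x] 3(2) Hi_subset by (cases "x \<in> ?D") auto
      qed
      have th: "forward_thickening le H G S \<epsilon> \<in> sets (completion m)" if "0 < \<epsilon>" for \<epsilon>
        using meas that by (simp add: minkowski_measurable_def)
      then have "?D \<in> sets (completion m)" unfolding D by (intro sets.countable_UN) auto
      then show ?thesis
        unfolding r using th[OF 3(2)] by (intro sets.Un sets.Diff) auto
    qed simp
  qed
  have "(\<lambda>x. ennreal (f x)) \<in> borel_measurable (completion m)"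
    by (rule borel_measurableI_less) (use lt in simp)
  \<comment> \<open>Passing from the completion to a Borel function costs the null set
    \<open>Z\<close>.\<close>
  from completion_ex_borel_measurable[OF this]
  obtain g' where g': "g' \<in> borel_measurable m" "AE x in m. ennreal (f x) = g' x" by blast
  from AE_E3[OF g'(2)] obtain Z where Z: "\<And>x. x \<in> space m - Z \<Longrightarrow> ennreal (f x) = g' x" "Z \<in> null_sets m"
    by blast
  define g where "g x = (if x \<in> H then enn2real (g' x) else 0)" for x
  have fg: "g x = f x" if "x \<in> Hi" "x \<notin> Z" for x
  proof -
    have "g' x = ennreal (f x)" using Z(1)[of x] that Hi_H by (simp add: space_m)
    then show ?thesis using that Hi_H f_nn by (simp add: g_def)
  qed
  show thesis
  proof (rule that[OF _ Z(2)])
    have "g' \<in> borel_measurable (borel_on H)"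
      using g'(1) by (subst (asm) measurable_cong_sets[OF sets_m refl])
    then have "(\<lambda>x. enn2real (g' x)) \<in> borel_measurable (borel_on H)" by measurable
    then show "g \<in> borel_measurable borel"
      using closed_H unfolding g_def by (subst (asm) measurable_restrict_space_iff[where c = 0]) auto
    show "g x = G x - G y" if "x \<in> Hi" "x \<notin> Z" "y \<in> S" "le y x" "y \<noteq> x" for x y
      using fg f that by simp
    show "\<exists>y\<in>S. le y x \<and> y \<noteq> x" if "x \<in> Hi" "x \<notin> Z" "0 < g x" for x
      using fg[OF that(1,2)] f0[of x] that by force
  qed
qed

context
  fixes S1 S2 :: "'a set"
  assumes S1: "S1 \<subseteq> Hi" "acausal le S1" "minkowski_measurable le H G m S1"
    and S2: "S2 \<subseteq> Hi" "acausal le S2" "minkowski_measurable le H G m S2"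
    and S12: "S1 \<subseteq> causal_past le S2"
begin

lemma later_base_point:
  assumes "y1 \<in> S1"
  obtains y2 where "y2 \<in> S2" "le y1 y2"
  using assms S12 unfolding causal_past_def by blast

text \<open>The set measured on the left consists of the points from which a transport towards gauge
  values above \<open>c\<close> has passed \<open>S2\<close> at half time.\<close>

lemma thickening_transport_bound:
  assumes A: "A \<in> sets m" "A \<subseteq> forward_thickening le H G S1 \<epsilon>" "emeasure m A < \<infinity>"
    and \<epsilon>: "0 < \<epsilon>" and t: "0 < t" "t < 1"
  shows "ennreal ((1 - t) powr (N - 1)) *
      outer_measure_of m {x \<in> A. \<exists>y\<in>S2. (le x y \<or> le y x) \<and> G y < (G x + c) / 2}
    \<le> emeasure (completion m) (forward_thickening le H G S2 \<epsilon>)"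
proof (cases "emeasure m A = 0")
  case True
  let ?E = "{x \<in> A. \<exists>y\<in>S2. (le x y \<or> le y x) \<and> G y < (G x + c) / 2}"
  have "outer_measure_of m ?E \<le> outer_measure_of m A" by (rule outer_measure_of_mono) auto
  then have "outer_measure_of m ?E = 0" using True A(1) by simp
  then show ?thesis by simp
next
  case False
  let ?P = "forward_thickening le H G S2 \<epsilon>"
  define E where "E = {x \<in> A. \<exists>y\<in>S2. (le x y \<or> le y x) \<and> G y < (G x + c) / 2}"
  define a where "a = measure m A"
  have "emeasure m A \<noteq> \<top>" using A(3) by auto
  then have a1: "emeasure m A = ennreal a" unfolding a_def by (rule emeasure_eq_ennreal_measure)
  have "a \<noteq> 0" using False a1 by auto
  then have "0 < a" using measure_nonneg[of m A] unfolding a_def by linarith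
  note a = a1 this
  have mem: "x \<in> Hi \<and> (\<exists>y\<in>S1. le y x \<and> 0 < G x - G y \<and> G x - G y < \<epsilon>)" if "x \<in> A" for x
    using A(2) that forward_thickening_iff[OF S1(1)] by blast
  have base: "\<exists>y\<in>S1. le y x \<and> 0 < G x - G y \<and> G x - G y < \<epsilon>" if "x \<in> A" for x
    using mem[OF that] by (rule conjunct2)
  have AHi: "A \<subseteq> Hi" using mem by (intro subsetI) (rule conjunct1)
  obtain g1 Z1 where g1: "g1 \<in> borel_measurable borel" "Z1 \<in> null_sets m"
    "\<And>x y. x \<in> Hi \<Longrightarrow> x \<notin> Z1 \<Longrightarrow> y \<in> S1 \<Longrightarrow> le y x \<Longrightarrow> y \<noteq> x \<Longrightarrow> g1 x = G x - G y"
    by (rule measurable_distance[OF S1]) blast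
  obtain g2 Z2 where g2: "g2 \<in> borel_measurable borel" "Z2 \<in> null_sets m"
    "\<And>x y. x \<in> Hi \<Longrightarrow> x \<notin> Z2 \<Longrightarrow> y \<in> S2 \<Longrightarrow> le y x \<Longrightarrow> y \<noteq> x \<Longrightarrow> g2 x = G x - G y"
    "\<And>x. x \<in> Hi \<Longrightarrow> x \<notin> Z2 \<Longrightarrow> 0 < g2 x \<Longrightarrow> \<exists>y\<in>S2. le y x \<and> y \<noteq> x"
    by (rule measurable_distance[OF S2]) blast
  have Z: "Z1 \<union> Z2 \<in> null_sets m" using g1(2) g2(2) by (rule null_sets.Un)
  obtain \<pi> :: "('a \<times> 'a) measure" where \<pi>: "prob_space \<pi>" "sets \<pi> = sets borel"
    "AE p in \<pi>. fst p \<in> A \<and> snd p \<in> Hi - (Z1 \<union> Z2) \<and> le (fst p) (snd p) \<and> (G (fst p) + c) / 2 < G (snd p)"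
    "\<And>B. B \<in> sets borel \<Longrightarrow> emeasure \<pi> (fst -` B) = emeasure m (A \<inter> B) / ennreal a"
    using first_transport[OF A(1) AHi a Z, of c] by blast
  interpret \<pi>: prob_space \<pi> by fact
  have Ab: "A \<in> sets borel" using A(1) by (simp add: sets_m_iff)
  have Zb: "Z1 \<union> Z2 \<in> sets borel" using Z by (auto simp: sets_m_iff dest: null_setsD2)
  define Q where "Q = {p. fst p \<in> A \<and> snd p \<in> Hi - (Z1 \<union> Z2) \<and> le (fst p) (snd p) \<and> (Gb (fst p) + c) / 2 < Gb (snd p)}"
  have [measurable]: "fst \<in> borel_measurable (borel :: ('a \<times> 'a) measure)" "snd \<in> borel_measurable (borel :: ('a \<times> 'a) measure)"
    by (auto intro!: borel_measurable_continuous_onI continuous_intros)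
  note [measurable] = g1(1) g2(1)
  have Q: "Q \<in> sets borel"
  proof -
    have QE: "Q = {p \<in> space borel. fst p \<in> A \<and> snd p \<in> Hi - (Z1 \<union> Z2) \<and> (Gb (fst p) + c) / 2 < Gb (snd p)} \<inter> {(x, y). le x y}"
      by (auto simp: Q_def)
    have m1: "{(x, y). le x y} \<in> sets borel" using closed_le by simp
    have [measurable]: "A \<in> sets borel" "Hi - (Z1 \<union> Z2) \<in> sets borel" using Ab Hi_borel Zb by auto
    have m2: "{p \<in> space borel. fst p \<in> A \<and> snd p \<in> Hi - (Z1 \<union> Z2) \<and> (Gb (fst p) + c) / 2 < Gb (snd p)} \<in> sets borel"
      by measurable
    show ?thesis unfolding QE by (intro sets.Int m1 m2)
  qed
  have inQ: "AE p in \<pi>. p \<in> Q"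
    using \<pi>(3) by eventually_elim (use AHi Gb_eq in \<open>auto simp: Q_def\<close>)
  have QD: "fst p \<in> A" "fst p \<in> Hi" "snd p \<in> Hi" "snd p \<notin> Z1" "snd p \<notin> Z2" "le (fst p) (snd p)"
      "(G (fst p) + c) / 2 < G (snd p)" if "p \<in> Q" for p
    using that AHi Gb_eq unfolding Q_def by auto
  \<comment> \<open>Pairs whose midpoint lies strictly beyond \<open>S2\<close>; there
    \<open>g1\<close> and \<open>g2\<close> are the true distances to both sets.\<close>
  define V where "V = Q \<inter> {p. 0 < g2 (snd p)}"
  have "{p \<in> space borel. 0 < g2 (snd (p :: 'a \<times> 'a))} \<in> sets borel" by measurable
  then have V: "V \<in> sets borel" unfolding V_def using Q by (intro sets.Int) auto
  \<comment> \<open>A start in \<open>E\<close> has only midpoints beyond \<open>S2\<close>, so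
    \<open>E\<close> misses the projection of \<open>Q - V\<close>. The Borel part \<open>C\<close>
    of that projection captures almost all of \<open>Q - V\<close>, so the Borel set
    \<open>A - C\<close> contains \<open>E\<close>, while its preimage under \<open>fst\<close> has
    \<pi>-mass at most that of \<open>V\<close>.\<close>
  obtain C where C: "C \<in> sets borel" "C \<subseteq> fst ` (Q - V)" "emeasure \<pi> (Q - V - fst -` C) = 0"
  proof (rule borel_image_core[of \<pi> "Q - V" fst])
    show "finite_measure \<pi>" by unfold_locales
    show "continuous_on UNIV fst" by (intro continuous_intros)
  qed (use \<pi>(2) Q V in auto)
  have EC: "E \<subseteq> A - C"
  proof
    fix x assume x: "x \<in> E"
    have "x \<notin> C"
    proof
      assume "x \<in> C"
      then obtain p where p: "p \<in> Q" "p \<notin> V" "x = fst p" using C(2) by blast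
      note pD = QD[OF p(1)]
      obtain y where y: "y \<in> S2" "le x y \<or> le y x" "G y < (G x + c) / 2" using x by (auto simp: E_def)
      have yHi: "y \<in> Hi" using y(1) S2(1) by blast
      have "le y (snd p) \<or> le (snd p) y"
        using comparable_trans[OF pD(2) yHi pD(3)] y(2) pD(6) p(3) by blast
      moreover have "G y < G (snd p)" using y(3) pD(7) p(3) by simp
      ultimately have "le y (snd p)" "y \<noteq> snd p" using le_iff_G[OF yHi pD(3)] by auto
      then have "g2 (snd p) = G (snd p) - G y" using g2(3)[OF pD(3,5) y(1)] by blast
      then have "p \<in> V" using \<open>G y < G (snd p)\<close> p(1) by (simp add: V_def)
      with p(2) show False by blast
    qed
    with x show "x \<in> A - C" by (auto simp: E_def)
  qed
  define p where "p = measure \<pi> V"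
  have p: "emeasure \<pi> V = ennreal p" "0 \<le> p" by (simp_all add: p_def \<pi>.emeasure_eq_measure)
  have "outer_measure_of m E \<le> emeasure m (A \<inter> - C)"
  proof -
    have "A \<inter> - C \<in> sets m" using A(1) C(1) by (auto simp: sets_m_iff)
    from outer_measure_of_eq[OF this] show ?thesis
      using outer_measure_of_mono[of E "A \<inter> - C" m] EC by auto
  qed
  also have "\<dots> = ennreal a * emeasure \<pi> (fst -` (- C))"
  proof -
    have inv: "ennreal a * inverse (ennreal a) = 1"
      using a(2) by (simp add: inverse_ennreal ennreal_mult'[symmetric])
    have "ennreal a * (X / ennreal a) = X" for X
      unfolding divide_ennreal_def using inv by (metis mult.assoc mult.commute mult_1)
    then show ?thesis using C(1) by (subst \<pi>(4)) auto
  qed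
  also have "emeasure \<pi> (fst -` (- C)) \<le> emeasure \<pi> V"
  proof (rule emeasure_mono_AE)
    have "fst -` C \<in> sets \<pi>"
      using measurable_sets[OF \<open>fst \<in> borel_measurable borel\<close> C(1)] \<pi>(2) by simp
    then have "Q - V - fst -` C \<in> null_sets \<pi>" using C(3) Q V \<pi>(2) by auto
    from AE_not_in[OF this] inQ show "AE q in \<pi>. q \<in> fst -` (- C) \<longrightarrow> q \<in> V" by eventually_elim auto
    show "V \<in> sets \<pi>" using V \<pi>(2) by simp
  qed
  finally have outer: "outer_measure_of m E \<le> ennreal a * ennreal p" unfolding p by (simp add: mult_left_mono)
  show ?thesis
  proof (cases "p = 0")
    case True
    then show ?thesis using outer by (simp add: E_def)
  next
    case False
    with p(2) have "0 < p" by simp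
    \<comment> \<open>A Borel function of the midpoint alone: the first bracket is G y1 and the
      difference of distances is \<tau> = G y2 - G y1, so this is G y1 + \<tau>/t.\<close>
    define lo where "lo q = (Gb (snd q) - g1 (snd q)) + (g1 (snd q) - g2 (snd q)) / t" for q :: "'a \<times> 'a"
    have lo: "lo \<in> borel_measurable borel" unfolding lo_def by measurable
    have key: "\<exists>y1\<in>S1. \<exists>y2\<in>S2. le y1 (fst q) \<and> le y1 y2 \<and> lo q = G y1 + (G y2 - G y1) / t"
      if "q \<in> V" for q
    proof -
      have "q \<in> Q" "0 < g2 (snd q)" using that by (auto simp: V_def)
      note qD = QD[OF this(1)]
      obtain y1 where y1: "y1 \<in> S1" "le y1 (fst q)" "0 < G (fst q) - G y1" using base[OF qD(1)] by blast
      have y1Hi: "y1 \<in> Hi" using y1 S1 by blast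
      have "le y1 (snd q)" using le_trans[OF y1(2) qD(6)] .
      moreover have "G (fst q) \<le> G (snd q)" by (rule G_mono[OF qD(2,3,6)])
      ultimately have g1q: "g1 (snd q) = G (snd q) - G y1" using g1(3)[OF qD(3,4) y1(1)] y1(3) by fastforce
      obtain y2 where y2: "y2 \<in> S2" "le y2 (snd q)" "y2 \<noteq> snd q"
        using g2(4)[OF qD(3,5) \<open>0 < g2 (snd q)\<close>] by blast
      have g2q: "g2 (snd q) = G (snd q) - G y2" by (rule g2(3)[OF qD(3,5) y2])
      obtain y2' where y2': "y2' \<in> S2" "le y1 y2'" using later_base_point[OF y1(1)] .
      have "le y2' (snd q) \<or> le (snd q) y2'"
        using comparable_trans[OF y1Hi, of y2' "snd q"] y2' S2(1) qD(3) \<open>le y1 (snd q)\<close> by blast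
      then have "y2 = y2'"
        using acausal_unique[OF S2(1,2) y2(1) y2'(1) qD(3)] y2(2) by blast
      then have "le y1 y2" using y2'(2) by simp
      moreover have "lo q = G y1 + (G y2 - G y1) / t"
        unfolding lo_def g1q g2q Gb_eq[OF qD(3)] by simp
      ultimately show ?thesis using y1 y2 by blast
    qed
    \<comment> \<open>The first marginal of \<pi> is uniform on \<open>A\<close>, hence the density
      bound 1/a; p/(1/a) = a p is the bound already found for the outer measure of
      \<open>E\<close>.\<close>
    have "ennreal ((1 - t) powr (N - 1) * (p / (1 / a))) \<le> emeasure (completion m) ?P"
    proof (rule second_transport[OF \<pi>(1,2) V p(1) \<open>0 < p\<close> _ Ab AHi _ _ lo \<epsilon> _ t(2)])
      show "V \<subseteq> A \<times> UNIV" using QD(1) by (force simp: V_def)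
      show "0 < 1 / a" using a(2) by simp
      show "0 \<le> t" using t by simp
      show "?P \<in> sets (completion m)" using S2(3) \<epsilon> by (simp add: minkowski_measurable_def)
      fix B assume B: "B \<in> sets m"
      then have "emeasure \<pi> (fst -` B) = emeasure m (A \<inter> B) / ennreal a"
        by (intro \<pi>(4)) (simp add: sets_m_iff)
      also have "\<dots> \<le> emeasure m B / ennreal a"
        using B by (intro divide_right_mono_ennreal emeasure_mono) auto
      also have "\<dots> = ennreal (1 / a) * emeasure m B"
        using a(2) by (simp add: divide_ennreal_def inverse_ennreal mult.commute inverse_eq_divide)
      finally show "emeasure \<pi> (fst -` B) \<le> ennreal (1 / a) * emeasure m B" .
    next
      fix q assume "q \<in> V"
      then have fq: "fst q \<in> A" "fst q \<in> Hi" using QD by (auto simp: V_def)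
      obtain y1 y2 where y: "y1 \<in> S1" "y2 \<in> S2" "le y1 (fst q)" "le y1 y2" "lo q = G y1 + (G y2 - G y1) / t"
        using key[OF \<open>q \<in> V\<close>] by blast
      obtain y1' where y1': "y1' \<in> S1" "le y1' (fst q)" "G (fst q) - G y1' < \<epsilon>" using base[OF fq(1)] by blast
      have "y1' = y1" using acausal_unique[OF S1(1,2) y1'(1) y(1) fq(2)] y(3) y1'(2) by blast
      moreover have "G y1 \<le> G y2" using G_mono y(1,2,4) S1(1) S2(1) by blast
      then have "0 \<le> (G y2 - G y1) / t" using t by simp
      ultimately show "G (fst q) < lo q + \<epsilon>" using y(5) y1'(3) by simp
      fix x w z assume x: "x \<in> A" and w: "w \<in> Hi" and z: "z \<in> Hi" and "le (fst q) w" and Gw: "lo q < G w" "G w < lo q + \<epsilon>"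
        and xz: "le x z" and zw: "le z w" and Gz: "G z = (1 - t) * G x + t * G w"
      obtain y0 where y0: "y0 \<in> S1" "le y0 x" "0 < G x - G y0" "G x - G y0 < \<epsilon>" using base[OF x] by blast
      \<comment> \<open>Although x and \<open>fst q\<close> may differ, both precede w, so the
        points of \<open>S1\<close> below them are comparable with w and therefore equal.\<close>
      have "le y0 w" using le_trans[OF y0(2) le_trans[OF xz zw]] .
      moreover have "le y1 w" using le_trans[OF y(3) \<open>le (fst q) w\<close>] .
      ultimately have "y0 = y1" using acausal_unique[OF S1(1,2) y0(1) y(1) w] by blast
      then have Gx: "G y1 < G x" "G x < G y1 + \<epsilon>" using y0 by auto
      have "le y1 z" using le_trans[OF y0(2) xz] \<open>y0 = y1\<close> by simp
      moreover have y1Hi: "y1 \<in> Hi" and y2Hi: "y2 \<in> Hi" using y S1 S2 by blast+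
      ultimately have cmp: "le y2 z \<or> le z y2"
        using comparable_trans[OF y1Hi y2Hi z] y(4) by blast
      \<comment> \<open>Equivalently, (1 - t) G y1 + t \<open>lo q\<close> = G y2, so the convex
        combination of the two windows of width \<epsilon> is the one above G y2.\<close>
      have tl: "t * lo q = t * G y1 + (G y2 - G y1)" unfolding y(5) using t by (simp add: distrib_left)
      have "(1 - t) * G y1 < (1 - t) * G x" "(1 - t) * G x < (1 - t) * (G y1 + \<epsilon>)" "t * lo q < t * G w" "t * G w < t * (lo q + \<epsilon>)"
        using Gx Gw t by (auto intro!: mult_strict_left_mono)
      then have "G y2 < G z" "G z < G y2 + \<epsilon>"
        unfolding Gz using tl by (simp_all add: algebra_simps)
      moreover from this have "le y2 z" using le_iff_G[OF y2Hi z cmp] by simp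
      ultimately show "z \<in> ?P"
        unfolding forward_thickening_iff[OF S2(1)] using z y(2) by (intro conjI bexI[of _ y2]) auto
    qed
    moreover have "ennreal ((1 - t) powr (N - 1)) * outer_measure_of m E \<le>
        ennreal ((1 - t) powr (N - 1)) * (ennreal a * ennreal p)"
      by (intro mult_left_mono outer) simp
    moreover have "\<dots> = ennreal ((1 - t) powr (N - 1) * (p / (1 / a)))"
      using a(2) p(2) by (simp add: ennreal_mult mult.commute)
    ultimately show ?thesis unfolding E_def by simp
  qed
qed

text \<open>Each x in \<open>A\<close> shares its ray with a point of \<open>S2\<close>, so it
  satisfies the condition of \<open>thickening_transport_bound\<close> once \<open>c\<close> is
  large. The sets \<open>E n\<close> increase to \<open>A\<close>, and so do their outer measures.
  Then t tends to 0.\<close>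

lemma thickening_finite_subset_le:
  assumes A: "A \<in> sets m" "A \<subseteq> forward_thickening le H G S1 \<epsilon>" "emeasure m A < \<infinity>" and \<epsilon>: "0 < \<epsilon>"
  shows "emeasure m A \<le> emeasure (completion m) (forward_thickening le H G S2 \<epsilon>)"
proof -
  let ?P = "emeasure (completion m) (forward_thickening le H G S2 \<epsilon>)"
  define E where "E n = {x \<in> A. \<exists>y\<in>S2. (le x y \<or> le y x) \<and> G y < (G x + real n) / 2}" for n
  have "x \<in> (\<Union>n. E n)" if "x \<in> A" for x
  proof -
    have "x \<in> forward_thickening le H G S1 \<epsilon>" using A(2) that by blast
    then obtain y1 where xHi: "x \<in> Hi" and y1: "y1 \<in> S1" "le y1 x"
      unfolding forward_thickening_iff[OF S1(1)] by blast
    obtain y2 where y2: "y2 \<in> S2" "le y1 y2" using later_base_point[OF y1(1)] .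
    have "le x y2 \<or> le y2 x"
      using comparable_trans[of y1 x y2] xHi y1 y2 S1(1) S2(1) by blast
    moreover obtain n where "2 * G y2 - G x < real n" using reals_Archimedean2 by blast
    then have "G y2 < (G x + real n) / 2" by simp
    ultimately show ?thesis using y2(1) that unfolding E_def by blast
  qed
  then have UE: "(\<Union>n. E n) = A" by (auto simp: E_def)
  have "incseq E"
  proof (rule incseq_SucI, rule subsetI)
    fix n x assume "x \<in> E n"
    then obtain y where "x \<in> A" "y \<in> S2" "le x y \<or> le y x" "G y < (G x + real n) / 2"
      unfolding E_def by blast
    moreover from this have "G y < (G x + real (Suc n)) / 2" by simp
    ultimately show "x \<in> E (Suc n)" unfolding E_def by blast
  qed
  moreover have "E n \<subseteq> space m" for n using sets.sets_into_space[OF A(1)] by (auto simp: E_def)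
  ultimately have "(SUP n. outer_measure_of m (E n)) = outer_measure_of m A"
    using SUP_outer_measure_of_incseq[of E m] UE by simp
  then have sup: "(SUP n. outer_measure_of m (E n)) = emeasure m A" using A(1) by simp
  have t: "ennreal ((1 - t) powr (N - 1)) * emeasure m A \<le> ?P" if "0 < t" "t < 1" for t
  proof -
    have "ennreal ((1 - t) powr (N - 1)) * outer_measure_of m (E n) \<le> ?P" for n
      unfolding E_def by (rule thickening_transport_bound[OF A \<epsilon> that])
    then show ?thesis
      unfolding sup[symmetric] by (subst SUP_mult_left_ennreal) (intro SUP_least)
  qed
  show ?thesis
  proof (rule tendsto_upperbound[of _ _ "at_right 0"])
    have "((\<lambda>t::real. (1 - t) powr (N - 1)) \<longlongrightarrow> (1 - 0) powr (N - 1)) (at_right 0)"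
      by (intro tendsto_intros) auto
    then have "((\<lambda>t::real. ennreal ((1 - t) powr (N - 1)) * emeasure m A) \<longlongrightarrow> ennreal 1 * emeasure m A) (at_right 0)"
      using A(3) by (intro tendsto_mult_ennreal tendsto_ennrealI tendsto_const) (auto simp: less_top)
    then show "((\<lambda>t::real. ennreal ((1 - t) powr (N - 1)) * emeasure m A) \<longlongrightarrow> emeasure m A) (at_right 0)" by simp
    show "\<forall>\<^sub>F t in at_right 0. ennreal ((1 - t) powr (N - 1)) * emeasure m A \<le> ?P"
      unfolding eventually_at_right_field by (intro exI[of _ 1]) (use t in auto)
  qed simp
qed

text \<open>Reduction to subsets in \<open>sets m\<close> of finite measure: the main part of the
  first thickening carries its completed measure, and \<sigma>-finiteness exhausts it.\<close>

lemma thickening_le: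
  assumes \<epsilon>: "0 < \<epsilon>"
  shows "emeasure (completion m) (forward_thickening le H G S1 \<epsilon>) \<le> emeasure (completion m) (forward_thickening le H G S2 \<epsilon>)"
proof -
  let ?P = "forward_thickening le H G S1 \<epsilon>" and ?R = "emeasure (completion m) (forward_thickening le H G S2 \<epsilon>)"
  interpret m: sigma_finite_measure m by (rule sigma_finite_m)
  have P: "?P \<in> sets (completion m)" using S1(3) \<epsilon> by (simp add: minkowski_measurable_def)
  define B where "B = main_part m ?P"
  have B: "B \<in> sets m" "B \<subseteq> ?P" "emeasure (completion m) ?P = emeasure m B"
    unfolding B_def using P main_part_null_part_Un[OF P] by (blast, blast, simp)
  obtain F :: "nat \<Rightarrow> 'a set" where F: "range F \<subseteq> sets m" "(\<Union>i. F i) = space m" "\<And>i. emeasure m (F i) \<noteq> \<infinity>" "incseq F"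
    using m.sigma_finite_incseq by metis
  have "(SUP i. emeasure m (B \<inter> F i)) = emeasure m (\<Union>i. B \<inter> F i)"
    using B(1) F(1,4) by (intro SUP_emeasure_incseq) (auto simp: incseq_def)
  also have "(\<Union>i. B \<inter> F i) = B" using F(2) sets.sets_into_space[OF B(1)] by auto
  finally have sup: "(SUP i. emeasure m (B \<inter> F i)) = emeasure m B" .
  have "emeasure m (B \<inter> F i) \<le> ?R" for i
  proof (rule thickening_finite_subset_le[OF _ _ _ \<epsilon>])
    show "B \<inter> F i \<in> sets m" using B(1) F(1) by auto
    have "emeasure m (B \<inter> F i) \<le> emeasure m (F i)" using B(1) F(1) by (intro emeasure_mono) auto
    also have "\<dots> < \<infinity>" using F(3) by (simp add: less_top)
    finally show "emeasure m (B \<inter> F i) < \<infinity>" .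
  qed (use B(2) in auto)
  then show ?thesis unfolding B(3) sup[symmetric] by (intro SUP_least)
qed

lemma minkowski_content_mono:
  "minkowski_content le H G m S1 \<le> minkowski_content le H G m S2"
  unfolding minkowski_content_def
  by (intro Limsup_mono eventually_at_rightI[of 0 1] divide_right_mono_ennreal thickening_le) auto

end

end

theorem theorem7p3:
  fixes ll le :: "'a::{polish_space, heine_borel} \<Rightarrow> 'a \<Rightarrow> bool"
    and H S1 S2 :: "'a set"
    and G :: "'a \<Rightarrow> real"
    and m :: "'a measure"
    and N :: real
  assumes "topological_causal_space ll le"
    and "synthetic_null_hypersurface ll le H G m"
    and "null_nonbranching le H"
    and "N > 1"
    and "NCe le H G m N"
    and "future_complete le H G"
    and "measure_support m = H"
    and "S1 \<subseteq> causal_interior le H"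
    and "S2 \<subseteq> causal_interior le H"
    and "acausal le S1"
    and "acausal le S2"
    and "S1 \<subseteq> causal_past le S2"
    and "minkowski_measurable le H G m S1"
    and "minkowski_measurable le H G m S2"
  shows "minkowski_content le H G m S1 \<le> minkowski_content le H G m S2"
proof -
  interpret complete_null_hypersurface ll le H G m N
    using assms(2-6) by (intro complete_null_hypersurface.intro complete_null_hypersurface_axioms.intro)
  show ?thesis
    using assms by (intro minkowski_content_mono)
qed

end
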